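(* Let $\mathcal{M}$ be a family of probability measures on $\mathbb{R}$ such that (i) $\inf_{p\in\mathcal{M}}\mu_p>0$; (ii) $M_\tau:=\sup_{p\in\mathcal{M}}E_p[e^{\tau|X|}]<\infty$ for some $\tau>0$; (iii) each $p\in\mathcal{M}$ can be written as $p=(1-\lambda_p)\Phi_p+\lambda_p\Psi_p$ with $0\le\lambda_p<1$, where $\Phi_p,\Psi_p$ are probability measures and $\Phi_p$ has a density $\phi_p$; (iv) $\gamma:=\sup_{p\in\mathcal{M}}\lambda_p<1$; (v) there exists $T\in(0,\infty)$ such that $\phi_p\in C_0^2((-T,T))$ for all $p\in\mathcal{M}$ and $\sup_{p\in\mathcal{M}}\int_{-T}^T|\phi_p''(x)|\,dx<\infty$. Then for each $p\in\mathcal{M}$ the renewal measure decomposes as $N_p=Q_p+\bar N_p$, where $Q_p$ has a density $q_p$, $\sup_{p\in\mathcal{M}}\bar N_p(\mathbb{R})<\infty$, and there is $r_0>0$ such that for all $r\in(0,r_0)$, $$A_1:=\sup_{x>0,\,p\in\mathcal{M}}\{e^{rx}|q_p(x)-\mu_p^{-1}|\}+\sup_{x>0,\,p\in\mathcal{M}}\{e^{rx}q_p(-x)\}<\infty,$$ $$A_2:=\sup_{x>0,\,p\in\mathcal{M}}\{e^{rx}\bar N_p((-\infty,-x]\cup[x,\infty))\}<\infty.$$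
   Context: For a probability measure $p$ on $\mathbb{R}$, $\mu_p$ denotes its mean, $E_p$ denotes expectation when $X\sim p$, $p^{n*}$ is the $n$-fold convolution of $p$ with $p^{0*}:=\delta_0$, and $N_p=\sum_{n=0}^\infty p^{n*}$ is the associated renewal measure. $C_0^2((-T,T))$ denotes twice continuously differentiable functions with compact support in $(-T,T)$. *)

theory Defs
  imports "HOL-Probability.Probability" "HOL-Probability.Convolution"
begin

definition mean :: "real measure \<Rightarrow> real" where
  "mean p = (\<integral>x. x \<partial>p)"

fun conv_pow :: "real measure \<Rightarrow> nat \<Rightarrow> real measure" where
  "conv_pow p 0 = return borel 0"
| "conv_pow p (Suc n) = convolution p (conv_pow p n)"

definition renewal_measure :: "real measure \<Rightarrow> real measure" where
  "renewal_measure p =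
     measure_of UNIV (sets borel) (\<lambda>A. \<Sum>n. emeasure (conv_pow p n) A)"

definition real_prob :: "real measure \<Rightarrow> bool" where
  "real_prob p \<longleftrightarrow> prob_space p \<and> sets p = sets borel"

definition C02_with :: "real \<Rightarrow> (real \<Rightarrow> real) \<Rightarrow> (real \<Rightarrow> real) \<Rightarrow> bool" where
  "C02_with T \<phi> \<phi>2 \<longleftrightarrow>
     (\<exists>\<phi>1. (\<forall>x. (\<phi> has_real_derivative \<phi>1 x) (at x)) \<and>
           (\<forall>x. (\<phi>1 has_real_derivative \<phi>2 x) (at x)) \<and>
           continuous_on UNIV \<phi>2) \<and>
     (\<exists>a<T. \<forall>x. a < \<bar>x\<bar> \<longrightarrow> \<phi> x = 0)"

end

theory Submission
  imports Defs "HOL-Complex_Analysis.Complex_Analysis" "HOL-Real_Asymp.Real_Asymp"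
begin

text \<open>Write \<open>p = f + g\<close> with \<open>f = (1 - \<lambda>) \<phi>\<close> smooth and \<open>g = \<lambda> \<Psi>\<close> of mass at most \<open>\<gamma> < 1\<close>. The singular part is
  the renewal measure of \<open>g\<close>, a geometric series with exponential moments, and the identity
  \<open>N\<^sub>p = N\<^sub>g + N\<^sub>p * f * N\<^sub>g\<close> shows that the rest has the density \<open>q = N\<^sub>p * f * N\<^sub>g\<close>. Its bilateral Laplace
  transform \<open>L q\<close> is \<open>L f / ((1 - L g) (1 - L p))\<close>, which decays like \<open>1/\<bar>z\<bar>\<^sup>2\<close> because \<open>\<phi>''\<close> is integrable.
  Inverting it along \<open>Re z = r > 0\<close>, where all series converge, gives the bound on the negative half-line;
  moving the line to \<open>Re z = -r\<close> crosses only the simple pole at 0, which contributes \<open>1/\<mu>\<^sub>p\<close>.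
  Uniformity over the family reduces to a lower bound for \<open>\<bar>1 - L p\<bar>\<close> in a strip: near 0 it comes from
  the mean, far from 0 from the decay of \<open>L \<phi>\<close>, and the doubling inequality
  \<open>1 - \<bar>L p (2it)\<bar> \<le> 4 (1 - \<bar>L p (it)\<bar>)\<close> carries the latter bound to the remaining \<open>t\<close>.\<close>

section \<open>Convolution powers and renewal sums\<close>

text \<open>The renewal measure has infinite mass: its transform does not exist on the imaginary
  axis, and measures cannot be subtracted freely. Hence the functional \<open>renewal_sum\<close>
  with values in \<open>ennreal\<close>, and a cancellation that is first carried out on sets
  bounded above. Since the means are positive, \<open>lap p\<close> is below 1 at small
  \<open>r > 0\<close> but above 1 at \<open>-r\<close> by Jensen. So the series for
  \<open>N_p\<close> converges only to the right of the axis, and what moves to the left is the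
  kernel of the inversion integral, not the series. The series for \<open>g\<close> converges on
  both sides because the mass of \<open>g\<close> stays away from 1; this gives the singular part
  two exponential tails. Compactness in \<open>t\<close> would bound \<open>1 - lap p\<close> for
  each \<open>p\<close> separately only, so every constant is computed from the shared bounds
  \<open>c\<close>, \<open>\<tau>\<close>, \<open>C\<close>, \<open>\<gamma>\<close>,
  \<open>T\<close>, \<open>B\<close>. The smooth component is informative only far out on the axis;
  doubling brings that information back, at a loss of a factor 4 per step.\<close>

lemma finite_borel_measure_conv_pow:
  assumes "finite_borel_measure p"
  shows "finite_borel_measure (conv_pow p n)"
proof (induction n)
  case 0
  interpret prob_space "return borel (0::real)" by (rule prob_space_return) simp
  have "finite_borel_measure (return borel 0)" by unfold_locales simp
  then show ?case by simp
next
  case (Suc n)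
  interpret p: finite_borel_measure p by fact
  interpret q: finite_borel_measure "conv_pow p n" by fact
  interpret finite_measure "convolution p (conv_pow p n)"
    by (intro convolution_finite) (auto simp: p.M_is_borel q.M_is_borel p.finite_measure_axioms q.finite_measure_axioms)
  have "finite_borel_measure (convolution p (conv_pow p n))" by unfold_locales simp
  then show ?case by simp
qed

lemma sets_conv_pow [simp, measurable_cong]: "sets (conv_pow p n) = sets borel"
  by (cases n) simp_all

lemma nn_integral_conv_pow_Suc:
  assumes "finite_borel_measure p" and [measurable]: "F \<in> borel_measurable borel"
  shows "(\<integral>\<^sup>+x. F x \<partial>conv_pow p (Suc n)) = (\<integral>\<^sup>+x. \<integral>\<^sup>+y. F (x + y) \<partial>conv_pow p n \<partial>p)"
proof -
  interpret p: finite_borel_measure p by fact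
  interpret q: finite_borel_measure "conv_pow p n" by (intro finite_borel_measure_conv_pow assms)
  show ?thesis
    using p.finite_measure_axioms q.finite_measure_axioms
    by (simp add: nn_integral_convolution p.M_is_borel)
qed

lemma nn_integral_conv_pow_Suc':
  assumes "finite_borel_measure p" and [measurable]: "F \<in> borel_measurable borel"
  shows "(\<integral>\<^sup>+x. F x \<partial>conv_pow p (Suc n)) = (\<integral>\<^sup>+y. \<integral>\<^sup>+x. F (y + x) \<partial>p \<partial>conv_pow p n)"
proof -
  interpret p: finite_borel_measure p by fact
  interpret q: finite_borel_measure "conv_pow p n" by (intro finite_borel_measure_conv_pow assms)
  interpret pair_sigma_finite p "conv_pow p n" ..
  have [measurable_cong]: "sets p = sets borel" by (rule p.M_is_borel)
  have "(\<integral>\<^sup>+x. F x \<partial>conv_pow p (Suc n)) = (\<integral>\<^sup>+x. \<integral>\<^sup>+y. F (x + y) \<partial>conv_pow p n \<partial>p)"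
    by (rule nn_integral_conv_pow_Suc) (use assms in auto)
  also have "\<dots> = (\<integral>\<^sup>+y. \<integral>\<^sup>+x. F (x + y) \<partial>p \<partial>conv_pow p n)"
    by (rule Fubini'[symmetric]) simp
  finally show ?thesis by (simp add: add.commute)
qed

text \<open>The exponential turns sums into products. Being an equality, this holds for either sign
  of \<open>a\<close>, unlike the version with \<open>\<bar>x\<bar>\<close>.\<close>

lemma nn_integral_exp_conv_pow:
  assumes "finite_borel_measure p"
  shows "(\<integral>\<^sup>+x. ennreal (exp (a * x)) \<partial>conv_pow p n) = (\<integral>\<^sup>+x. ennreal (exp (a * x)) \<partial>p) ^ n"
proof (induction n)
  case (Suc n)
  interpret p: finite_borel_measure p by fact
  have [measurable_cong]: "sets p = sets borel" by (rule p.M_is_borel)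
  have "(\<integral>\<^sup>+x. ennreal (exp (a * x)) \<partial>conv_pow p (Suc n))
      = (\<integral>\<^sup>+x. \<integral>\<^sup>+y. ennreal (exp (a * x)) * ennreal (exp (a * y)) \<partial>conv_pow p n \<partial>p)"
    by (simp add: nn_integral_conv_pow_Suc[OF assms] distrib_left exp_add ennreal_mult' del: conv_pow.simps)
  also have "\<dots> = (\<integral>\<^sup>+x. ennreal (exp (a * x)) \<partial>p) ^ Suc n"
    by (simp add: nn_integral_cmult nn_integral_multc Suc)
  finally show ?case .
qed (simp add: nn_integral_return)

text \<open>The triangle inequality makes \<open>exp (a * \<bar>x\<bar>)\<close> submultiplicative.
  Weighting both directions at once is what controls both tails of the singular part.\<close>

lemma nn_integral_exp_abs_conv_pow_le:
  assumes "finite_borel_measure p" "0 \<le> a"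
  shows "(\<integral>\<^sup>+x. ennreal (exp (a * \<bar>x\<bar>)) \<partial>conv_pow p n) \<le> (\<integral>\<^sup>+x. ennreal (exp (a * \<bar>x\<bar>)) \<partial>p) ^ n"
proof (induction n)
  case (Suc n)
  interpret p: finite_borel_measure p by fact
  have [measurable_cong]: "sets p = sets borel" by (rule p.M_is_borel)
  have "(\<integral>\<^sup>+x. ennreal (exp (a * \<bar>x\<bar>)) \<partial>conv_pow p (Suc n))
      = (\<integral>\<^sup>+x. \<integral>\<^sup>+y. ennreal (exp (a * \<bar>x + y\<bar>)) \<partial>conv_pow p n \<partial>p)"
    by (simp add: nn_integral_conv_pow_Suc[OF assms(1)] del: conv_pow.simps)
  also have "\<dots> \<le> (\<integral>\<^sup>+x. \<integral>\<^sup>+y. ennreal (exp (a * \<bar>x\<bar>)) * ennreal (exp (a * \<bar>y\<bar>)) \<partial>conv_pow p n \<partial>p)"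
    using assms(2)
    by (intro nn_integral_mono)
       (auto simp: ennreal_mult'[symmetric] exp_add[symmetric] distrib_left[symmetric] intro!: mult_left_mono)
  also have "\<dots> = (\<integral>\<^sup>+x. ennreal (exp (a * \<bar>x\<bar>)) \<partial>p) * (\<integral>\<^sup>+x. ennreal (exp (a * \<bar>x\<bar>)) \<partial>conv_pow p n)"
    by (simp add: nn_integral_cmult nn_integral_multc)
  also have "\<dots> \<le> (\<integral>\<^sup>+x. ennreal (exp (a * \<bar>x\<bar>)) \<partial>p) ^ Suc n"
    using Suc by (simp add: mult_left_mono)
  finally show ?case .
qed (simp add: nn_integral_return)

section \<open>Renewal sums as functionals of nonnegative functions\<close>

text \<open>Integration against the renewal measure, kept as a series: each term concerns a finite
  measure, so Tonelli applies term by term without sigma-finiteness of the whole.\<close>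

definition renewal_sum :: "real measure \<Rightarrow> (real \<Rightarrow> ennreal) \<Rightarrow> ennreal" where
  "renewal_sum p F = (\<Sum>n. \<integral>\<^sup>+x. F x \<partial>conv_pow p n)"

lemma emeasure_renewal_measure:
  assumes "A \<in> sets borel"
  shows "emeasure (renewal_measure p) A = (\<Sum>n. emeasure (conv_pow p n) A)"
  unfolding renewal_measure_def
proof (rule emeasure_measure_of_sigma)
  show "sigma_algebra UNIV (sets (borel :: real measure))"
    by (metis sets.sigma_algebra_axioms space_borel)
  show "positive (sets borel) (\<lambda>A. \<Sum>n. emeasure (conv_pow p n) A)"
    by (simp add: positive_def)
  show "countably_additive (sets borel) (\<lambda>A. \<Sum>n. emeasure (conv_pow p n) A)"
  proof (rule countably_additiveI)
    fix A :: "nat \<Rightarrow> real set"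
    assume A: "range A \<subseteq> sets borel" "disjoint_family A"
    \<comment> \<open>One of the two series is read as an integral over counting measure, so that
      the exchange becomes monotone convergence.\<close>
    have "(\<Sum>i. \<Sum>n. emeasure (conv_pow p n) (A i)) = (\<Sum>n. \<Sum>i. emeasure (conv_pow p n) (A i))"
      using nn_integral_suminf[of "\<lambda>n i. emeasure (conv_pow p n) (A i)" "count_space UNIV"]
      by (simp add: nn_integral_count_space_nat)
    also have "\<dots> = (\<Sum>n. emeasure (conv_pow p n) (\<Union>i. A i))"
      using A by (intro suminf_cong suminf_emeasure) auto
    finally show "(\<Sum>i. \<Sum>n. emeasure (conv_pow p n) (A i)) = (\<Sum>n. emeasure (conv_pow p n) (\<Union>i. A i))" .
  qed
qed fact

lemma sets_renewal_measure [simp]: "sets (renewal_measure p) = sets borel"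
  unfolding renewal_measure_def by (metis sets.sets_measure_of_eq space_borel)

lemma emeasure_renewal_measure_eq_renewal_sum:
  assumes "A \<in> sets borel"
  shows "emeasure (renewal_measure p) A = renewal_sum p (indicator A)"
  using assms by (simp add: emeasure_renewal_measure renewal_sum_def)

lemma renewal_sum_mono: "(\<And>x. F x \<le> G x) \<Longrightarrow> renewal_sum p F \<le> renewal_sum p G"
  unfolding renewal_sum_def by (intro suminf_le nn_integral_mono) auto

lemma renewal_sum_add:
  assumes [measurable]: "F \<in> borel_measurable borel" "G \<in> borel_measurable borel"
  shows "renewal_sum p (\<lambda>x. F x + G x) = renewal_sum p F + renewal_sum p G"
  unfolding renewal_sum_def by (simp add: nn_integral_add suminf_add)

lemma renewal_sum_cmult:
  assumes [measurable]: "F \<in> borel_measurable borel"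
  shows "renewal_sum p (\<lambda>x. c * F x) = c * renewal_sum p F"
  unfolding renewal_sum_def by (simp add: nn_integral_cmult)

lemma measurable_renewal_sum [measurable (raw)]:
  assumes "finite_borel_measure p"
    and [measurable]: "case_prod F \<in> borel_measurable (M \<Otimes>\<^sub>M borel)"
  shows "(\<lambda>x. renewal_sum p (F x)) \<in> borel_measurable M"
proof -
  have [measurable]: "(\<lambda>x. \<integral>\<^sup>+y. F x y \<partial>conv_pow p n) \<in> borel_measurable M" for n
  proof -
    interpret finite_borel_measure "conv_pow p n" by (intro finite_borel_measure_conv_pow assms)
    show ?thesis by (rule borel_measurable_nn_integral) measurable
  qed
  show ?thesis unfolding renewal_sum_def by measurable
qed

lemma nn_integral_renewal_sum:
  assumes "finite_borel_measure p" "sigma_finite_measure M"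
    and [measurable]: "case_prod F \<in> borel_measurable (M \<Otimes>\<^sub>M borel)"
  shows "(\<integral>\<^sup>+x. renewal_sum p (F x) \<partial>M) = renewal_sum p (\<lambda>y. \<integral>\<^sup>+x. F x y \<partial>M)"
proof -
  have "(\<lambda>x. \<integral>\<^sup>+y. F x y \<partial>conv_pow p n) \<in> borel_measurable M \<and>
     (\<integral>\<^sup>+x. \<integral>\<^sup>+y. F x y \<partial>conv_pow p n \<partial>M) = (\<integral>\<^sup>+y. \<integral>\<^sup>+x. F x y \<partial>M \<partial>conv_pow p n)" for n
  proof
    interpret n: finite_borel_measure "conv_pow p n" by (intro finite_borel_measure_conv_pow assms)
    interpret M: sigma_finite_measure M by fact
    interpret pair_sigma_finite M "conv_pow p n" ..
    show "(\<lambda>x. \<integral>\<^sup>+y. F x y \<partial>conv_pow p n) \<in> borel_measurable M"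
      by (rule n.borel_measurable_nn_integral) measurable
    show "(\<integral>\<^sup>+x. \<integral>\<^sup>+y. F x y \<partial>conv_pow p n \<partial>M) = (\<integral>\<^sup>+y. \<integral>\<^sup>+x. F x y \<partial>M \<partial>conv_pow p n)"
      by (rule Fubini'[symmetric]) measurable
  qed
  then show ?thesis
    by (simp add: renewal_sum_def nn_integral_suminf)
qed

text \<open>Splits off the term \<open>n = 0\<close>, a unit mass at 0: this is
  \<open>N = delta_0 + p * N\<close>, conditioning on the first step.\<close>

lemma renewal_sum_rec_left:
  assumes "finite_borel_measure p" and [measurable]: "F \<in> borel_measurable borel"
  shows "renewal_sum p F = F 0 + (\<integral>\<^sup>+w. renewal_sum p (\<lambda>z. F (w + z)) \<partial>p)"
proof -
  interpret p: finite_borel_measure p by fact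
  have [measurable_cong]: "sets p = sets borel" by (rule p.M_is_borel)
  have m: "(\<lambda>x. \<integral>\<^sup>+y. F (x + y) \<partial>conv_pow p n) \<in> borel_measurable p" for n
  proof -
    interpret n: finite_borel_measure "conv_pow p n" by (intro finite_borel_measure_conv_pow assms)
    show ?thesis by (rule n.borel_measurable_nn_integral) measurable
  qed
  have "renewal_sum p F = (\<integral>\<^sup>+x. F x \<partial>conv_pow p 0) + (\<Sum>n. \<integral>\<^sup>+x. F x \<partial>conv_pow p (Suc n))"
    unfolding renewal_sum_def by (subst suminf_offset[where i=1]) simp_all
  also have "\<dots> = F 0 + (\<Sum>n. \<integral>\<^sup>+x. \<integral>\<^sup>+y. F (x + y) \<partial>conv_pow p n \<partial>p)"
    by (simp only: nn_integral_conv_pow_Suc[OF assms(1)] assms(2)) (simp add: nn_integral_return)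
  also have "\<dots> = F 0 + (\<integral>\<^sup>+w. renewal_sum p (\<lambda>z. F (w + z)) \<partial>p)"
    unfolding renewal_sum_def by (subst nn_integral_suminf) (use m in auto)
  finally show ?thesis .
qed

text \<open>The mirror identity \<open>N = delta_0 + N * p\<close>, conditioning on the last step.
  The splitting of \<open>p\<close> uses the left recursion for \<open>g\<close> and the right one
  for \<open>p\<close>.\<close>

lemma renewal_sum_rec_right:
  assumes "finite_borel_measure p" and [measurable]: "F \<in> borel_measurable borel"
  shows "renewal_sum p F = F 0 + renewal_sum p (\<lambda>y. \<integral>\<^sup>+w. F (y + w) \<partial>p)"
proof -
  have "renewal_sum p F = (\<integral>\<^sup>+x. F x \<partial>conv_pow p 0) + (\<Sum>n. \<integral>\<^sup>+x. F x \<partial>conv_pow p (Suc n))"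
    unfolding renewal_sum_def by (subst suminf_offset[where i=1]) simp_all
  also have "\<dots> = F 0 + renewal_sum p (\<lambda>y. \<integral>\<^sup>+w. F (y + w) \<partial>p)"
    by (simp only: nn_integral_conv_pow_Suc'[OF assms(1)] assms(2) renewal_sum_def)
       (simp add: nn_integral_return)
  finally show ?thesis .
qed

lemma renewal_sum_geometric_le:
  assumes "\<And>n. (\<integral>\<^sup>+x. F x \<partial>conv_pow p n) \<le> (\<integral>\<^sup>+x. F x \<partial>p) ^ n"
    and "(\<integral>\<^sup>+x. F x \<partial>p) \<le> ennreal \<rho>" "0 \<le> \<rho>" "\<rho> < 1"
  shows "renewal_sum p F \<le> ennreal (1 / (1 - \<rho>))"
proof -
  have "renewal_sum p F \<le> (\<Sum>n. ennreal (\<rho> ^ n))"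
    unfolding renewal_sum_def
  proof (rule suminf_le)
    fix n
    have "(\<integral>\<^sup>+x. F x \<partial>p) ^ n \<le> ennreal \<rho> ^ n" by (rule power_mono) (use assms in auto)
    then show "(\<integral>\<^sup>+x. F x \<partial>conv_pow p n) \<le> ennreal (\<rho> ^ n)"
      using assms by (auto simp: ennreal_power intro: order_trans)
  qed auto
  also have "\<dots> = ennreal (1 / (1 - \<rho>))"
    using assms by (simp add: suminf_ennreal2 summable_geometric suminf_geometric)
  finally show ?thesis .
qed

text \<open>Additivity passes from sets to functions by the usual induction; the limit step uses
  that suprema of increasing sequences add.\<close>

lemma nn_integral_sum_measure:
  assumes s: "sets p = sets borel" "sets p1 = sets borel" "sets p2 = sets borel"
    and eq: "\<And>A. A \<in> sets borel \<Longrightarrow> emeasure p A = emeasure p1 A + emeasure p2 A"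
    and F: "F \<in> borel_measurable borel"
  shows "(\<integral>\<^sup>+x. F x \<partial>p) = (\<integral>\<^sup>+x. F x \<partial>p1) + (\<integral>\<^sup>+x. F x \<partial>p2)"
proof -
  note [measurable_cong] = s
  have [simp]: "space p = UNIV" "space p1 = UNIV" "space p2 = UNIV"
    using s[THEN sets_eq_imp_space_eq] by auto
  show ?thesis
    using F
  proof (induction F rule: borel_measurable_induct)
    case (cong f g) then show ?case by (simp cong: nn_integral_cong)
  next
    case (set A) then show ?case using eq s by simp
  next
    case (mult u c)
    have "u \<in> borel_measurable p" "u \<in> borel_measurable p1" "u \<in> borel_measurable p2"
      using mult(2) by measurable
    then show ?case by (simp add: nn_integral_cmult mult distrib_left)
  next
    case (add u v)
    have "u \<in> borel_measurable p" "u \<in> borel_measurable p1" "u \<in> borel_measurable p2"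
      "v \<in> borel_measurable p" "v \<in> borel_measurable p1" "v \<in> borel_measurable p2"
      using \<open>u \<in> borel_measurable borel\<close> \<open>v \<in> borel_measurable borel\<close> by measurable
    then show ?case by (simp add: nn_integral_add add ac_simps)
  next
    case (seq U)
    have m: "U i \<in> borel_measurable q" if "sets q = sets borel" for i q
      using seq(1)[of i] measurable_cong_sets[OF that refl] by auto
    have "(\<integral>\<^sup>+x. (SUP i. U i) x \<partial>q) = (SUP i. \<integral>\<^sup>+x. U i x \<partial>q)" if "sets q = sets borel" for q
      using m[OF that] seq(3) by (simp add: nn_integral_monotone_convergence_SUP image_comp)
    moreover have "incseq (\<lambda>i. \<integral>\<^sup>+x. U i x \<partial>q)" for q
      using seq(3) by (auto simp: incseq_def le_fun_def intro!: nn_integral_mono)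
    ultimately show ?case
      using s by (simp add: seq ennreal_SUP_add)
  qed
qed

text \<open>Convolving \<open>N\<^sub>g = \<delta> + g * N\<^sub>g\<close> with \<open>N\<^sub>p\<close> and \<open>N\<^sub>p = \<delta> + N\<^sub>p * (f + g)\<close> with \<open>N\<^sub>g\<close> gives two
  expressions for \<open>N\<^sub>p * N\<^sub>g\<close>; the common term \<open>N\<^sub>p * g * N\<^sub>g\<close> can be cancelled on test functions on
  which it is finite.\<close>

lemma renewal_sum_split:
  assumes p: "finite_borel_measure p" and g: "finite_borel_measure g"
    and f [measurable]: "f \<in> borel_measurable borel"
    and eq: "\<And>A. A \<in> sets borel \<Longrightarrow> emeasure p A = emeasure (density lborel f) A + emeasure g A"
    and F [measurable]: "F \<in> borel_measurable borel"
    and fin: "renewal_sum p (\<lambda>y. renewal_sum g (\<lambda>z. F (y + z))) < \<infinity>"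
  shows "renewal_sum p F = renewal_sum g F + (\<integral>\<^sup>+x. F x * renewal_sum p (\<lambda>y. renewal_sum g (\<lambda>z. f (x - y - z))) \<partial>lborel)"
proof -
  interpret p: finite_borel_measure p by fact
  interpret g: finite_borel_measure g by fact
  have [measurable_cong]: "sets p = sets borel" "sets g = sets borel"
    by (rule p.M_is_borel g.M_is_borel)+
  define H where "H y = renewal_sum g (\<lambda>z. F (y + z))" for y
  have [measurable]: "H \<in> borel_measurable borel"
    unfolding H_def by (rule measurable_renewal_sum[OF g]) measurable
  define X where "X = renewal_sum p (\<lambda>y. \<integral>\<^sup>+w. H (y + w) \<partial>g)"
  define Y where "Y = renewal_sum p (\<lambda>y. \<integral>\<^sup>+w. f w * H (y + w) \<partial>lborel)"
  have Hrec: "H y = F y + (\<integral>\<^sup>+w. H (y + w) \<partial>g)" for y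
    using renewal_sum_rec_left[OF g, of "\<lambda>z. F (y + z)"] by (simp add: H_def add.assoc)
  have mg [measurable]: "(\<lambda>y. \<integral>\<^sup>+w. H (y + w) \<partial>g) \<in> borel_measurable borel"
    by (rule g.borel_measurable_nn_integral) measurable
  have mf [measurable]: "(\<lambda>y. \<integral>\<^sup>+w. f w * H (y + w) \<partial>lborel) \<in> borel_measurable borel"
    by (rule lborel.borel_measurable_nn_integral) measurable
  have 1: "renewal_sum p H = renewal_sum p F + X"
    unfolding X_def by (subst renewal_sum_add[symmetric]) (auto simp: Hrec[symmetric])
  have pH: "(\<integral>\<^sup>+w. H (y + w) \<partial>p) = (\<integral>\<^sup>+w. f w * H (y + w) \<partial>lborel) + (\<integral>\<^sup>+w. H (y + w) \<partial>g)" for y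
  proof -
    have "(\<integral>\<^sup>+w. H (y + w) \<partial>p) = (\<integral>\<^sup>+w. H (y + w) \<partial>density lborel f) + (\<integral>\<^sup>+w. H (y + w) \<partial>g)"
      by (rule nn_integral_sum_measure) (use eq p.M_is_borel g.M_is_borel in auto)
    then show ?thesis by (simp add: nn_integral_density)
  qed
  have 2: "renewal_sum p H = renewal_sum g F + Y + X"
  proof -
    have "renewal_sum p H = H 0 + renewal_sum p (\<lambda>y. \<integral>\<^sup>+w. H (y + w) \<partial>p)"
      by (rule renewal_sum_rec_right[OF p]) measurable
    also have "\<dots> = renewal_sum g F + (Y + X)"
      unfolding pH X_def Y_def by (subst renewal_sum_add[OF mf mg]) (simp add: H_def)
    finally show ?thesis by (simp add: add.assoc)
  qed
  \<comment> \<open>\<open>X\<close> is a summand of \<open>renewal_sum p H\<close>, which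
    \<open>fin\<close> makes finite; this is what permits the subtraction in
    \<open>ennreal\<close>.\<close>
  have "X < \<infinity>" using fin 1 unfolding H_def by auto
  then have 3: "renewal_sum p F = renewal_sum g F + Y"
    using 1 2 ennreal_add_left_cancel[of X "renewal_sum p F" "renewal_sum g F + Y"]
    by (auto simp: add.commute)
  \<comment> \<open>Substituting \<open>x = y + w + z\<close> moves the translation from
    \<open>F\<close> to \<open>f\<close>; Tonelli then exposes the coefficient of
    \<open>F x\<close>, which is the density.\<close>
  have Y1: "(\<integral>\<^sup>+w. f w * H (y + w) \<partial>lborel) = (\<integral>\<^sup>+x. F x * renewal_sum g (\<lambda>z. f (x - y - z)) \<partial>lborel)" for y
  proof -
    have "(\<integral>\<^sup>+w. f w * H (y + w) \<partial>lborel) = (\<integral>\<^sup>+w. renewal_sum g (\<lambda>z. f w * F (y + w + z)) \<partial>lborel)"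
      unfolding H_def by (intro nn_integral_cong) (simp add: renewal_sum_cmult)
    also have "\<dots> = renewal_sum g (\<lambda>z. \<integral>\<^sup>+w. f w * F (y + w + z) \<partial>lborel)"
      by (rule nn_integral_renewal_sum[OF g lborel.sigma_finite_measure_axioms]) measurable
    also have "\<dots> = renewal_sum g (\<lambda>z. \<integral>\<^sup>+x. F x * f (x - y - z) \<partial>lborel)"
    proof (rule arg_cong[where f="renewal_sum g"], rule ext)
      fix z
      show "(\<integral>\<^sup>+w. f w * F (y + w + z) \<partial>lborel) = (\<integral>\<^sup>+x. F x * f (x - y - z) \<partial>lborel)"
        by (subst (2) nn_integral_real_affine[where c=1 and t="y + z"]) (auto simp: mult.commute algebra_simps)
    qed
    also have "\<dots> = (\<integral>\<^sup>+x. renewal_sum g (\<lambda>z. F x * f (x - y - z)) \<partial>lborel)"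
      by (rule nn_integral_renewal_sum[OF g lborel.sigma_finite_measure_axioms, symmetric]) measurable
    finally show ?thesis by (simp add: renewal_sum_cmult)
  qed
  have [measurable]: "(\<lambda>(x, y). renewal_sum g (\<lambda>z. f (x - y - z))) \<in> borel_measurable (borel \<Otimes>\<^sub>M borel)"
    using measurable_renewal_sum[OF g, of "\<lambda>xy z. f (fst xy - snd xy - z)" "borel \<Otimes>\<^sub>M borel"]
    by (simp add: case_prod_beta')
  have "Y = (\<integral>\<^sup>+x. renewal_sum p (\<lambda>y. F x * renewal_sum g (\<lambda>z. f (x - y - z))) \<partial>lborel)"
    unfolding Y_def Y1
    by (rule nn_integral_renewal_sum[OF p lborel.sigma_finite_measure_axioms, symmetric]) measurable
  also have "\<dots> = (\<integral>\<^sup>+x. F x * renewal_sum p (\<lambda>y. renewal_sum g (\<lambda>z. f (x - y - z))) \<partial>lborel)"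
    by (simp add: renewal_sum_cmult)
  finally show ?thesis using 3 by simp
qed

section \<open>The bilateral Laplace transform\<close>

text \<open>With the sign in \<open>exp (- z * x)\<close>, \<open>Re z > 0\<close> damps the right
  half-line, the side towards which a walk of positive mean drifts.\<close>

definition lap :: "real measure \<Rightarrow> complex \<Rightarrow> complex" where
  "lap M z = (CLINT x|M. exp (- z * of_real x))"

lemma lap_integrable:
  assumes [measurable_cong]: "sets M = sets borel"
    and fin: "(\<integral>\<^sup>+x. ennreal (exp (- (Re z * x))) \<partial>M) < \<infinity>"
  shows "integrable M (\<lambda>x. exp (- z * of_real x))"
  by (rule integrableI_bounded) (use fin in auto)

lemma norm_lap_le:
  assumes "sets M = sets borel" "0 \<le> \<rho>"
    and "(\<integral>\<^sup>+x. ennreal (exp (- (Re z * x))) \<partial>M) \<le> ennreal \<rho>"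
  shows "norm (lap M z) \<le> \<rho>"
proof -
  have "ennreal (norm (lap M z)) \<le> (\<integral>\<^sup>+x. norm (exp (- z * of_real x)) \<partial>M)"
    unfolding lap_def
    by (intro integral_norm_bound_ennreal lap_integrable assms order.strict_trans1[OF assms(3)]) simp
  also have "\<dots> \<le> ennreal \<rho>" using assms by simp
  finally show ?thesis using assms by simp
qed

lemma measurable_Complex [measurable]: "Complex s \<in> borel_measurable borel"
  unfolding Complex_eq by measurable

lemma measurable_lap_line:
  assumes "sigma_finite_measure M" "sets M = sets borel"
  shows "(\<lambda>t. lap M (Complex s t)) \<in> borel_measurable lborel"
proof -
  interpret sigma_finite_measure M by fact
  note [measurable_cong] = assms(2)
  show ?thesis unfolding lap_def by measurable
qed

text \<open>\<open>F\<close> is an inversion integral along \<open>Re z = s\<close>, and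
  \<open>\<Phi>\<close> absorbs the factor \<open>1 / (2 * pi)\<close>. Only this inverse direction
  is recorded: convolving \<open>F\<close> with a measure multiplies \<open>\<Phi>\<close> by its
  transform, and the direct transform of \<open>F\<close> is never computed. Nonnegativity allows
  passing between \<open>F x\<close> and \<open>ennreal (F x)\<close> under sums and
  integrals.\<close>

definition laplace_repr :: "real \<Rightarrow> (real \<Rightarrow> real) \<Rightarrow> (real \<Rightarrow> complex) \<Rightarrow> bool" where
  "laplace_repr s F \<Phi> \<longleftrightarrow> integrable lborel \<Phi> \<and> F \<in> borel_measurable borel \<and> (\<forall>x. 0 \<le> F x) \<and>
     (\<forall>x. complex_of_real (F x) = (CLINT t|lborel. exp (Complex s t * of_real x) * \<Phi> t))"

lemma integrable_exp_line_mult: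
  assumes "integrable lborel \<Phi>"
  shows "integrable lborel (\<lambda>t. exp (Complex s t * of_real x) * \<Phi> t)"
proof (rule Bochner_Integration.integrable_bound)
  show "integrable lborel (\<lambda>t. exp (s * x) * norm (\<Phi> t))"
    using assms by simp
  have [measurable]: "\<Phi> \<in> borel_measurable lborel" using assms by (rule borel_measurable_integrable)
  show "(\<lambda>t. exp (Complex s t * complex_of_real x) * \<Phi> t) \<in> borel_measurable lborel" by measurable
qed (simp add: norm_mult)

lemma norm_exp_line_integral_le:
  assumes "integrable lborel \<Phi>"
  shows "norm (CLINT t|lborel. exp (Complex s t * of_real x) * \<Phi> t) \<le> exp (s * x) * (LINT t|lborel. norm (\<Phi> t))"
proof -
  have "norm (CLINT t|lborel. exp (Complex s t * of_real x) * \<Phi> t)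
     \<le> (LINT t|lborel. norm (exp (Complex s t * of_real x) * \<Phi> t))"
    by simp
  also have "\<dots> = exp (s * x) * (LINT t|lborel. norm (\<Phi> t))"
    by (simp add: norm_mult)
  finally show ?thesis .
qed

lemma laplace_repr_bound:
  assumes "laplace_repr s F \<Phi>"
  shows "F x \<le> exp (s * x) * (LINT t|lborel. norm (\<Phi> t))"
proof -
  have "0 \<le> F x" using assms by (simp add: laplace_repr_def)
  then have "F x = norm (complex_of_real (F x))" by simp
  also have "\<dots> = norm (CLINT t|lborel. exp (Complex s t * of_real x) * \<Phi> t)"
    using assms unfolding laplace_repr_def by metis
  finally show ?thesis
    using norm_exp_line_integral_le[of \<Phi> s x] assms by (simp add: laplace_repr_def)
qed

text \<open>Fubini, with a dominating function that factorises. Sigma-finiteness of \<open>M\<close>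
  suffices because the exponential weight makes the integrals finite; Lebesgue measure on a
  half-line is one of the instances.\<close>

lemma laplace_repr_convolution:
  assumes r: "laplace_repr s F \<Phi>" and M: "sigma_finite_measure M" "sets M = sets borel"
    and fin: "(\<integral>\<^sup>+x. ennreal (exp (- (s * x))) \<partial>M) < \<infinity>"
  shows "(\<integral>\<^sup>+y. ennreal (F (x - y)) \<partial>M) = ennreal (LINT y|M. F (x - y))"
    and "laplace_repr s (\<lambda>x. LINT y|M. F (x - y)) (\<lambda>t. \<Phi> t * lap M (Complex s t))"
proof -
  interpret M: sigma_finite_measure M by fact
  note [measurable_cong] = M(2)
  interpret pair_sigma_finite M "lborel :: real measure" ..
  have \<Phi>: "integrable lborel \<Phi>" and [measurable]: "F \<in> borel_measurable borel" and F0: "\<And>x. 0 \<le> F x"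
    and rep: "\<And>x. complex_of_real (F x) = (CLINT t|lborel. exp (Complex s t * of_real x) * \<Phi> t)"
    using r by (auto simp: laplace_repr_def)
  have [measurable]: "\<Phi> \<in> borel_measurable borel" using \<Phi> by simp
  define K where "K = (LINT t|lborel. norm (\<Phi> t))"
  have iM: "integrable M (\<lambda>y. exp (- (s * y)))"
    by (rule integrableI_bounded) (use fin in auto)
  have bd: "F (x - y) \<le> exp (s * x) * K * exp (- (s * y))" for x y
    using laplace_repr_bound[OF r, of "x - y"] by (simp add: K_def right_diff_distrib exp_diff exp_minus field_simps)
  have iF: "integrable M (\<lambda>y. F (x - y))" for x
  proof (rule Bochner_Integration.integrable_bound)
    show "integrable M (\<lambda>y. exp (s * x) * K * exp (- (s * y)))" using iM by simp
    show "AE y in M. norm (F (x - y)) \<le> norm (exp (s * x) * K * exp (- (s * y)))"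
      using bd F0 by (auto intro!: AE_I2 order_trans[OF bd])
  qed measurable
  show "(\<integral>\<^sup>+y. ennreal (F (x - y)) \<partial>M) = ennreal (LINT y|M. F (x - y))"
    by (rule nn_integral_eq_integral) (use iF F0 in auto)
  define \<rho> where "\<rho> = enn2real (\<integral>\<^sup>+x. ennreal (exp (- (s * x))) \<partial>M)"
  have \<rho>: "(\<integral>\<^sup>+x. ennreal (exp (- (s * x))) \<partial>M) = ennreal \<rho>" "0 \<le> \<rho>"
    unfolding \<rho>_def using fin by (auto simp: less_top[symmetric])
  have nl: "norm (lap M (Complex s t)) \<le> \<rho>" for t
    by (rule norm_lap_le) (use \<rho> M in auto)
  have ml [measurable]: "(\<lambda>t. lap M (Complex s t)) \<in> borel_measurable borel"
    using measurable_lap_line[OF M] by simp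
  show "laplace_repr s (\<lambda>x. LINT y|M. F (x - y)) (\<lambda>t. \<Phi> t * lap M (Complex s t))"
    unfolding laplace_repr_def
  proof (intro conjI allI)
    show "integrable lborel (\<lambda>t. \<Phi> t * lap M (Complex s t))"
    proof (rule Bochner_Integration.integrable_bound)
      show "integrable lborel (\<lambda>t. norm (\<Phi> t) * \<rho>)" using \<Phi> by simp
      show "AE t in lborel. norm (\<Phi> t * lap M (Complex s t)) \<le> norm (norm (\<Phi> t) * \<rho>)"
        using nl \<rho>(2) by (auto simp: norm_mult intro!: AE_I2 mult_left_mono)
    qed measurable
    show "(\<lambda>x. LINT y|M. F (x - y)) \<in> borel_measurable borel" by measurable
    show "0 \<le> (LINT y|M. F (x - y))" for x using F0 by simp
    show "complex_of_real (LINT y|M. F (x - y)) = (CLINT t|lborel. exp (Complex s t * of_real x) * (\<Phi> t * lap M (Complex s t)))" for x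
    proof -
      have int: "integrable (M \<Otimes>\<^sub>M lborel) (\<lambda>(y, t). exp (Complex s t * of_real (x - y)) * \<Phi> t)"
      proof (rule Fubini_integrable)
        show "AE y in M. integrable lborel (\<lambda>t. case (y, t) of (y, t) \<Rightarrow> exp (Complex s t * of_real (x - y)) * \<Phi> t)"
          using integrable_exp_line_mult[OF \<Phi>, of s "x - _"] by (intro AE_I2) simp
        have "norm (exp (Complex s t * of_real (x - y)) * \<Phi> t) = exp (s * x) * exp (- (s * y)) * norm (\<Phi> t)" for y t
          by (simp add: norm_mult norm_inverse right_diff_distrib exp_diff exp_minus divide_inverse)
        then have "(LINT t|lborel. norm (exp (Complex s t * of_real (x - y)) * \<Phi> t)) = exp (s * x) * K * exp (- (s * y))" for y
          by (simp add: K_def)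
        then show "integrable M (\<lambda>y. LINT t|lborel. norm (case (y, t) of (y, t) \<Rightarrow> exp (Complex s t * of_real (x - y)) * \<Phi> t))"
          using iM by simp
      qed measurable
      have "complex_of_real (LINT y|M. F (x - y)) = (CLINT y|M. complex_of_real (F (x - y)))"
        using iF by simp
      also have "\<dots> = (CLINT y|M. CLINT t|lborel. exp (Complex s t * of_real (x - y)) * \<Phi> t)"
        by (simp add: rep)
      also have "\<dots> = (CLINT t|lborel. CLINT y|M. exp (Complex s t * of_real (x - y)) * \<Phi> t)"
        by (rule Fubini_integral[symmetric]) (rule int)
      also have "\<dots> = (CLINT t|lborel. exp (Complex s t * of_real x) * (\<Phi> t * lap M (Complex s t)))"
      proof (rule Bochner_Integration.integral_cong[OF refl])
        fix t
        have "(CLINT y|M. exp (Complex s t * of_real (x - y)) * \<Phi> t)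
           = (CLINT y|M. (exp (Complex s t * of_real x) * \<Phi> t) * exp (- Complex s t * of_real y))"
          by (simp add: right_diff_distrib exp_diff exp_minus divide_inverse mult_ac)
        then show "(CLINT y|M. exp (Complex s t * of_real (x - y)) * \<Phi> t) = exp (Complex s t * of_real x) * (\<Phi> t * lap M (Complex s t))"
          by (simp add: lap_def mult.assoc)
      qed
      finally show ?thesis .
    qed
  qed
qed

lemma laplace_repr_conv_pow:
  assumes r: "laplace_repr s F \<Phi>" and p: "finite_borel_measure p"
    and fin: "(\<integral>\<^sup>+x. ennreal (exp (- (s * x))) \<partial>p) < \<infinity>"
  shows "\<exists>F'. (\<forall>x. (\<integral>\<^sup>+y. ennreal (F (x - y)) \<partial>conv_pow p n) = ennreal (F' x)) \<and>
     laplace_repr s F' (\<lambda>t. \<Phi> t * lap p (Complex s t) ^ n)"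
proof (induction n)
  case 0
  have "F \<in> borel_measurable borel" using r by (simp add: laplace_repr_def)
  then show ?case using r by (intro exI[of _ F]) (simp add: nn_integral_return)
next
  case (Suc n)
  interpret p: finite_borel_measure p by fact
  have [measurable]: "F \<in> borel_measurable borel" using r by (simp add: laplace_repr_def)
  from Suc obtain F' where F': "\<And>x. (\<integral>\<^sup>+y. ennreal (F (x - y)) \<partial>conv_pow p n) = ennreal (F' x)"
    and r': "laplace_repr s F' (\<lambda>t. \<Phi> t * lap p (Complex s t) ^ n)" by auto
  note * = laplace_repr_convolution[OF r' p.sigma_finite_measure_axioms p.M_is_borel fin]
  have "(\<integral>\<^sup>+y. ennreal (F (x - y)) \<partial>conv_pow p (Suc n)) = ennreal (LINT y|p. F' (x - y))" for x
    by (subst nn_integral_conv_pow_Suc[OF p]) (auto simp: diff_diff_eq[symmetric] F' *(1))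
  then show ?case using *(2) by (intro exI[of _ "\<lambda>x. LINT y|p. F' (x - y)"]) (simp add: mult_ac)
qed

text \<open>Sums the geometric series under the inversion integral. An exponential moment below 1
  bounds the transform on the entire line; for \<open>p\<close> this confines \<open>s\<close> to
  the right of 0.\<close>

lemma laplace_repr_renewal_sum:
  assumes r: "laplace_repr s F \<Phi>" and p: "finite_borel_measure p"
    and \<rho>: "(\<integral>\<^sup>+x. ennreal (exp (- (s * x))) \<partial>p) \<le> ennreal \<rho>" "0 \<le> \<rho>" "\<rho> < 1"
  shows "\<exists>F'. (\<forall>x. renewal_sum p (\<lambda>y. ennreal (F (x - y))) = ennreal (F' x)) \<and>
     laplace_repr s F' (\<lambda>t. \<Phi> t / (1 - lap p (Complex s t)))"
proof -
  interpret p: finite_borel_measure p by fact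
  have fin: "(\<integral>\<^sup>+x. ennreal (exp (- (s * x))) \<partial>p) < \<infinity>"
    using \<rho>(1) by (rule order.strict_trans1) simp
  obtain G where G: "\<And>n x. (\<integral>\<^sup>+y. ennreal (F (x - y)) \<partial>conv_pow p n) = ennreal (G n x)"
     "\<And>n. laplace_repr s (G n) (\<lambda>t. \<Phi> t * lap p (Complex s t) ^ n)"
    using laplace_repr_conv_pow[OF r p fin] by metis
  have \<Phi>: "integrable lborel \<Phi>" using r by (simp add: laplace_repr_def)
  then have [measurable]: "\<Phi> \<in> borel_measurable borel" by simp
  have [measurable]: "(\<lambda>t. lap p (Complex s t)) \<in> borel_measurable borel"
    using measurable_lap_line[OF p.sigma_finite_measure_axioms p.M_is_borel] by simp
  have nl: "norm (lap p (Complex s t)) \<le> \<rho>" for t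
    by (rule norm_lap_le) (use \<rho> p.M_is_borel in auto)
  have geo: "(\<lambda>n. lap p (Complex s t) ^ n) sums (1 / (1 - lap p (Complex s t)))" for t
    by (rule geometric_sums) (rule order.strict_trans1[OF nl \<rho>(3)])
  \<comment> \<open>Uniform in \<open>t\<close> and \<open>k\<close>, so that
    \<open>norm (\<Phi> t) / (1 - \<rho>)\<close>, up to the factor \<open>exp (s * x)\<close>,
    dominates all partial sums.\<close>
  have bsum: "norm (\<Sum>n<k. lap p (Complex s t) ^ n) \<le> 1 / (1 - \<rho>)" for t k
  proof -
    have "norm (\<Sum>n<k. lap p (Complex s t) ^ n) \<le> (\<Sum>n<k. \<rho> ^ n)"
      by (intro sum_norm_le) (auto simp: norm_power intro!: power_mono nl)
    also have "\<dots> \<le> (\<Sum>n. \<rho> ^ n)"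
      using \<rho> by (intro sum_le_suminf summable_geometric) auto
    finally show ?thesis using \<rho> by (simp add: suminf_geometric)
  qed
  have inv: "norm (1 / (1 - lap p (Complex s t))) \<le> 1 / (1 - \<rho>)" for t
    using geo[of t] bsum[where t=t] unfolding sums_def
    by (intro Lim_norm_ubound[OF _ geo[of t, unfolded sums_def]]) auto
  have lim: "(\<lambda>n. complex_of_real (G n x)) sums
      (CLINT t|lborel. exp (Complex s t * of_real x) * (\<Phi> t / (1 - lap p (Complex s t))))" for x
  proof -
    have "(\<Sum>n<k. complex_of_real (G n x)) = (CLINT t|lborel. exp (Complex s t * of_real x) * (\<Phi> t * (\<Sum>n<k. lap p (Complex s t) ^ n)))" for k
    proof -
      have "(\<Sum>n<k. complex_of_real (G n x)) = (\<Sum>n<k. CLINT t|lborel. exp (Complex s t * of_real x) * (\<Phi> t * lap p (Complex s t) ^ n))"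
        using G(2) by (simp add: laplace_repr_def)
      also have "\<dots> = (CLINT t|lborel. \<Sum>n<k. exp (Complex s t * of_real x) * (\<Phi> t * lap p (Complex s t) ^ n))"
        by (rule Bochner_Integration.integral_sum[symmetric])
           (use G(2) integrable_exp_line_mult in \<open>auto simp: laplace_repr_def\<close>)
      finally show ?thesis by (simp add: sum_distrib_left)
    qed
    moreover have "(\<lambda>k. CLINT t|lborel. exp (Complex s t * of_real x) * (\<Phi> t * (\<Sum>n<k. lap p (Complex s t) ^ n)))
       \<longlonglongrightarrow> (CLINT t|lborel. exp (Complex s t * of_real x) * (\<Phi> t * (1 / (1 - lap p (Complex s t)))))"
    proof (rule integral_dominated_convergence)
      show "integrable lborel (\<lambda>t. exp (s * x) * (norm (\<Phi> t) * (1 / (1 - \<rho>))))" using \<Phi> by simp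
      show "AE t in lborel. (\<lambda>k. exp (Complex s t * of_real x) * (\<Phi> t * (\<Sum>n<k. lap p (Complex s t) ^ n)))
         \<longlonglongrightarrow> exp (Complex s t * of_real x) * (\<Phi> t * (1 / (1 - lap p (Complex s t))))"
        using geo unfolding sums_def by (intro tendsto_mult tendsto_const AE_I2)
      show "AE t in lborel. norm (exp (Complex s t * of_real x) * (\<Phi> t * (\<Sum>n<k. lap p (Complex s t) ^ n)))
         \<le> exp (s * x) * (norm (\<Phi> t) * (1 / (1 - \<rho>)))" for k
        unfolding norm_mult by (intro AE_I2 mult_mono bsum) auto
    qed measurable
    ultimately show ?thesis by (simp add: sums_def)
  qed
  \<comment> \<open>Taking the real part loses nothing: the terms \<open>G n x\<close> are real,
    hence so is their sum.\<close>
  define F' where "F' x = Re (CLINT t|lborel. exp (Complex s t * of_real x) * (\<Phi> t / (1 - lap p (Complex s t))))" for x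
  have G0: "0 \<le> G n x" for n x using G(2) by (simp add: laplace_repr_def)
  have sF': "(\<lambda>n. G n x) sums F' x" for x
    using lim[of x, THEN sums_Re] by (simp add: F'_def)
  have F'eq: "F' = (\<lambda>x. \<Sum>n. G n x)" using sF' by (auto simp: sums_iff)
  have cF': "complex_of_real (F' x) = (CLINT t|lborel. exp (Complex s t * of_real x) * (\<Phi> t / (1 - lap p (Complex s t))))" for x
    using sums_unique2[OF sums_of_real[OF sF'] lim] .
  have [measurable]: "G n \<in> borel_measurable borel" for n using G(2) by (simp add: laplace_repr_def)
  show ?thesis
  proof (intro exI[of _ F'] conjI allI)
    show "renewal_sum p (\<lambda>y. ennreal (F (x - y))) = ennreal (F' x)" for x
      unfolding renewal_sum_def G(1) using sF'[of x] G0 by (subst suminf_ennreal2) (auto simp: sums_iff)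
    show "laplace_repr s F' (\<lambda>t. \<Phi> t / (1 - lap p (Complex s t)))"
      unfolding laplace_repr_def
    proof (intro conjI allI cF')
      show "integrable lborel (\<lambda>t. \<Phi> t / (1 - lap p (Complex s t)))"
      proof (rule Bochner_Integration.integrable_bound)
        show "integrable lborel (\<lambda>t. norm (\<Phi> t) * (1 / (1 - \<rho>)))" using \<Phi> by simp
        show "AE t in lborel. norm (\<Phi> t / (1 - lap p (Complex s t))) \<le> norm (norm (\<Phi> t) * (1 / (1 - \<rho>)))"
        proof (rule AE_I2)
          fix t
          have "norm (\<Phi> t / (1 - lap p (Complex s t))) = norm (\<Phi> t) * norm (1 / (1 - lap p (Complex s t)))"
            by (simp add: norm_mult norm_divide)
          also have "\<dots> \<le> norm (\<Phi> t) * (1 / (1 - \<rho>))" by (intro mult_left_mono inv) auto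
          finally show "norm (\<Phi> t / (1 - lap p (Complex s t))) \<le> norm (norm (\<Phi> t) * (1 / (1 - \<rho>)))"
            using \<rho> by simp
        qed
      qed measurable
      show "F' \<in> borel_measurable borel" unfolding F'eq by measurable
      show "0 \<le> F' x" for x unfolding F'eq using sF'[of x] G0 by (intro suminf_nonneg) (auto simp: sums_iff)
    qed
  qed
qed

section \<open>Fourier inversion and smooth densities\<close>

text \<open>Gaussian regularisation: the factor \<open>?N (\<epsilon> * t)\<close> makes the double
  integral absolutely convergent, and Fubini turns the left side into a Gaussian average of
  \<open>f\<close> around \<open>x\<close> at scale \<open>\<epsilon>\<close>. As
  \<open>\<epsilon>\<close> tends to 0, one side converges by integrability of the transform, the
  other by continuity and boundedness of \<open>f\<close>.\<close>

lemma fourier_inversion: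
  fixes f :: "real \<Rightarrow> complex"
  assumes cont: "continuous_on UNIV f" and int: "integrable lborel f" and bd: "\<And>x. norm (f x) \<le> K"
    and int': "integrable lborel (\<lambda>t::real. CLINT u|lborel. exp (- (\<i> * t * u)) * f u)"
  shows "(CLINT t|lborel. exp (\<i> * of_real t * of_real x) * (CLINT u|lborel. exp (- (\<i> * of_real t * of_real u)) * f u)) = 2 * pi * f x"
proof -
  have [measurable]: "f \<in> borel_measurable borel" using int by simp
  define \<Phi> where "\<Phi> t = (CLINT u|lborel. exp (- (\<i> * of_real t * of_real u)) * f u)" for t
  have \<Phi>: "integrable lborel \<Phi>" using int' unfolding \<Phi>_def .
  then have [measurable]: "\<Phi> \<in> borel_measurable borel" by simp
  let ?N = "std_normal_density"
  have N_int: "integrable lborel ?N" by simp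
  have N_bd: "?N x \<le> 1 / sqrt (2 * pi)" for x :: real
    by (simp add: normal_density_def divide_right_mono)
  \<comment> \<open>The standard normal density is its own transform up to the factor
    \<open>sqrt (2 * pi)\<close>.\<close>
  have char: "(CLINT w|lborel. exp (\<i> * t * w) * ?N w) = sqrt (2 * pi) * ?N t" for t :: real
  proof -
    have "char std_normal_distribution t = (CLINT w|lborel. exp (\<i> * t * w) * ?N w)"
      unfolding char_def by (subst integral_density) (auto simp: scaleR_conv_of_real mult_ac)
    then have "(CLINT w|lborel. exp (\<i> * t * w) * ?N w) = exp (- (t\<^sup>2) / 2)"
      unfolding char_std_normal_distribution by simp
    also have "exp (- (t\<^sup>2) / 2) = sqrt (2 * pi) * ?N t" by (simp add: normal_density_def)
    finally show ?thesis by simp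
  qed
  have key: "(CLINT t|lborel. exp (\<i> * t * x) * \<Phi> t * ?N (\<epsilon> * t))
      = sqrt (2 * pi) * (CLINT y|lborel. f (x + \<epsilon> * y) * ?N y)" if "\<epsilon> > 0" for \<epsilon>
  proof -
    have iN: "integrable lborel (\<lambda>t. ?N (\<epsilon> * t))"
      using lborel_integrable_real_affine_iff[of \<epsilon> ?N 0] that by simp
    have inner: "(CLINT t|lborel. exp (\<i> * t * x) * (exp (- (\<i> * t * u)) * f u) * ?N (\<epsilon> * t))
        = sqrt (2 * pi) / \<epsilon> * (f u * ?N ((u - x) / \<epsilon>))" for u
    proof -
      have "(CLINT t|lborel. exp (\<i> * t * x) * (exp (- (\<i> * t * u)) * f u) * ?N (\<epsilon> * t))
          = (CLINT t|lborel. f u * (exp (\<i> * t * (x - u)) * ?N (\<epsilon> * t)))"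
        by (simp add: right_diff_distrib exp_diff exp_minus divide_inverse mult_ac)
      also have "\<dots> = f u * (CLINT t|lborel. exp (\<i> * t * (x - u)) * ?N (\<epsilon> * t))"
        by simp
      also have "(CLINT t|lborel. exp (\<i> * t * (x - u)) * ?N (\<epsilon> * t))
         = (1 / \<epsilon>) * (CLINT w|lborel. exp (\<i> * ((x - u) / \<epsilon>) * w) * ?N w)"
        using that
        by (subst lborel_integral_real_affine[where c="1/\<epsilon>" and t=0]) (auto simp: scaleR_conv_of_real field_simps)
      also have "\<dots> = (1 / \<epsilon>) * (sqrt (2 * pi) * ?N ((x - u) / \<epsilon>))"
        using char[of "(x - u) / \<epsilon>"] by simp
      also have "?N ((x - u) / \<epsilon>) = ?N ((u - x) / \<epsilon>)"
        by (simp add: normal_density_def power_divide power2_commute)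
      finally show ?thesis by (simp add: mult_ac)
    qed
    have int2: "integrable (lborel \<Otimes>\<^sub>M lborel) (\<lambda>(t, u). exp (\<i> * of_real t * of_real x) * (exp (- (\<i> * of_real t * of_real u)) * f u) * ?N (\<epsilon> * t))"
    proof (rule lborel_pair.Fubini_integrable)
      show "AE t in lborel. integrable lborel (\<lambda>u. case (t, u) of (t, u) \<Rightarrow> exp (\<i> * of_real t * of_real x) * (exp (- (\<i> * of_real t * of_real u)) * f u) * ?N (\<epsilon> * t))"
      proof (rule AE_I2)
        fix t :: real
        have "integrable lborel (\<lambda>u. exp (\<i> * of_real t * of_real x) * (exp (- (\<i> * of_real t * of_real u)) * f u) * ?N (\<epsilon> * t))"
        proof (rule Bochner_Integration.integrable_bound)
          show "integrable lborel (\<lambda>u. norm (f u) * ?N (\<epsilon> * t))" using int by simp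
        qed (auto simp: norm_mult)
        then show "integrable lborel (\<lambda>u. case (t, u) of (t, u) \<Rightarrow> exp (\<i> * of_real t * of_real x) * (exp (- (\<i> * of_real t * of_real u)) * f u) * ?N (\<epsilon> * t))"
          by simp
      qed
      show "integrable lborel (\<lambda>t. LINT u|lborel. norm (case (t, u) of (t, u) \<Rightarrow> exp (\<i> * of_real t * of_real x) * (exp (- (\<i> * of_real t * of_real u)) * f u) * ?N (\<epsilon> * t)))"
        using iN by (simp add: norm_mult)
    qed measurable
    have "(CLINT t|lborel. exp (\<i> * t * x) * \<Phi> t * ?N (\<epsilon> * t))
       = (CLINT t|lborel. CLINT u|lborel. exp (\<i> * t * x) * (exp (- (\<i> * t * u)) * f u) * ?N (\<epsilon> * t))"
      unfolding \<Phi>_def by simp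
    also have "\<dots> = (CLINT u|lborel. CLINT t|lborel. exp (\<i> * t * x) * (exp (- (\<i> * t * u)) * f u) * ?N (\<epsilon> * t))"
      by (rule lborel_pair.Fubini_integral[symmetric]) (rule int2)
    also have "\<dots> = (CLINT u|lborel. sqrt (2 * pi) / \<epsilon> * (f u * ?N ((u - x) / \<epsilon>)))"
      unfolding inner ..
    also have "\<dots> = sqrt (2 * pi) / \<epsilon> * (CLINT u|lborel. f u * ?N ((u - x) / \<epsilon>))"
      by simp
    also have "(CLINT u|lborel. f u * ?N ((u - x) / \<epsilon>)) = \<epsilon> * (CLINT y|lborel. f (x + \<epsilon> * y) * ?N y)"
      using that
      by (subst lborel_integral_real_affine[where c="\<epsilon>" and t=x]) (auto simp: scaleR_conv_of_real)
    finally show ?thesis using that by simp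
  qed
  define e where "e n = inverse (real (Suc n))" for n
  have e0: "e n > 0" for n by (simp add: e_def)
  have elim: "e \<longlonglongrightarrow> 0" unfolding e_def by (rule LIMSEQ_inverse_real_of_nat)
  have contN: "isCont ?N y" for y unfolding normal_density_def by (auto intro!: continuous_intros)
  have "(\<lambda>n. CLINT t|lborel. exp (\<i> * t * x) * \<Phi> t * ?N (e n * t))
     \<longlonglongrightarrow> (CLINT t|lborel. exp (\<i> * t * x) * \<Phi> t * ?N 0)"
  proof (rule integral_dominated_convergence)
    show "integrable lborel (\<lambda>t. norm (\<Phi> t) * (1 / sqrt (2 * pi)))" using \<Phi> by simp
    show "AE t in lborel. (\<lambda>n. exp (\<i> * of_real t * of_real x) * \<Phi> t * ?N (e n * t)) \<longlonglongrightarrow> exp (\<i> * of_real t * of_real x) * \<Phi> t * ?N 0"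
      by (intro AE_I2 tendsto_mult tendsto_const tendsto_of_real isCont_tendsto_compose[OF contN] tendsto_mult_left_zero elim)
    show "AE t in lborel. norm (exp (\<i> * of_real t * of_real x) * \<Phi> t * ?N (e n * t)) \<le> norm (\<Phi> t) * (1 / sqrt (2 * pi))" for n
      unfolding norm_mult using N_bd by (intro AE_I2 mult_mono) auto
  qed measurable
  moreover have "(\<lambda>n. CLINT t|lborel. exp (\<i> * t * x) * \<Phi> t * ?N (e n * t)) \<longlonglongrightarrow> sqrt (2 * pi) * (CLINT y|lborel. f x * ?N y)"
    unfolding key[OF e0]
  proof (intro tendsto_mult tendsto_const integral_dominated_convergence)
    show "integrable lborel (\<lambda>t. K * ?N t)" by simp
    show "AE y in lborel. (\<lambda>n. f (x + e n * y) * of_real (?N y)) \<longlonglongrightarrow> f x * of_real (?N y)"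
    proof (intro AE_I2 tendsto_mult tendsto_const)
      fix y
      have "(\<lambda>n. x + e n * y) \<longlonglongrightarrow> x + 0 * y" by (intro tendsto_intros elim)
      then show "(\<lambda>n. f (x + e n * y)) \<longlonglongrightarrow> f x"
        using cont by (intro isCont_tendsto_compose[of x f]) (auto simp: continuous_on_eq_continuous_at)
    qed
    show "AE y in lborel. norm (f (x + e n * y) * of_real (?N y)) \<le> K * ?N y" for n
      unfolding norm_mult using bd by (intro AE_I2 mult_mono) (auto intro: order_trans[OF norm_ge_zero bd])
  qed measurable
  ultimately have "(CLINT t|lborel. exp (\<i> * t * x) * \<Phi> t * ?N 0) = sqrt (2 * pi) * (CLINT y|lborel. f x * ?N y)"
    by (rule LIMSEQ_unique)
  moreover have "(CLINT y|lborel. f x * ?N y) = f x"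
  proof -
    have "(CLINT y|lborel. f x * ?N y) = f x * of_real (LINT y|lborel. ?N y)" by simp
    then show ?thesis by simp
  qed
  \<comment> \<open>The factors \<open>sqrt (2 * pi)\<close> from \<open>key\<close> and from
    \<open>?N 0\<close> combine to \<open>2 * pi\<close>.\<close>
  moreover have "?N 0 = 1 / sqrt (2 * pi)" by (simp add: normal_density_def)
  moreover have "complex_of_real (sqrt (2 * pi)) * complex_of_real (sqrt (2 * pi)) = 2 * pi"
    by (simp flip: of_real_mult)
  ultimately show ?thesis unfolding \<Phi>_def
    by (simp add: field_simps)
qed

lemma C02_vanish:
  assumes "C02_with T \<phi> \<phi>2" "\<bar>x\<bar> \<ge> T"
  shows "\<phi> x = 0"
  using assms unfolding C02_with_def by force

lemma C02_continuous:
  assumes "C02_with T \<phi> \<phi>2"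
  shows "continuous_on UNIV \<phi>"
  using assms unfolding C02_with_def
  by (metis DERIV_isCont continuous_at_imp_continuous_on)

lemma C02_continuous2:
  assumes "C02_with T \<phi> \<phi>2"
  shows "continuous_on UNIV \<phi>2"
  using assms unfolding C02_with_def by blast

text \<open>Two integrations by parts at once: \<open>exp (-zx) (\<phi>' + z \<phi>)\<close> is an antiderivative of
  \<open>exp (-zx) (\<phi>'' - z\<^sup>2 \<phi>)\<close> that vanishes at both end points.\<close>

lemma lap_C02_bound:
  assumes C: "C02_with T \<phi> \<phi>2" and T: "T > 0" and nn: "\<And>x. 0 \<le> \<phi> x" and [measurable]: "\<phi> \<in> borel_measurable borel"
  shows "(norm z)\<^sup>2 * norm (lap (density lborel \<phi>) z) \<le> exp (\<bar>Re z\<bar> * T) * integral {-T..T} (\<lambda>x. \<bar>\<phi>2 x\<bar>)"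
proof -
  from C obtain \<phi>1 a where d1: "\<And>x. (\<phi> has_real_derivative \<phi>1 x) (at x)"
    and d2: "\<And>x. (\<phi>1 has_real_derivative \<phi>2 x) (at x)" and c2: "continuous_on UNIV \<phi>2"
    and a: "a < T" "\<And>x. a < \<bar>x\<bar> \<Longrightarrow> \<phi> x = 0"
    unfolding C02_with_def by blast
  \<comment> \<open>Because \<open>a < T\<close> strictly, \<open>\<phi>\<close> vanishes in a whole
    neighbourhood of each end point, and its derivative vanishes there too.\<close>
  have z1: "\<phi>1 x = 0" if "\<bar>x\<bar> = T" for x
  proof -
    have "eventually (\<lambda>y. a < \<bar>y\<bar>) (nhds x)"
      using a(1) that by (intro order_tendstoD(1)[of _ "\<bar>x\<bar>"]) (auto intro!: tendsto_intros filterlim_ident)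
    then have "eventually (\<lambda>y. \<phi> y = 0) (nhds x)" by eventually_elim (use a in auto)
    then have "(\<phi> has_real_derivative \<phi>1 x) (at x) = ((\<lambda>_. 0) has_real_derivative \<phi>1 x) (at x)"
      by (intro DERIV_cong_ev) auto
    then have "((\<lambda>_. 0::real) has_real_derivative \<phi>1 x) (at x)" using d1 by blast
    then show ?thesis using DERIV_unique[OF _ DERIV_const] by blast
  qed
  have z0: "\<phi> x = 0" if "\<bar>x\<bar> \<ge> T" for x using C02_vanish[OF C that] .
  define P where "P x = exp (- z * of_real x) * (of_real (\<phi>1 x) + z * of_real (\<phi> x))" for x
  have "(P has_vector_derivative exp (- z * of_real x) * (of_real (\<phi>2 x) - z\<^sup>2 * of_real (\<phi> x))) (at x)" for x
  proof -
    have 1: "((\<lambda>x. exp (- z * of_real x)) has_vector_derivative (- z * exp (- z * of_real x))) (at x)" for x :: real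
    proof -
      have "((\<lambda>w. exp (- z * w)) has_field_derivative (- z * exp (- z * of_real x))) (at (complex_of_real x))"
        by (auto intro!: derivative_eq_intros)
      then show ?thesis by (rule has_vector_derivative_real_field)
    qed
    have 2: "((\<lambda>x. complex_of_real (\<phi>1 x) + z * of_real (\<phi> x)) has_vector_derivative (of_real (\<phi>2 x) + z * of_real (\<phi>1 x))) (at x)"
      using d1[of x] d2[of x]
      by (intro has_vector_derivative_add has_vector_derivative_mult_right has_vector_derivative_of_real)
         (auto simp: has_real_derivative_iff_has_vector_derivative)
    show ?thesis unfolding P_def
      by (rule has_vector_derivative_eq_rhs[OF has_vector_derivative_mult[OF 1 2]])
         (simp add: algebra_simps power2_eq_square)
  qed
  then have "((\<lambda>x. exp (- z * of_real x) * (of_real (\<phi>2 x) - z\<^sup>2 * of_real (\<phi> x))) has_integral (P T - P (-T))) {-T..T}"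
    using T by (intro fundamental_theorem_of_calculus) (auto intro: has_vector_derivative_at_within)
  then have F: "((\<lambda>x. exp (- z * of_real x) * of_real (\<phi>2 x) - z\<^sup>2 * (exp (- z * of_real x) * of_real (\<phi> x))) has_integral 0) {-T..T}"
    using z0 z1 T by (simp add: P_def algebra_simps)
  have cph: "continuous_on UNIV \<phi>" by (rule C02_continuous[OF C])
  have i2: "(\<lambda>x. exp (- z * of_real x) * of_real (\<phi>2 x)) integrable_on {-T..T}"
    by (intro integrable_continuous_real continuous_intros continuous_on_subset[OF c2]) auto
  have L: "lap (density lborel \<phi>) z = integral {-T..T} (\<lambda>x. exp (- z * of_real x) * of_real (\<phi> x))"
    and i0: "(\<lambda>x. exp (- z * of_real x) * of_real (\<phi> x)) integrable_on {-T..T}"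
  proof -
    have si: "set_integrable lborel {-T..T} (\<lambda>x. exp (- z * of_real x) * of_real (\<phi> x))"
      by (intro borel_integrable_atLeastAtMost' continuous_intros continuous_on_subset[OF cph]) auto
    have "lap (density lborel \<phi>) z = (CLINT x|lborel. \<phi> x *\<^sub>R exp (- z * of_real x))"
      unfolding lap_def by (subst integral_density) (use nn in auto)
    also have "\<dots> = (CLINT x:{-T..T}|lborel. exp (- z * of_real x) * of_real (\<phi> x))"
      unfolding set_lebesgue_integral_def
    proof (intro Bochner_Integration.integral_cong refl)
      fix x
      show "\<phi> x *\<^sub>R exp (- z * of_real x) = indicator {-T..T} x *\<^sub>R (exp (- z * of_real x) * of_real (\<phi> x))"
        using z0[of x] by (cases "x \<in> {-T..T}") (auto simp: scaleR_conv_of_real)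
    qed
    also have "\<dots> = integral {-T..T} (\<lambda>x. exp (- z * of_real x) * of_real (\<phi> x))"
      by (rule set_borel_integral_eq_integral) (rule si)
    finally show "lap (density lborel \<phi>) z = integral {-T..T} (\<lambda>x. exp (- z * of_real x) * of_real (\<phi> x))" .
    show "(\<lambda>x. exp (- z * of_real x) * of_real (\<phi> x)) integrable_on {-T..T}"
      using set_borel_integral_eq_integral(1)[OF si] .
  qed
  have "z\<^sup>2 * lap (density lborel \<phi>) z = integral {-T..T} (\<lambda>x. exp (- z * of_real x) * of_real (\<phi>2 x))"
  proof -
    have "integral {-T..T} (\<lambda>x. exp (- z * of_real x) * of_real (\<phi>2 x) - z\<^sup>2 * (exp (- z * of_real x) * of_real (\<phi> x))) = 0"
      using F by (rule integral_unique)
    moreover have "(\<lambda>x. z\<^sup>2 * (exp (- z * of_real x) * of_real (\<phi> x))) integrable_on {-T..T}"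
      using i0 by (rule integrable_on_mult_right)
    ultimately show ?thesis unfolding L using i2 by (simp add: integral_diff)
  qed
  then have "(norm z)\<^sup>2 * norm (lap (density lborel \<phi>) z) = norm (integral {-T..T} (\<lambda>x. exp (- z * of_real x) * of_real (\<phi>2 x)))"
    by (metis norm_mult norm_power)
  also have "\<dots> \<le> integral {-T..T} (\<lambda>x. exp (\<bar>Re z\<bar> * T) * \<bar>\<phi>2 x\<bar>)"
  proof (rule integral_norm_bound_integral[OF i2])
    show "(\<lambda>x. exp (\<bar>Re z\<bar> * T) * \<bar>\<phi>2 x\<bar>) integrable_on {-T..T}"
      by (intro integrable_continuous_real continuous_intros continuous_on_subset[OF c2]) auto
    fix x assume "x \<in> {-T..T}"
    then have "- (Re z * x) \<le> \<bar>Re z\<bar> * T"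
      using mult_left_mono[of "\<bar>x\<bar>" T "\<bar>Re z\<bar>"] abs_ge_minus_self[of "Re z * x"] by (auto simp: abs_mult abs_le_iff)
    then show "norm (exp (- z * of_real x) * of_real (\<phi>2 x)) \<le> exp (\<bar>Re z\<bar> * T) * \<bar>\<phi>2 x\<bar>"
      by (auto simp: norm_mult intro!: mult_right_mono)
  qed
  finally show ?thesis by simp
qed

text \<open>On \<open>Re z = s\<close> the squared modulus of \<open>z\<close> is
  \<open>s\<^sup>2 + t\<^sup>2\<close>, so this is the majorant for every kernel with inverse-square
  decay.\<close>

lemma integrable_inverse_square_line:
  assumes "s \<noteq> 0"
  shows "integrable lborel (\<lambda>t. 1 / (s\<^sup>2 + t\<^sup>2) :: real)"
proof (rule Bochner_Integration.integrable_bound)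
  have "integrable lborel (\<lambda>t::real. inverse (1 + t\<^sup>2))"
    using integrable_inverse_1_plus_square by (simp add: set_integrable_def einterval_def)
  then show "integrable lborel (\<lambda>t::real. max 1 (1 / s\<^sup>2) * inverse (1 + t\<^sup>2))" by simp
  show "AE t in lborel. norm (1 / (s\<^sup>2 + t\<^sup>2)) \<le> norm (max 1 (1 / s\<^sup>2) * inverse (1 + t\<^sup>2))"
  proof (rule AE_I2)
    fix t :: real
    have s: "s\<^sup>2 > 0" using assms by simp
    have "1 + t\<^sup>2 \<le> max 1 (1 / s\<^sup>2) * s\<^sup>2 + max 1 (1 / s\<^sup>2) * t\<^sup>2"
    proof (intro add_mono)
      have "1 / s\<^sup>2 * s\<^sup>2 \<le> max 1 (1 / s\<^sup>2) * s\<^sup>2" by (intro mult_right_mono) auto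
      then show "1 \<le> max 1 (1 / s\<^sup>2) * s\<^sup>2" using s by simp
      show "t\<^sup>2 \<le> max 1 (1 / s\<^sup>2) * t\<^sup>2" using mult_right_mono[of 1 "max 1 (1 / s\<^sup>2)" "t\<^sup>2"] by simp
    qed
    then have "1 / (s\<^sup>2 + t\<^sup>2) \<le> max 1 (1 / s\<^sup>2) * inverse (1 + t\<^sup>2)"
      using s by (simp add: field_simps add_pos_nonneg)
    then show "norm (1 / (s\<^sup>2 + t\<^sup>2)) \<le> norm (max 1 (1 / s\<^sup>2) * inverse (1 + t\<^sup>2))" by simp
  qed
qed measurable

section \<open>Measures with exponential moments\<close>

text \<open>Mean value inequality on a half-plane, which is convex and on which the derivative of
  \<open>exp\<close> has modulus at most \<open>exp R\<close>.\<close>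

lemma norm_exp_diff_le:
  fixes a b :: complex
  assumes "Re a \<le> R" "Re b \<le> R"
  shows "norm (exp a - exp b) \<le> exp R * norm (a - b)"
  by (rule field_differentiable_bound[of "{z. Re z \<le> R}" exp exp])
     (use assms in \<open>auto simp: convex_halfspace_Re_le intro!: derivative_eq_intros\<close>)

lemma norm_lebesgue_integral_le:
  fixes f :: "'a \<Rightarrow> 'b :: {banach, second_countable_topology}"
  assumes "integrable M f" "integrable M g" "\<And>x. norm (f x) \<le> g x"
  shows "norm (integral\<^sup>L M f) \<le> (LINT x|M. g x)"
  by (rule order_trans[OF integral_norm_bound integral_mono]) (use assms in auto)

text \<open>The mass is left free so that \<open>p\<close>, its smooth component and the singular
  part \<open>g\<close> of mass \<open>lam\<close> are all instances.\<close>

locale exp_moment = finite_borel_measure M for M :: "real measure" +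
  fixes \<tau> C :: real
  assumes tau: "0 < \<tau>" and C: "0 \<le> C"
    and moment: "(\<integral>\<^sup>+x. ennreal (exp (\<tau> * \<bar>x\<bar>)) \<partial>M) \<le> ennreal C"
begin

lemma sets_M_borel [measurable_cong]: "sets M = sets borel"
  by (rule M_is_borel)

lemma space_M_UNIV [simp]: "space M = UNIV"
  using sets_eq_imp_space_eq[OF M_is_borel] by simp

lemma integrable_exp_tau: "integrable M (\<lambda>x. exp (\<tau> * \<bar>x\<bar>))"
  by (rule integrableI_bounded) (use moment in \<open>auto intro: order.strict_trans1\<close>)

lemma integral_exp_tau_le: "(LINT x|M. exp (\<tau> * \<bar>x\<bar>)) \<le> C"
proof -
  have "ennreal (LINT x|M. exp (\<tau> * \<bar>x\<bar>)) = (\<integral>\<^sup>+x. ennreal (exp (\<tau> * \<bar>x\<bar>)) \<partial>M)"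
    by (rule nn_integral_eq_integral[symmetric]) (auto simp: integrable_exp_tau)
  then have "ennreal (LINT x|M. exp (\<tau> * \<bar>x\<bar>)) \<le> ennreal C" using moment by simp
  then show ?thesis using C ennreal_le_iff by blast
qed

lemma integrable_exp_tau_bound:
  fixes f :: "real \<Rightarrow> 'b :: {banach, second_countable_topology}"
  assumes [measurable]: "f \<in> borel_measurable borel" and "\<And>x. norm (f x) \<le> K * exp (\<tau> * \<bar>x\<bar>)"
  shows "integrable M f"
  by (rule Bochner_Integration.integrable_bound[of M "\<lambda>x. K * exp (\<tau> * \<bar>x\<bar>)"])
     (use assms integrable_exp_tau in \<open>auto intro!: AE_I2 order_trans[OF assms(2)]\<close>)

text \<open>Convexity: \<open>r * u\<close> lies between 0 and \<open>\<tau> * u\<close>, where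
  \<open>exp\<close> stays below its chord. Integrated, this gives a change linear in
  \<open>r\<close> with slope \<open>C / \<tau>\<close>, the same for the whole family.\<close>

lemma exp_secant_bound:
  assumes "0 \<le> r" "r \<le> \<tau>" "0 \<le> u"
  shows "exp (r * u) - 1 \<le> r / \<tau> * exp (\<tau> * u)"
proof -
  have "convex_on UNIV (exp :: real \<Rightarrow> real)" by (rule exp_convex)
  then have "exp ((1 - r / \<tau>) *\<^sub>R 0 + (r / \<tau>) *\<^sub>R (\<tau> * u)) \<le> (1 - r / \<tau>) * exp 0 + (r / \<tau>) * exp (\<tau> * u)"
    by (rule convex_onD) (use assms tau in \<open>auto simp: field_simps\<close>)
  then have "exp (r * u) \<le> (1 - r / \<tau>) + (r / \<tau>) * exp (\<tau> * u)"
    using tau by simp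
  moreover have "0 \<le> r / \<tau>" using assms tau by simp
  ultimately show ?thesis by linarith
qed

lemma integral_exp_secant_bound:
  assumes "0 \<le> r" "r \<le> \<tau>"
  shows "integrable M (\<lambda>x. exp (r * \<bar>x\<bar>) - 1)" "(LINT x|M. exp (r * \<bar>x\<bar>) - 1) \<le> r / \<tau> * C"
proof -
  show i: "integrable M (\<lambda>x. exp (r * \<bar>x\<bar>) - 1)"
    by (rule integrable_exp_tau_bound[of _ "r / \<tau>"]) (use assms exp_secant_bound in auto)
  have "(LINT x|M. exp (r * \<bar>x\<bar>) - 1) \<le> (LINT x|M. r / \<tau> * exp (\<tau> * \<bar>x\<bar>))"
    by (rule integral_mono) (use i integrable_exp_tau exp_secant_bound assms in auto)
  also have "\<dots> \<le> r / \<tau> * C"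
    using integral_exp_tau_le assms tau by (simp add: divide_right_mono mult_left_mono)
  finally show "(LINT x|M. exp (r * \<bar>x\<bar>) - 1) \<le> r / \<tau> * C" .
qed

lemma nn_integral_exp_abs_le:
  assumes "0 \<le> r" "r \<le> \<tau>"
  shows "(\<integral>\<^sup>+x. ennreal (exp (r * \<bar>x\<bar>)) \<partial>M) \<le> ennreal (measure M UNIV + r / \<tau> * C)"
proof -
  note i = integral_exp_secant_bound[OF assms]
  have i': "integrable M (\<lambda>x. (exp (r * \<bar>x\<bar>) - 1) + 1)"
    using i(1) by (intro Bochner_Integration.integrable_add) auto
  have "(\<integral>\<^sup>+x. ennreal (exp (r * \<bar>x\<bar>)) \<partial>M) = ennreal (LINT x|M. (exp (r * \<bar>x\<bar>) - 1) + 1)"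
    by (subst nn_integral_eq_integral[symmetric]) (use i' in auto)
  also have "(LINT x|M. (exp (r * \<bar>x\<bar>) - 1) + 1) = (LINT x|M. exp (r * \<bar>x\<bar>) - 1) + measure M UNIV"
    using i(1) by (subst Bochner_Integration.integral_add) auto
  also have "ennreal \<dots> \<le> ennreal (measure M UNIV + r / \<tau> * C)"
    using i(2) by (intro ennreal_leI) simp
  finally show ?thesis .
qed

lemma nn_integral_exp_le:
  assumes "\<bar>s\<bar> \<le> \<tau>"
  shows "(\<integral>\<^sup>+x. ennreal (exp (- (s * x))) \<partial>M) \<le> ennreal (measure M UNIV + \<bar>s\<bar> / \<tau> * C)"
proof -
  have "- (s * x) \<le> \<bar>s\<bar> * \<bar>x\<bar>" for x by (metis abs_ge_minus_self abs_mult)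
  then have "(\<integral>\<^sup>+x. ennreal (exp (- (s * x))) \<partial>M) \<le> (\<integral>\<^sup>+x. ennreal (exp (\<bar>s\<bar> * \<bar>x\<bar>)) \<partial>M)"
    by (intro nn_integral_mono) simp
  also have "\<dots> \<le> ennreal (measure M UNIV + \<bar>s\<bar> / \<tau> * C)"
    by (rule nn_integral_exp_abs_le) (use assms in auto)
  finally show ?thesis .
qed

lemma integrable_exp_strip:
  assumes "\<bar>Re z\<bar> \<le> \<tau>"
  shows "integrable M (\<lambda>x. exp (- z * of_real x))"
  by (rule lap_integrable[OF M_is_borel]) (rule order.strict_trans1[OF nn_integral_exp_le[OF assms]], simp)

text \<open>The oscillating factor has modulus 1 and drops out, so the cost of leaving the imaginary
  axis is uniform in \<open>t\<close>. This carries estimates from the axis into a strip.\<close>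

lemma lap_minus_line_bound:
  assumes "\<bar>s\<bar> \<le> \<tau>"
  shows "norm (lap M (Complex s t) - lap M (Complex 0 t)) \<le> \<bar>s\<bar> / \<tau> * C"
proof -
  have "lap M (Complex s t) - lap M (Complex 0 t) = (CLINT x|M. exp (- Complex s t * of_real x) - exp (- Complex 0 t * of_real x))"
    unfolding lap_def using integrable_exp_strip[of "Complex s t"] integrable_exp_strip[of "Complex 0 t"] assms tau
    by (subst Bochner_Integration.integral_diff) auto
  also have "norm \<dots> \<le> (LINT x|M. exp (\<bar>s\<bar> * \<bar>x\<bar>) - 1)"
  proof (rule norm_lebesgue_integral_le)
    show "integrable M (\<lambda>x. exp (- Complex s t * of_real x) - exp (- Complex 0 t * of_real x))"
      using integrable_exp_strip[of "Complex s t"] integrable_exp_strip[of "Complex 0 t"] assms tau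
      by (intro Bochner_Integration.integrable_diff) auto
    show "integrable M (\<lambda>x. exp (\<bar>s\<bar> * \<bar>x\<bar>) - 1)"
      by (rule integral_exp_secant_bound) (use assms in auto)
    fix x
    have eq: "exp (- Complex s t * of_real x) - exp (- Complex 0 t * of_real x)
      = exp (- Complex 0 t * of_real x) * (of_real (exp (- (s * x))) - 1)"
    proof -
      have "- Complex s t * of_real x = - Complex 0 t * of_real x + of_real (- (s * x))"
        by (simp add: complex_eq_iff)
      then show ?thesis unfolding right_diff_distrib exp_of_real[symmetric] exp_add[symmetric] by simp
    qed
    have "norm (exp (- Complex s t * of_real x) - exp (- Complex 0 t * of_real x)) = \<bar>exp (- (s * x)) - 1\<bar>"
    proof -
      have "complex_of_real (exp (- (s * x))) - 1 = of_real (exp (- (s * x)) - 1)" by simp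
      then have "norm (complex_of_real (exp (- (s * x))) - 1) = \<bar>exp (- (s * x)) - 1\<bar>"
        by (simp only: norm_of_real)
      then show ?thesis using eq by (simp add: norm_mult)
    qed
    also have "\<dots> \<le> exp (\<bar>s\<bar> * \<bar>x\<bar>) - 1"
    proof -
      have a: "exp (- (s * x)) \<le> exp \<bar>s * x\<bar>" by simp
      \<comment> \<open>With \<open>u = s * x\<close>, this is
        \<open>1 - exp (- u) \<le> u \<le> exp \<bar>u\<bar> - 1\<close>.\<close>
      have b: "1 - exp (- (s * x)) \<le> exp \<bar>s * x\<bar> - 1"
      proof -
        have "1 + - (s * x) \<le> exp (- (s * x))" "1 + \<bar>s * x\<bar> \<le> exp \<bar>s * x\<bar>" by (rule exp_ge_add_one_self)+
        then show ?thesis by linarith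
      qed
      from a b show ?thesis unfolding abs_mult[symmetric] by linarith
    qed
    finally show "norm (exp (- Complex s t * of_real x) - exp (- Complex 0 t * of_real x)) \<le> exp (\<bar>s\<bar> * \<bar>x\<bar>) - 1" .
  qed
  also have "\<dots> \<le> \<bar>s\<bar> / \<tau> * C" by (rule integral_exp_secant_bound) (use assms in auto)
  finally show ?thesis .
qed

text \<open>Differentiation under the integral: near \<open>z\<close> all difference quotients are
  dominated by a multiple of \<open>exp (\<tau> * \<bar>x\<bar>)\<close>.\<close>

lemma lap_has_field_derivative:
  assumes "\<bar>Re z\<bar> < \<tau>"
  shows "(lap M has_field_derivative (CLINT x|M. - of_real x * exp (- z * of_real x))) (at z)"
proof -
  \<comment> \<open>Half the distance to the edge of the strip: one \<open>\<eta>\<close> is room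
    for the real part of \<open>w\<close>, the other pays for the factor
    \<open>\<bar>x\<bar>\<close>.\<close>
  define \<eta> where "\<eta> = (\<tau> - \<bar>Re z\<bar>) / 2"
  have \<eta>: "\<eta> > 0" "\<bar>Re z\<bar> + \<eta> = \<tau> - \<eta>" using assms by (auto simp: \<eta>_def field_simps)
  have B: "norm ((exp (- w * of_real x) - exp (- z * of_real x)) / (w - z)) \<le> 1 / \<eta> * exp (\<tau> * \<bar>x\<bar>)"
    if "w \<in> ball z \<eta>" "w \<noteq> z" for w :: complex and x :: real
  proof -
    have "\<bar>Re w\<bar> \<le> \<tau> - \<eta>"
      using that(1) abs_Re_le_cmod[of "w - z"] \<eta> by (auto simp: dist_norm norm_minus_commute)
    moreover have "\<bar>Re z\<bar> \<le> \<tau> - \<eta>" using \<eta> by auto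
    moreover have "- (y * x) \<le> (\<tau> - \<eta>) * \<bar>x\<bar>" if "\<bar>y\<bar> \<le> \<tau> - \<eta>" for y
      using mult_right_mono[OF that, of "\<bar>x\<bar>"] abs_ge_minus_self[of "y * x"] by (simp add: abs_mult)
    ultimately have ub: "- (Re w * x) \<le> (\<tau> - \<eta>) * \<bar>x\<bar>" "- (Re z * x) \<le> (\<tau> - \<eta>) * \<bar>x\<bar>"
      by blast+
    have "norm (exp (- w * of_real x) - exp (- z * of_real x)) \<le> exp ((\<tau> - \<eta>) * \<bar>x\<bar>) * norm (- w * of_real x - (- z * of_real x))"
      by (rule norm_exp_diff_le) (use ub in auto)
    also have "norm (- w * of_real x - (- z * of_real x)) = norm (w - z) * \<bar>x\<bar>"
    proof -
      have "- w * of_real x - (- z * of_real x) = - ((w - z) * of_real x)" by (simp add: algebra_simps)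
      then show ?thesis by (simp only: norm_minus_cancel norm_mult norm_of_real)
    qed
    finally have "norm ((exp (- w * of_real x) - exp (- z * of_real x)) / (w - z)) \<le> exp ((\<tau> - \<eta>) * \<bar>x\<bar>) * \<bar>x\<bar>"
      using that by (simp add: norm_divide pos_divide_le_eq mult_ac)
    also have "\<dots> \<le> exp ((\<tau> - \<eta>) * \<bar>x\<bar>) * (1 / \<eta> * exp (\<eta> * \<bar>x\<bar>))"
    proof (rule mult_left_mono)
      have "\<eta> * \<bar>x\<bar> \<le> exp (\<eta> * \<bar>x\<bar>)" using exp_ge_add_one_self[of "\<eta> * \<bar>x\<bar>"] by linarith
      then show "\<bar>x\<bar> \<le> 1 / \<eta> * exp (\<eta> * \<bar>x\<bar>)" using \<eta> by (simp add: field_simps)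
    qed simp
    also have "\<dots> = 1 / \<eta> * exp (\<tau> * \<bar>x\<bar>)"
      by (simp add: left_diff_distrib exp_diff)
    finally show ?thesis .
  qed
  have "(lap M has_field_derivative (CLINT x|M. - of_real x * exp (- z * of_real x))) (at z within ball z \<eta>)"
    unfolding has_field_derivative_iff tendsto_at_iff_sequentially
  proof safe
    fix X :: "nat \<Rightarrow> complex"
    assume X: "\<forall>i. X i \<in> ball z \<eta> - {z}" "X \<longlonglongrightarrow> z"
    have Xs: "\<bar>Re (X i)\<bar> \<le> \<tau>" for i
    proof -
      have "norm (X i - z) < \<eta>" using X(1) by (auto simp: dist_norm norm_minus_commute)
      then show ?thesis using abs_Re_le_cmod[of "X i - z"] \<eta> by auto
    qed
    have eq: "(lap M (X i) - lap M z) / (X i - z) = (CLINT x|M. (exp (- X i * of_real x) - exp (- z * of_real x)) / (X i - z))" for i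
      unfolding lap_def using integrable_exp_strip[OF Xs[of i]] integrable_exp_strip[of z] assms by simp
    show "((\<lambda>y. (lap M y - lap M z) / (y - z)) \<circ> X) \<longlonglongrightarrow> (CLINT x|M. - of_real x * exp (- z * of_real x))"
      unfolding comp_def eq
    proof (rule integral_dominated_convergence)
      show "integrable M (\<lambda>x. 1 / \<eta> * exp (\<tau> * \<bar>x\<bar>))" using integrable_exp_tau by simp
      show "AE x in M. norm ((exp (- X i * of_real x) - exp (- z * of_real x)) / (X i - z)) \<le> 1 / \<eta> * exp (\<tau> * \<bar>x\<bar>)" for i
        by (intro AE_I2 B) (use X(1) in auto)
      show "AE x in M. (\<lambda>i. (exp (- X i * of_real x) - exp (- z * of_real x)) / (X i - z)) \<longlonglongrightarrow> - of_real x * exp (- z * of_real x)"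
      proof (rule AE_I2)
        fix x
        have "((\<lambda>w. exp (- w * of_real x)) has_field_derivative (- of_real x * exp (- z * of_real x))) (at z)"
          by (auto intro!: derivative_eq_intros)
        then have "((\<lambda>w. (exp (- w * of_real x) - exp (- z * of_real x)) / (w - z)) \<longlongrightarrow> - of_real x * exp (- z * of_real x)) (at z)"
          by (simp add: has_field_derivative_iff)
        then show "(\<lambda>i. (exp (- X i * of_real x) - exp (- z * of_real x)) / (X i - z)) \<longlonglongrightarrow> - of_real x * exp (- z * of_real x)"
          by (rule filterlim_compose) (use X in \<open>auto simp: filterlim_at\<close>)
      qed
    qed measurable
  qed
  then show ?thesis using at_within_open[of z "ball z \<eta>"] \<eta>(1) by simp
qed

lemma lap_holomorphic: "lap M holomorphic_on {z. \<bar>Re z\<bar> < \<tau>}"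
  unfolding holomorphic_on_def field_differentiable_def
  using lap_has_field_derivative by (blast intro: has_field_derivative_at_within)

lemma integrable_id: "integrable M (\<lambda>x. x)"
proof (rule integrable_exp_tau_bound[of _ "1 / \<tau>"])
  fix x :: real
  have "\<tau> * \<bar>x\<bar> \<le> exp (\<tau> * \<bar>x\<bar>)" using exp_ge_add_one_self[of "\<tau> * \<bar>x\<bar>"] by linarith
  then show "norm x \<le> 1 / \<tau> * exp (\<tau> * \<bar>x\<bar>)" using tau by (simp add: field_simps)
qed simp

lemma lap_has_field_derivative_0: "(lap M has_field_derivative (- of_real (mean M))) (at 0)"
proof -
  have "(CLINT x|M. - of_real x * exp (- 0 * of_real x)) = - complex_of_real (mean M)"
    unfolding mean_def using integrable_id by simp
  then show ?thesis using lap_has_field_derivative[of 0] tau by simp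
qed

lemma lap_0: "lap M 0 = of_real (measure M UNIV)"
  unfolding lap_def by (simp add: scaleR_conv_of_real)

text \<open>A first-order expansion at 0 whose error constant depends on the moment bound alone, so
  that near 0 the linear term dominates uniformly over the family.\<close>

lemma lap_second_order:
  assumes "\<bar>Re z\<bar> \<le> \<tau> / 2"
  shows "norm (lap M z - of_real (measure M UNIV) + of_real (mean M) * z) \<le> (norm z)\<^sup>2 * (8 * C / \<tau>\<^sup>2)"
proof -
  have iz: "integrable M (\<lambda>x. exp (- z * of_real x))" using integrable_exp_strip[of z] assms tau by simp
  have ix: "integrable M (\<lambda>x. z * complex_of_real x)" using integrable_id by simp
  have "lap M z - of_real (measure M UNIV) + of_real (mean M) * z = (CLINT x|M. exp (- z * of_real x) - 1 + z * of_real x)"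
  proof -
    have "(CLINT x|M. exp (- z * of_real x) - 1 + z * of_real x) = (CLINT x|M. exp (- z * of_real x)) - of_real (measure M UNIV) + (CLINT x|M. z * of_real x)"
      using iz ix by (subst Bochner_Integration.integral_add, simp, simp, subst Bochner_Integration.integral_diff) (auto simp: scaleR_conv_of_real)
    then show ?thesis unfolding lap_def mean_def using integrable_id by (simp add: mult.commute)
  qed
  also have "norm \<dots> \<le> (LINT x|M. (norm z)\<^sup>2 * (8 / \<tau>\<^sup>2) * exp (\<tau> * \<bar>x\<bar>))"
  proof (rule norm_lebesgue_integral_le)
    show "integrable M (\<lambda>x. exp (- z * of_real x) - 1 + z * of_real x)" using iz ix by simp
    show "integrable M (\<lambda>x. (norm z)\<^sup>2 * (8 / \<tau>\<^sup>2) * exp (\<tau> * \<bar>x\<bar>))" using integrable_exp_tau by simp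
    fix x
    have "norm (exp (- z * of_real x) - (\<Sum>k\<le>1. (- z * of_real x) ^ k / fact k)) \<le> exp \<bar>Re (- z * of_real x)\<bar> * norm (- z * of_real x) ^ Suc 1 / fact 1"
      by (rule Taylor_exp)
    then have "norm (exp (- z * of_real x) - 1 + z * of_real x) \<le> exp (\<bar>Re z\<bar> * \<bar>x\<bar>) * ((norm z)\<^sup>2 * x\<^sup>2)"
      by (simp add: norm_mult abs_mult power2_eq_square algebra_simps)
    also have "\<dots> \<le> exp (\<tau> / 2 * \<bar>x\<bar>) * ((norm z)\<^sup>2 * (8 / \<tau>\<^sup>2 * exp (\<tau> / 2 * \<bar>x\<bar>)))"
    proof (intro mult_mono mult_left_mono)
      show "exp (\<bar>Re z\<bar> * \<bar>x\<bar>) \<le> exp (\<tau> / 2 * \<bar>x\<bar>)" using assms by (simp add: mult_right_mono del: times_divide_eq_left)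
      \<comment> \<open>Half of the exponent bounds the Taylor factor, the other half absorbs
        \<open>x\<^sup>2\<close>: \<open>u\<^sup>2 / 2 \<le> exp u\<close> at
        \<open>u = \<tau> / 2 * \<bar>x\<bar>\<close> produces the constant
        \<open>8 / \<tau>\<^sup>2\<close>.\<close>
      have "1 + \<tau> / 2 * \<bar>x\<bar> + (\<tau> / 2 * \<bar>x\<bar>)\<^sup>2 / 2 \<le> exp (\<tau> / 2 * \<bar>x\<bar>)"
        by (rule exp_lower_Taylor_quadratic) (use tau in auto)
      moreover have "0 \<le> \<tau> / 2 * \<bar>x\<bar>" using tau by simp
      moreover have "(\<tau> / 2 * \<bar>x\<bar>)\<^sup>2 / 2 = x\<^sup>2 * \<tau>\<^sup>2 / 8" by (simp add: power2_eq_square)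
      ultimately have "x\<^sup>2 * \<tau>\<^sup>2 / 8 \<le> exp (\<tau> / 2 * \<bar>x\<bar>)" by linarith
      then show "x\<^sup>2 \<le> 8 / \<tau>\<^sup>2 * exp (\<tau> / 2 * \<bar>x\<bar>)" using tau by (simp add: field_simps)
    qed auto
    also have "\<dots> = (norm z)\<^sup>2 * (8 / \<tau>\<^sup>2) * exp (\<tau> * \<bar>x\<bar>)"
    proof -
      have "exp (\<tau> / 2 * \<bar>x\<bar>) * exp (\<tau> / 2 * \<bar>x\<bar>) = exp (\<tau> * \<bar>x\<bar>)" by (simp flip: exp_add)
      then show ?thesis by (simp add: mult_ac)
    qed
    finally show "norm (exp (- z * of_real x) - 1 + z * of_real x) \<le> (norm z)\<^sup>2 * (8 / \<tau>\<^sup>2) * exp (\<tau> * \<bar>x\<bar>)" .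
  qed
  also have "\<dots> = (norm z)\<^sup>2 * (8 / \<tau>\<^sup>2) * (LINT x|M. exp (\<tau> * \<bar>x\<bar>))" by simp
  also have "\<dots> \<le> (norm z)\<^sup>2 * (8 / \<tau>\<^sup>2) * C"
    by (intro mult_left_mono integral_exp_tau_le) auto
  finally show ?thesis by (simp add: mult_ac)
qed

end

section \<open>Moduli on the imaginary axis\<close>

text \<open>A cosine average with phase \<open>a\<close> is the real part of the transform rotated
  by \<open>- a\<close>, with equality to the modulus when the rotation cancels the argument.
  Inequalities between moduli thus reduce to pointwise inequalities for cosines.\<close>

lemma (in real_distribution) lap_imag_axis:
  shows "(LINT x|M. cos (t * x + a)) \<le> norm (lap M (Complex 0 t))"
    and "\<exists>a. (LINT x|M. cos (t * x + a)) = norm (lap M (Complex 0 t))"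
proof -
  have i: "integrable M (\<lambda>x. exp (- Complex 0 t * complex_of_real x))"
    by (rule integrable_const_bound[of _ 1]) auto
  have *: "(LINT x|M. cos (t * x + a)) = Re (cis (- a) * lap M (Complex 0 t))" for a
  proof -
    have "Re (cis (- a) * lap M (Complex 0 t)) = Re (CLINT x|M. cis (- a) * exp (- Complex 0 t * of_real x))"
      unfolding lap_def by simp
    also have "\<dots> = (LINT x|M. Re (cis (- a) * exp (- Complex 0 t * of_real x)))"
      using i by (subst integral_Re) auto
    also have "\<dots> = (LINT x|M. cos (t * x + a))"
    proof (intro Bochner_Integration.integral_cong refl)
      fix x
      have "cis (- a) * exp (- Complex 0 t * of_real x) = cis (- (t * x + a))"
      proof -
        have "exp (- Complex 0 t * of_real x) = cis (- (t * x))"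
          unfolding cis_conv_exp by (rule arg_cong[where f=exp]) (simp add: complex_eq_iff)
        then show ?thesis by (simp add: cis_mult add.commute)
      qed
      then show "Re (cis (- a) * exp (- Complex 0 t * of_real x)) = cos (t * x + a)"
        by (simp del: minus_add_distrib)
    qed
    finally show ?thesis ..
  qed
  show "(LINT x|M. cos (t * x + a)) \<le> norm (lap M (Complex 0 t))"
    unfolding * using complex_Re_le_cmod[of "cis (- a) * lap M (Complex 0 t)"] by (simp add: norm_mult)
  have "lap M (Complex 0 t) = norm (lap M (Complex 0 t)) * cis (Arg (lap M (Complex 0 t)))"
    by (metis rcis_cmod_Arg rcis_def)
  then have "cis (- Arg (lap M (Complex 0 t))) * lap M (Complex 0 t) = norm (lap M (Complex 0 t)) * (cis (- Arg (lap M (Complex 0 t))) * cis (Arg (lap M (Complex 0 t))))"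
    by (metis mult.left_commute)
  also have "\<dots> = norm (lap M (Complex 0 t))" by (simp add: cis_mult)
  finally have "(LINT x|M. cos (t * x + Arg (lap M (Complex 0 t)))) = norm (lap M (Complex 0 t))"
    unfolding * by simp
  then show "\<exists>a. (LINT x|M. cos (t * x + a)) = norm (lap M (Complex 0 t))" ..
qed

text \<open>Pointwise \<open>1 - cos (2 * u) \<le> 4 * (1 - cos u)\<close>, the difference being
  \<open>2 * (1 - cos u)\<^sup>2\<close>. The phase \<open>a\<close> is optimal at \<open>t\<close>;
  the phase \<open>2 * a\<close> at \<open>2 * t\<close> need not be, since there the modulus only
  has to bound the cosine average from above.\<close>

lemma (in real_distribution) lap_imag_axis_doubling:
  "1 - norm (lap M (Complex 0 (2 * t))) \<le> 4 * (1 - norm (lap M (Complex 0 t)))"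
proof -
  obtain a where a: "(LINT x|M. cos (t * x + a)) = norm (lap M (Complex 0 t))"
    using lap_imag_axis(2) by blast
  have ic: "integrable M (\<lambda>x. cos (t * x + a))" for t a
    by (rule integrable_const_bound[of _ 1]) auto
  have "(LINT x|M. 1 - cos (2 * t * x + 2 * a)) \<le> (LINT x|M. 4 * (1 - cos (t * x + a)))"
  proof (rule integral_mono)
    fix x
    define c where "c = cos (t * x + a)"
    have "cos (2 * t * x + 2 * a) = 2 * c\<^sup>2 - 1"
      using cos_double_cos[of "t * x + a"] by (simp add: algebra_simps c_def)
    moreover have "c \<le> 1" "- 1 \<le> c" by (auto simp: c_def)
    then have "0 \<le> (1 - c) * (1 - c)" by simp
    ultimately show "1 - cos (2 * t * x + 2 * a) \<le> 4 * (1 - cos (t * x + a))"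
      unfolding c_def[symmetric] by (simp add: power2_eq_square algebra_simps)
  qed (use ic in auto)
  then have "1 - (LINT x|M. cos (2 * t * x + 2 * a)) \<le> 4 * (1 - (LINT x|M. cos (t * x + a)))"
    using ic prob_space by simp
  then show ?thesis
    unfolding a by (rule order_trans[OF diff_left_mono[OF lap_imag_axis(1)]])
qed

lemma (in real_distribution) lap_imag_axis_doubling_power:
  "1 - norm (lap M (Complex 0 (2 ^ k * t))) \<le> 4 ^ k * (1 - norm (lap M (Complex 0 t)))"
proof (induction k)
  case (Suc k)
  have "1 - norm (lap M (Complex 0 (2 ^ Suc k * t))) \<le> 4 * (1 - norm (lap M (Complex 0 (2 ^ k * t))))"
    using lap_imag_axis_doubling[of "2 ^ k * t"] by (simp add: mult.assoc)
  also have "\<dots> \<le> 4 * (4 ^ k * (1 - norm (lap M (Complex 0 t))))" using Suc by simp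
  finally show ?case by simp
qed simp

section \<open>Shifting the line of integration\<close>

text \<open>The strip is convex, so \<open>F\<close> has a primitive on it and truncated line
  integrals become differences of its values at the corners of a rectangle. The quadratic decay
  makes the horizontal sides negligible.\<close>

lemma line_integral_shift:
  fixes F :: "complex \<Rightarrow> complex"
  assumes hol: "F holomorphic_on {z. \<bar>Re z\<bar> < R}" and r: "0 < r" "r < R"
    and bd: "\<And>z. \<bar>Re z\<bar> \<le> r \<Longrightarrow> \<bar>Im z\<bar> \<ge> L \<Longrightarrow> norm (F z) \<le> K / (Im z)\<^sup>2"
    and int: "integrable lborel (\<lambda>t. F (Complex r t))" "integrable lborel (\<lambda>t. F (Complex (-r) t))"
  shows "(CLINT t|lborel. F (Complex r t)) = (CLINT t|lborel. F (Complex (-r) t))"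
proof -
  define S where "S = {z. \<bar>Re z\<bar> < R}"
  have S: "S = {z. Re z < R} \<inter> {z. Re z > - R}" by (auto simp: S_def)
  have "convex S" "open S" unfolding S
    by (auto intro!: convex_Int open_Int simp: convex_halfspace_Re_lt convex_halfspace_Re_gt open_halfspace_Re_lt open_halfspace_Re_gt)
  with hol obtain P where P: "\<And>z. z \<in> S \<Longrightarrow> (P has_field_derivative F z) (at z)"
    using holomorphic_convex_primitive'[of S F] \<open>open S\<close>
    unfolding S_def[symmetric] by (metis at_within_open)
  \<comment> \<open>On a vertical line \<open>dz = \<i> dt\<close>, whence the factor
    \<open>- \<i>\<close>.\<close>
  have fin: "(CLINT t:{-real n..real n}|lborel. F (Complex s t)) = - \<i> * (P (Complex s (real n)) - P (Complex s (- real n)))"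
    if "\<bar>s\<bar> < R" for s n
  proof -
    have d: "((\<lambda>t. - \<i> * P (Complex s t)) has_vector_derivative F (Complex s t)) (at t)" for t
    proof -
      have "((\<lambda>t. Complex s t) has_vector_derivative \<i>) (at t)"
        unfolding Complex_eq by (auto intro!: derivative_eq_intros)
      moreover have "(P has_field_derivative F (Complex s t)) (at (Complex s t))"
        by (rule P) (use that in \<open>auto simp: S_def\<close>)
      ultimately have "((\<lambda>t. P (Complex s t)) has_vector_derivative \<i> * F (Complex s t)) (at t)"
        using field_vector_diff_chain_at[of "\<lambda>t. Complex s t" \<i> t P] by (simp add: o_def)
      then have "((\<lambda>t. - \<i> * P (Complex s t)) has_vector_derivative - \<i> * (\<i> * F (Complex s t))) (at t)"
        by (rule has_vector_derivative_mult_right)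
      then show ?thesis by (simp flip: mult.assoc)
    qed
    have "continuous_on UNIV (\<lambda>t. F (Complex s t))"
      using that
      by (intro continuous_on_compose2[OF holomorphic_on_imp_continuous_on[OF hol]])
         (auto simp: Complex_eq intro!: continuous_intros)
    then have c: "continuous_on {-real n..real n} (\<lambda>t. F (Complex s t))"
      by (rule continuous_on_subset) simp
    have "(CLINT t|lborel. indicator {-real n..real n} t *\<^sub>R F (Complex s t)) = - \<i> * P (Complex s (real n)) - (- \<i> * P (Complex s (- real n)))"
    proof (rule integral_FTC_Icc[where F="\<lambda>t. - \<i> * P (Complex s t)"])
      show "((\<lambda>t. - \<i> * P (Complex s t)) has_vector_derivative F (Complex s t)) (at t within {-real n..real n})" for t
        using d by (rule has_vector_derivative_at_within)
    qed (use c in auto)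
    then show ?thesis by (simp add: set_lebesgue_integral_def algebra_simps)
  qed
  have lim: "(\<lambda>n. CLINT t:{-real n..real n}|lborel. F (Complex s t)) \<longlonglongrightarrow> (CLINT t|lborel. F (Complex s t))"
    if "integrable lborel (\<lambda>t. F (Complex s t))" for s
    unfolding set_lebesgue_integral_def
  proof (rule integral_dominated_convergence[where w="\<lambda>t. norm (F (Complex s t))"])
    show "integrable lborel (\<lambda>t. norm (F (Complex s t)))" using that by simp
    have [measurable]: "(\<lambda>t. F (Complex s t)) \<in> borel_measurable borel" using that by simp
    show "(\<lambda>t. indicator {-real n..real n} t *\<^sub>R F (Complex s t)) \<in> borel_measurable lborel" for n by measurable
    show "(\<lambda>t. F (Complex s t)) \<in> borel_measurable lborel" by measurable
    show "AE t in lborel. (\<lambda>n. indicator {-real n..real n} t *\<^sub>R F (Complex s t)) \<longlonglongrightarrow> F (Complex s t)"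
    proof (rule AE_I2)
      fix t
      have "eventually (\<lambda>n. indicator {-real n..real n} t *\<^sub>R F (Complex s t) = F (Complex s t)) sequentially"
        using eventually_ge_at_top[of "nat \<lceil>\<bar>t\<bar>\<rceil>"]
      proof eventually_elim
        case (elim n)
        then have "\<bar>t\<bar> \<le> real n" by linarith
        then show ?case by (auto simp: indicator_def)
      qed
      then show "(\<lambda>n. indicator {-real n..real n} t *\<^sub>R F (Complex s t)) \<longlonglongrightarrow> F (Complex s t)"
        by (rule tendsto_eventually)
    qed
  qed (auto simp: indicator_def)
  have edge: "norm (P (Complex r t) - P (Complex (-r) t)) \<le> K / t\<^sup>2 * (2 * r)" if "\<bar>t\<bar> \<ge> L" for t
  proof -
    define A where "A = closed_segment (Complex (-r) t) (Complex r t)"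
    have A: "\<bar>Re z\<bar> \<le> r" "Im z = t" if "z \<in> A" for z
    proof -
      obtain u where u: "0 \<le> u" "u \<le> 1" "z = (1 - u) *\<^sub>R Complex (-r) t + u *\<^sub>R Complex r t"
        using \<open>z \<in> A\<close> unfolding A_def closed_segment_def by blast
      have "Re z = (2 * u - 1) * r" by (simp add: u algebra_simps)
      moreover have "\<bar>2 * u - 1\<bar> * r \<le> 1 * r" using u r by (intro mult_right_mono) auto
      ultimately show "\<bar>Re z\<bar> \<le> r" using r by (simp add: abs_mult)
      show "Im z = t" by (simp add: u algebra_simps)
    qed
    have "norm (P (Complex r t) - P (Complex (-r) t)) \<le> K / t\<^sup>2 * norm (Complex r t - Complex (-r) t)"
    proof (rule field_differentiable_bound[of A P F])
      show "(P has_field_derivative F z) (at z within A)" if "z \<in> A" for z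
        using A(1)[OF that] r by (intro has_field_derivative_at_within[OF P]) (auto simp: S_def)
      show "norm (F z) \<le> K / t\<^sup>2" if "z \<in> A" for z
        using bd[of z] A[OF that] \<open>\<bar>t\<bar> \<ge> L\<close> by auto
    qed (auto simp: A_def)
    also have "Complex r t - Complex (-r) t = of_real (2 * r)" by (simp add: complex_eq_iff)
    also have "norm (complex_of_real (2 * r)) = 2 * r" using r by (simp only: norm_of_real)
    finally show ?thesis .
  qed
  define E where "E n = (CLINT t:{-real n..real n}|lborel. F (Complex r t)) - (CLINT t:{-real n..real n}|lborel. F (Complex (-r) t))" for n :: nat
  have "E \<longlonglongrightarrow> (CLINT t|lborel. F (Complex r t)) - (CLINT t|lborel. F (Complex (-r) t))"
    unfolding E_def by (intro tendsto_diff lim int)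
  moreover have "E \<longlonglongrightarrow> 0"
  proof (rule Lim_null_comparison)
    show "eventually (\<lambda>n. norm (E n) \<le> 4 * K * r / (real n)\<^sup>2) sequentially"
      using eventually_ge_at_top[of "nat \<lceil>L\<rceil>"]
    proof eventually_elim
      case (elim n)
      then have n: "\<bar>real n\<bar> \<ge> L" "\<bar>- real n\<bar> \<ge> L" by linarith+
      have "E n = - \<i> * ((P (Complex r (real n)) - P (Complex (-r) (real n))) - (P (Complex r (- real n)) - P (Complex (-r) (- real n))))"
        unfolding E_def using r by (subst (1 2) fin) (auto simp: algebra_simps)
      also have "norm \<dots> \<le> norm (P (Complex r (real n)) - P (Complex (-r) (real n))) + norm (P (Complex r (- real n)) - P (Complex (-r) (- real n)))"
        unfolding norm_mult by (simp add: norm_triangle_ineq4)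
      also have "\<dots> \<le> K / (real n)\<^sup>2 * (2 * r) + K / (real n)\<^sup>2 * (2 * r)"
        using edge[OF n(1)] edge[OF n(2)] by (intro add_mono) auto
      finally show ?case by (simp add: field_simps)
    qed
    show "(\<lambda>n. 4 * K * r / (real n)\<^sup>2) \<longlonglongrightarrow> 0" by real_asymp
  qed
  ultimately have "(CLINT t|lborel. F (Complex r t)) - (CLINT t|lborel. F (Complex (-r) t)) = 0"
    by (rule LIMSEQ_unique)
  then show ?thesis by simp
qed

section \<open>Lebesgue measure on the positive half-line\<close>

definition half_lebesgue :: "real measure" where
  "half_lebesgue = density lborel (indicator {0<..})"

lemma sets_half_lebesgue [simp, measurable_cong]: "sets half_lebesgue = sets borel"
  by (simp add: half_lebesgue_def)

lemma sigma_finite_half_lebesgue: "sigma_finite_measure half_lebesgue"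
  unfolding half_lebesgue_def
  by (subst sigma_finite_measure.sigma_finite_iff_density_finite[OF lborel.sigma_finite_measure_axioms])
     (auto split: split_indicator)

lemma nn_integral_exp_half_lebesgue:
  assumes "s > 0"
  shows "(\<integral>\<^sup>+x. ennreal (exp (- (s * x))) \<partial>half_lebesgue) < \<infinity>"
proof -
  have "(\<integral>\<^sup>+x. ennreal (exp (- (s * x))) \<partial>half_lebesgue) = (\<integral>\<^sup>+x. ennreal (exp (- (s * x))) * indicator {0<..} x \<partial>lborel)"
    unfolding half_lebesgue_def by (subst nn_integral_density) (auto simp: mult.commute)
  also have "\<dots> \<le> (\<integral>\<^sup>+x. ennreal (exp (- (s * x))) * indicator {0..} x \<partial>lborel)"
    by (intro nn_integral_mono) (auto simp: indicator_def)
  also have "\<dots> = ennreal (0 - (- (exp (- (s * 0)) / s)))"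
  proof (rule nn_integral_FTC_atLeast)
    show "((\<lambda>x. - (exp (- (s * x)) / s)) \<longlongrightarrow> 0) at_top"
      using assms by real_asymp
  qed (use assms in \<open>auto intro!: derivative_eq_intros\<close>)
  also have "\<dots> < \<infinity>" by simp
  finally show ?thesis .
qed

text \<open>The source of the pole term: convolving a density with \<open>half_lebesgue\<close>
  gives its distribution function and multiplies the kernel by \<open>1 / z\<close>.\<close>

lemma lap_half_lebesgue:
  assumes "Re z > 0"
  shows "lap half_lebesgue z = 1 / z"
proof -
  have z0: "z \<noteq> 0" using assms by auto
  have i: "integrable half_lebesgue (\<lambda>x. exp (- z * of_real x))"
    by (rule lap_integrable) (use nn_integral_exp_half_lebesgue[OF assms] in auto)
  have eq: "integral\<^sup>L half_lebesgue f = (CLINT x|lborel. indicator {0<..} x *\<^sub>R f x)"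
     "integrable half_lebesgue f \<longleftrightarrow> integrable lborel (\<lambda>x. indicator {0<..} x *\<^sub>R f x)" if "f \<in> borel_measurable borel" for f
  proof -
    have *: "half_lebesgue = density lborel (\<lambda>x. ennreal (indicator {0<..} x))"
      unfolding half_lebesgue_def by (intro density_cong) (auto simp: indicator_def)
    show "integral\<^sup>L half_lebesgue f = (CLINT x|lborel. indicator {0<..} x *\<^sub>R f x)"
      unfolding * by (rule integral_density) (use that in auto)
    show "integrable half_lebesgue f \<longleftrightarrow> integrable lborel (\<lambda>x. indicator {0<..} x *\<^sub>R f x)"
      unfolding * by (rule integrable_density) (use that in auto)
  qed
  have "(LBINT x=0..\<infinity>. exp (- z * of_real x)) = 0 - (- 1 / z)"
  proof (rule interval_integral_FTC_integrable[where F="\<lambda>x. - exp (- z * of_real x) / z"])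
    fix x :: real
    have "((\<lambda>w. - exp (- z * w) / z) has_field_derivative exp (- z * of_real x)) (at (of_real x))"
      using z0 by (auto intro!: derivative_eq_intros simp: field_simps)
    then show "((\<lambda>x. - exp (- z * of_real x) / z) has_vector_derivative exp (- z * of_real x)) (at x)"
      by (rule has_vector_derivative_real_field)
    show "isCont (\<lambda>x. exp (- z * complex_of_real x)) x" by (intro continuous_intros)
  next
    show "set_integrable lborel (einterval 0 \<infinity>) (\<lambda>x. exp (- z * of_real x))"
      using i eq(2) by (simp add: set_integrable_def einterval_def greaterThan_def)
    show "(((\<lambda>x. - exp (- z * complex_of_real x) / z) \<circ> real_of_ereal) \<longlongrightarrow> - 1 / z) (at_right 0)"
      unfolding zero_ereal_def ereal_tendsto_simps
      using z0 by (auto intro!: tendsto_eq_intros)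
    show "(((\<lambda>x. - exp (- z * complex_of_real x) / z) \<circ> real_of_ereal) \<longlongrightarrow> 0) (at_left \<infinity>)"
      unfolding ereal_tendsto_simps
    proof (rule tendsto_norm_zero_cancel)
      have "((\<lambda>x. exp (- (Re z * x)) / norm z) \<longlongrightarrow> 0) at_top" using assms z0 by real_asymp
      then show "((\<lambda>x. norm (- exp (- z * complex_of_real x) / z)) \<longlongrightarrow> 0) at_top"
        by (simp add: norm_divide)
    qed
  qed simp
  then have "(CLINT x|lborel. indicator {0<..} x *\<^sub>R exp (- z * of_real x)) = 1 / z"
    by (simp add: interval_lebesgue_integral_def set_lebesgue_integral_def einterval_def greaterThan_def)
  then show ?thesis
    unfolding lap_def by (subst eq(1)) auto
qed

section \<open>Uniform estimates for a single measure\<close>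

text \<open>Only bounds shared by the family live here, so whatever is defined from them is uniform
  in \<open>p\<close>. Asking for \<open>1 \<le> C\<close> and \<open>0 \<le> \<gamma>\<close> loses
  nothing, since both bounds can be enlarged.\<close>

locale renewal_constants =
  fixes c \<tau> C \<gamma> T B :: real
  assumes c_pos: "0 < c" and tau_pos: "0 < \<tau>" and C_ge: "1 \<le> C" and gamma: "0 \<le> \<gamma>" "\<gamma> < 1"
    and T_pos: "0 < T"
begin

text \<open>\<open>1 - lap p z\<close> is bounded below by \<open>c \<bar>z\<bar> / 2\<close> for \<open>\<bar>z\<bar> \<le> \<rho>\<close>, and by \<open>\<delta>\<close> elsewhere in the
  strip \<open>\<bar>Re z\<bar> \<le> r0\<close>; \<open>2 ^ doublings\<close> moves the point \<open>\<rho> / 2\<close> to where the transform of the smooth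
  component is at most 1/2.\<close>

definition "\<rho> = min (\<tau> / 2) (c / (2 * (8 * C / \<tau>\<^sup>2)))"

definition "doublings = (SOME k::nat. 2 * B \<le> (2 ^ k * (\<rho> / 2))\<^sup>2)"

definition "\<delta> = (1 - \<gamma>) / (4 * 4 ^ doublings)"

definition "r0 = min (\<rho> / 2) (min (\<delta> * \<tau> / C) ((1 - \<gamma>) * \<tau> / (2 * C)))"

text \<open>The prefactor comes from the decay of \<open>lap \<Phi>\<close> and from the inversion
  formula. At distance at least \<open>d\<close> from 0, the first summand bounds
  \<open>(1 - lam) / ((1 - lap g z) * (1 - lap p z))\<close>, the second the pole term
  \<open>1 / (mean p * z)\<close>.\<close>

definition "decay_const r d = exp (r * T) * B / (2 * pi) * (2 / ((1 - \<gamma>) * min (d * (c / 2)) \<delta>) + 1 / (c * d))"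

text \<open>The first entry of the minimum keeps to the range of the second-order expansion; the
  second is tuned so that its quadratic error is at most half of the linear term
  \<open>c * norm z\<close>.\<close>

lemma rho: "0 < \<rho>" "\<rho> \<le> \<tau> / 2" "\<rho> * (8 * C / \<tau>\<^sup>2) \<le> c / 2"
proof -
  have D: "0 < 8 * C / \<tau>\<^sup>2" using C_ge tau_pos by simp
  show "0 < \<rho>" using C_ge c_pos tau_pos unfolding \<rho>_def by simp
  show "\<rho> \<le> \<tau> / 2" unfolding \<rho>_def by simp
  have "\<rho> \<le> c / (2 * (8 * C / \<tau>\<^sup>2))" unfolding \<rho>_def by simp
  then have "\<rho> * (8 * C / \<tau>\<^sup>2) \<le> c / (2 * (8 * C / \<tau>\<^sup>2)) * (8 * C / \<tau>\<^sup>2)"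
    using D by (intro mult_right_mono) auto
  also have "\<dots> = c / 2" using C_ge tau_pos by simp
  finally show "\<rho> * (8 * C / \<tau>\<^sup>2) \<le> c / 2" .
qed

text \<open>Powers of 4 are unbounded, so the choice in the definition is legitimate. It makes
  \<open>B / s\<^sup>2\<close>, which bounds the transform of the smooth component, at most 1/2 at
  the doubled point \<open>s\<close>.\<close>

lemma doublings: "2 * B \<le> (2 ^ doublings * (\<rho> / 2))\<^sup>2"
proof -
  obtain k where k: "2 * B / (\<rho> / 2)\<^sup>2 < 4 ^ k" using real_arch_pow[of 4] by auto
  have "2 * B \<le> 4 ^ k * (\<rho> / 2)\<^sup>2"
    using k rho(1) by (simp add: pos_divide_less_eq less_imp_le)
  also have "\<dots> = (2 ^ k * (\<rho> / 2))\<^sup>2"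
  proof -
    have "(4::real) ^ k = (2 ^ k)\<^sup>2" by (simp add: power2_eq_square flip: power_mult_distrib)
    then show ?thesis by (simp only: power_mult_distrib)
  qed
  finally show ?thesis unfolding doublings_def by (rule someI)
qed

lemma delta_pos: "0 < \<delta>"
  using gamma by (simp add: \<delta>_def)

text \<open>Three caps: \<open>\<rho> / 2\<close> puts \<open>z\<close> in the disc of radius
  \<open>\<rho>\<close> once \<open>\<bar>Im z\<bar> < \<rho> / 2\<close>; the second limits the
  loss on leaving the imaginary axis to \<open>\<delta>\<close>; the third keeps the exponential
  moments of \<open>g\<close> at most \<open>(1 + \<gamma>) / 2\<close>.\<close>

lemma r0: "0 < r0" "r0 \<le> \<rho> / 2" "r0 * C / \<tau> \<le> \<delta>" "r0 * C / \<tau> \<le> (1 - \<gamma>) / 2" "r0 < \<tau>"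
proof -
  show "0 < r0" using rho delta_pos tau_pos C_ge gamma by (simp add: r0_def)
  show "r0 \<le> \<rho> / 2" unfolding r0_def by (rule min.cobounded1)
  have "r0 \<le> \<delta> * \<tau> / C" "r0 \<le> (1 - \<gamma>) * \<tau> / (2 * C)"
    unfolding r0_def by (meson min.cobounded1 min.cobounded2 order_trans)+
  then show "r0 * C / \<tau> \<le> \<delta>" "r0 * C / \<tau> \<le> (1 - \<gamma>) / 2"
    using C_ge tau_pos by (auto simp: field_simps)
  show "r0 < \<tau>" using \<open>r0 \<le> \<rho> / 2\<close> rho tau_pos by linarith
qed

end

section \<open>One member of the family and its two components\<close>

locale smooth_component = renewal_constants +
  fixes p \<Phi> \<Psi> :: "real measure" and \<phi> \<phi>2 :: "real \<Rightarrow> real" and lam :: real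
  assumes p: "real_distribution p" and Phi: "real_distribution \<Phi>" and Psi: "real_distribution \<Psi>"
    and mean_ge: "c \<le> mean p"
    and moment_p: "(\<integral>\<^sup>+x. ennreal (exp (\<tau> * \<bar>x\<bar>)) \<partial>p) \<le> ennreal C"
    and lam: "0 \<le> lam" "lam \<le> \<gamma>"
    and phi_nonneg: "\<And>x. 0 \<le> \<phi> x" and phi_meas [measurable]: "\<phi> \<in> borel_measurable borel"
    and Phi_eq: "\<Phi> = density lborel \<phi>"
    and mix: "\<And>A. A \<in> sets borel \<Longrightarrow> measure p A = (1 - lam) * measure \<Phi> A + lam * measure \<Psi> A"
    and C02: "C02_with T \<phi> \<phi>2" and B: "integral {-T..T} (\<lambda>x. \<bar>\<phi>2 x\<bar>) \<le> B"
begin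

sublocale p: real_distribution p by (rule p)
sublocale Phi: real_distribution \<Phi> by (rule Phi)
sublocale Psi: real_distribution \<Psi> by (rule Psi)

definition "g = scale_measure (ennreal lam) \<Psi>"

lemma lam_less_1: "lam < 1" using lam gamma by simp

lemma sets_g [simp, measurable_cong]: "sets g = sets borel"
  by (simp add: g_def)

lemma finite_borel_measure_g: "finite_borel_measure g"
proof (intro finite_borel_measure.intro finite_borel_measure_axioms.intro finite_measureI)
  have "emeasure g (space g) = ennreal lam * emeasure \<Psi> (space \<Psi>)"
    by (simp add: g_def space_scale_measure)
  then show "emeasure g (space g) \<noteq> \<infinity>" by (simp add: Psi.emeasure_space_1 ennreal_mult_eq_top_iff)
qed (simp_all add: g_def)

sublocale g: finite_borel_measure g by (rule finite_borel_measure_g)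

lemma space_g [simp]: "space g = UNIV" by (simp add: g_def space_scale_measure)

lemma measure_g: "measure g UNIV = lam"
  using lam Psi.prob_space by (simp add: g_def measure_scale_measure)

lemma nn_integral_smooth_part:
  assumes [measurable]: "u \<in> borel_measurable borel"
  shows "(\<integral>\<^sup>+x. u x \<partial>density lborel (\<lambda>x. ennreal ((1 - lam) * \<phi> x))) = ennreal (1 - lam) * (\<integral>\<^sup>+x. u x \<partial>\<Phi>)"
proof -
  have "(\<integral>\<^sup>+x. u x \<partial>density lborel (\<lambda>x. ennreal ((1 - lam) * \<phi> x))) = (\<integral>\<^sup>+x. ennreal (1 - lam) * (ennreal (\<phi> x) * u x) \<partial>lborel)"
    using lam_less_1 phi_nonneg
    by (subst nn_integral_density) (auto simp: ennreal_mult' mult_ac intro!: nn_integral_cong)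
  also have "\<dots> = ennreal (1 - lam) * (\<integral>\<^sup>+x. u x \<partial>\<Phi>)"
    unfolding Phi_eq by (subst nn_integral_cmult) (auto simp: nn_integral_density)
  finally show ?thesis .
qed

lemma emeasure_p_split:
  assumes A: "A \<in> sets borel"
  shows "emeasure p A = emeasure (density lborel (\<lambda>x. ennreal ((1 - lam) * \<phi> x))) A + emeasure g A"
proof -
  have "emeasure (density lborel (\<lambda>x. ennreal ((1 - lam) * \<phi> x))) A = ennreal (1 - lam) * emeasure \<Phi> A"
    using nn_integral_smooth_part[of "indicator A"] A by simp
  also have "\<dots> = ennreal ((1 - lam) * measure \<Phi> A)"
    using lam_less_1 by (simp add: Phi.emeasure_eq_measure ennreal_mult')
  finally have 1: "emeasure (density lborel (\<lambda>x. ennreal ((1 - lam) * \<phi> x))) A = ennreal ((1 - lam) * measure \<Phi> A)" .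
  have 2: "emeasure g A = ennreal (lam * measure \<Psi> A)"
    using lam by (simp add: g_def Psi.emeasure_eq_measure ennreal_mult')
  show ?thesis
    unfolding 1 2 p.emeasure_eq_measure mix[OF A]
    using lam lam_less_1 by (subst ennreal_plus) auto
qed

lemma nn_integral_p_split:
  assumes "u \<in> borel_measurable borel"
  shows "(\<integral>\<^sup>+x. u x \<partial>p) = ennreal (1 - lam) * (\<integral>\<^sup>+x. u x \<partial>\<Phi>) + (\<integral>\<^sup>+x. u x \<partial>g)"
  unfolding nn_integral_smooth_part[OF assms, symmetric]
  by (rule nn_integral_sum_measure) (use assms emeasure_p_split in auto)

sublocale mp: exp_moment p \<tau> C
  by unfold_locales (use tau_pos C_ge moment_p in auto)

text \<open>\<open>g\<close> is dominated by \<open>p\<close> and inherits its moment bound.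
  Normalising to \<open>\<Psi>\<close> would cost the factor \<open>1 / lam\<close>, which is not
  controlled.\<close>

sublocale mg: exp_moment g \<tau> C
proof unfold_locales
  have "(\<integral>\<^sup>+x. ennreal (exp (\<tau> * \<bar>x\<bar>)) \<partial>g) \<le> (\<integral>\<^sup>+x. ennreal (exp (\<tau> * \<bar>x\<bar>)) \<partial>p)"
    by (subst nn_integral_p_split) auto
  then show "(\<integral>\<^sup>+x. ennreal (exp (\<tau> * \<bar>x\<bar>)) \<partial>g) \<le> ennreal C"
    using moment_p by (rule order_trans)
qed (use tau_pos C_ge in auto)

sublocale mPhi: exp_moment \<Phi> \<tau> "exp (\<tau> * T)"
proof unfold_locales
  have "(\<integral>\<^sup>+x. ennreal (exp (\<tau> * \<bar>x\<bar>)) \<partial>\<Phi>) = (\<integral>\<^sup>+x. ennreal (\<phi> x) * ennreal (exp (\<tau> * \<bar>x\<bar>)) \<partial>lborel)"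
    unfolding Phi_eq by (subst nn_integral_density) auto
  also have "\<dots> \<le> (\<integral>\<^sup>+x. ennreal (\<phi> x) * ennreal (exp (\<tau> * T)) \<partial>lborel)"
  proof (rule nn_integral_mono)
    fix x
    show "ennreal (\<phi> x) * ennreal (exp (\<tau> * \<bar>x\<bar>)) \<le> ennreal (\<phi> x) * ennreal (exp (\<tau> * T))"
      using C02_vanish[OF C02, of x] tau_pos
      by (cases "T \<le> \<bar>x\<bar>") (auto intro!: mult_left_mono)
  qed
  also have "\<dots> = (\<integral>\<^sup>+x. ennreal (exp (\<tau> * T)) \<partial>\<Phi>)"
    unfolding Phi_eq by (subst nn_integral_density) auto
  also have "\<dots> = ennreal (exp (\<tau> * T))"
    using Phi.emeasure_space_1 by simp
  finally show "(\<integral>\<^sup>+x. ennreal (exp (\<tau> * \<bar>x\<bar>)) \<partial>\<Phi>) \<le> ennreal (exp (\<tau> * T))" .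
qed (use tau_pos in auto)

lemma mean_pos: "0 < mean p" using mean_ge c_pos by simp

text \<open>\<open>p\<close> dominates \<open>(1 - lam)\<close> times \<open>\<Phi>\<close>, and
  \<open>1 - cos\<close> is nonnegative. The phase is the optimal one for \<open>p\<close>; for
  \<open>\<Phi>\<close> any phase gives a lower bound of the modulus.\<close>

lemma lap_imag_axis_component:
  "(1 - lam) * (1 - norm (lap \<Phi> (Complex 0 t))) \<le> 1 - norm (lap p (Complex 0 t))"
proof -
  obtain a where a: "(LINT x|p. cos (t * x + a)) = norm (lap p (Complex 0 t))"
    using p.lap_imag_axis(2) by blast
  have ic: "integrable p (\<lambda>x. cos (t * x + a))" "integrable \<Phi> (\<lambda>x. cos (t * x + a))"
    by (auto intro!: p.integrable_const_bound[of _ 1] Phi.integrable_const_bound[of _ 1])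
  have "ennreal ((1 - lam) * (LINT x|\<Phi>. 1 - cos (t * x + a))) = ennreal (1 - lam) * (\<integral>\<^sup>+x. ennreal (1 - cos (t * x + a)) \<partial>\<Phi>)"
    using lam_less_1 ic by (subst nn_integral_eq_integral) (auto simp: ennreal_mult')
  also have "\<dots> \<le> (\<integral>\<^sup>+x. ennreal (1 - cos (t * x + a)) \<partial>p)"
    by (subst nn_integral_p_split) auto
  also have "\<dots> = ennreal (LINT x|p. 1 - cos (t * x + a))"
    using ic by (subst nn_integral_eq_integral) auto
  finally have "(1 - lam) * (LINT x|\<Phi>. 1 - cos (t * x + a)) \<le> (LINT x|p. 1 - cos (t * x + a))"
    by (subst (asm) ennreal_le_iff) (auto intro!: integral_nonneg_AE)
  moreover have "(LINT x|p. 1 - cos (t * x + a)) = 1 - norm (lap p (Complex 0 t))"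
    using ic a p.prob_space by simp
  moreover have "(LINT x|\<Phi>. 1 - cos (t * x + a)) = 1 - (LINT x|\<Phi>. cos (t * x + a))"
    using ic Phi.prob_space by simp
  moreover have "(1 - lam) * (1 - norm (lap \<Phi> (Complex 0 t))) \<le> (1 - lam) * (1 - (LINT x|\<Phi>. cos (t * x + a)))"
    using lam_less_1 Phi.lap_imag_axis(1)[of t a] by (intro mult_left_mono) auto
  ultimately show ?thesis by simp
qed

lemma lap_Phi_bound:
  "(norm z)\<^sup>2 * norm (lap \<Phi> z) \<le> exp (\<bar>Re z\<bar> * T) * B"
proof -
  have "(norm z)\<^sup>2 * norm (lap \<Phi> z) \<le> exp (\<bar>Re z\<bar> * T) * integral {-T..T} (\<lambda>x. \<bar>\<phi>2 x\<bar>)"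
    unfolding Phi_eq by (rule lap_C02_bound[OF C02 T_pos phi_nonneg phi_meas])
  also have "\<dots> \<le> exp (\<bar>Re z\<bar> * T) * B" using B by (intro mult_left_mono) auto
  finally show ?thesis .
qed

text \<open>At the doubled point \<open>s\<close> the smooth component leaves a gap of at least
  \<open>(1 - \<gamma>) / 2\<close>; returning to \<open>t\<close> divides it by
  \<open>4 ^ doublings\<close>. The constant \<open>\<delta>\<close> is half of the result, so that
  the other half can be spent on leaving the axis.\<close>

lemma norm_lap_imag_axis_le:
  assumes "\<rho> / 2 \<le> \<bar>t\<bar>"
  shows "norm (lap p (Complex 0 t)) \<le> 1 - 2 * \<delta>"
proof -
  define s where "s = 2 ^ doublings * t"
  have "(2 ^ doublings * (\<rho> / 2))\<^sup>2 \<le> \<bar>s\<bar>\<^sup>2"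
    using assms rho(1) unfolding s_def by (intro power_mono) (auto simp: abs_mult)
  then have s: "2 * B \<le> s\<^sup>2" using doublings by simp
  have s0: "s \<noteq> 0" using assms rho(1) by (auto simp: s_def)
  have "s\<^sup>2 * norm (lap \<Phi> (Complex 0 s)) \<le> B"
    using lap_Phi_bound[of "Complex 0 s"] by (simp add: cmod_def)
  also have "B \<le> s\<^sup>2 * (1 / 2)" using s by simp
  finally have "norm (lap \<Phi> (Complex 0 s)) \<le> 1 / 2" using s0 by (subst (asm) mult_le_cancel_left_pos) auto
  then have "(1 - \<gamma>) * (1 / 2) \<le> (1 - lam) * (1 - norm (lap \<Phi> (Complex 0 s)))"
    using lam gamma by (intro mult_mono) auto
  also have "\<dots> \<le> 1 - norm (lap p (Complex 0 s))" by (rule lap_imag_axis_component)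
  also have "\<dots> \<le> 4 ^ doublings * (1 - norm (lap p (Complex 0 t)))"
    unfolding s_def by (rule p.lap_imag_axis_doubling_power)
  finally have "(1 - \<gamma>) / 2 / 4 ^ doublings \<le> 1 - norm (lap p (Complex 0 t))"
    by (simp add: field_simps)
  also have "(1 - \<gamma>) / 2 / 4 ^ doublings = 2 * \<delta>" by (simp add: \<delta>_def field_simps)
  finally show ?thesis by linarith
qed

text \<open>If \<open>\<bar>Im z\<bar> \<ge> \<rho> / 2\<close>, the gap \<open>2 * \<delta>\<close>
  on the axis exceeds the loss \<open>\<delta>\<close> of moving to \<open>Re z\<close>. Otherwise
  \<open>norm z \<le> \<rho>\<close>, and the linear term of the expansion at 0 is at least twice
  its error.\<close>

lemma norm_one_minus_lap_p_ge:
  assumes "\<bar>Re z\<bar> \<le> r0"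
  shows "min (norm z * (c / 2)) \<delta> \<le> norm (1 - lap p z)"
proof (cases "\<rho> / 2 \<le> \<bar>Im z\<bar>")
  case True
  have z: "z = Complex (Re z) (Im z)" by simp
  have "norm (lap p z - lap p (Complex 0 (Im z))) \<le> \<bar>Re z\<bar> / \<tau> * C"
    using mp.lap_minus_line_bound[of "Re z" "Im z"] assms r0 by simp
  also have "\<dots> \<le> r0 * C / \<tau>" using assms C_ge tau_pos by (simp add: divide_right_mono mult_right_mono)
  also have "\<dots> \<le> \<delta>" by (rule r0)
  finally have "norm (lap p z - lap p (Complex 0 (Im z))) \<le> \<delta>" .
  then have "norm (lap p z) \<le> 1 - \<delta>"
    using norm_lap_imag_axis_le[OF True] norm_triangle_sub[of "lap p z" "lap p (Complex 0 (Im z))"] by linarith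
  then have "\<delta> \<le> norm (1 - lap p z)"
    using norm_triangle_ineq2[of 1 "lap p z"] by simp
  then show ?thesis by simp
next
  case False
  have nz: "norm z \<le> \<rho>"
    using cmod_le[of z] False assms r0(2) by linarith
  have "norm (lap p z - 1 + of_real (mean p) * z) \<le> (norm z)\<^sup>2 * (8 * C / \<tau>\<^sup>2)"
    using mp.lap_second_order[of z] assms r0 rho p.prob_space by simp
  moreover have "norm (of_real (mean p) * z) \<le> norm (lap p z - 1 + of_real (mean p) * z) + norm (1 - lap p z)"
    using norm_triangle_ineq[of "lap p z - 1 + of_real (mean p) * z" "1 - lap p z"] by simp
  moreover have "norm (of_real (mean p) * z) = mean p * norm z" using mean_pos by (simp add: norm_mult)
  moreover have "norm z * c \<le> mean p * norm z" using mean_ge by (simp add: mult.commute mult_right_mono)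
  moreover have "(norm z)\<^sup>2 * (8 * C / \<tau>\<^sup>2) \<le> norm z * (c / 2)"
  proof -
    have "norm z * (8 * C / \<tau>\<^sup>2) \<le> \<rho> * (8 * C / \<tau>\<^sup>2)" using nz C_ge by (intro mult_right_mono) auto
    then have "norm z * (8 * C / \<tau>\<^sup>2) \<le> c / 2" using rho(3) by linarith
    then have "norm z * (norm z * (8 * C / \<tau>\<^sup>2)) \<le> norm z * (c / 2)" by (intro mult_left_mono) auto
    then show ?thesis by (simp add: power2_eq_square mult.assoc)
  qed
  ultimately have "norm z * c \<le> norm z * (c / 2) + norm (1 - lap p z)" by linarith
  then show ?thesis by simp
qed

text \<open>Leaves 0 as the only possible pole of \<open>1 / (1 - lap p z)\<close> in the strip, so
  that a shift of the line meets no other residue.\<close>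

lemma lap_p_neq_1:
  assumes "\<bar>Re z\<bar> \<le> r0" "z \<noteq> 0"
  shows "lap p z \<noteq> 1"
proof
  assume "lap p z = 1"
  moreover have "0 < min (norm z * (c / 2)) \<delta>" using assms(2) c_pos delta_pos by simp
  ultimately show False using norm_one_minus_lap_p_ge[OF assms(1)] by (simp only: diff_self norm_zero)
qed

lemma measure_g_exp_bound:
  assumes "0 \<le> r" "r \<le> r0"
  shows "measure g UNIV + r / \<tau> * C \<le> (1 + \<gamma>) / 2"
proof -
  have "r / \<tau> * C \<le> r0 * C / \<tau>" using assms tau_pos C_ge by (simp add: divide_right_mono mult_right_mono)
  then have "r / \<tau> * C \<le> (1 - \<gamma>) / 2" using r0(4) by linarith
  then show ?thesis using lam unfolding measure_g by argo
qed

lemma nn_integral_exp_g: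
  assumes "\<bar>s\<bar> \<le> r0"
  shows "(\<integral>\<^sup>+x. ennreal (exp (- (s * x))) \<partial>g) \<le> ennreal ((1 + \<gamma>) / 2)"
  using mg.nn_integral_exp_le[of s] measure_g_exp_bound[of "\<bar>s\<bar>"] assms r0(5)
  by (intro order_trans[OF mg.nn_integral_exp_le] ennreal_leI) auto

lemma nn_integral_exp_abs_g:
  assumes "0 \<le> r" "r \<le> r0"
  shows "(\<integral>\<^sup>+x. ennreal (exp (r * \<bar>x\<bar>)) \<partial>g) \<le> ennreal ((1 + \<gamma>) / 2)"
  using measure_g_exp_bound[OF assms] assms r0(5)
  by (intro order_trans[OF mg.nn_integral_exp_abs_le] ennreal_leI) auto

lemma norm_one_minus_lap_g_ge:
  assumes "\<bar>Re z\<bar> \<le> r0"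
  shows "(1 - \<gamma>) / 2 \<le> norm (1 - lap g z)"
proof -
  have "norm (lap g z) \<le> (1 + \<gamma>) / 2"
    by (rule norm_lap_le[OF sets_g _ nn_integral_exp_g[OF assms]]) (use gamma in auto)
  then show ?thesis using norm_triangle_ineq2[of 1 "lap g z"] by (simp add: field_simps)
qed

text \<open>Positive drift: the linear term \<open>- mean p * r\<close> of the expansion at 0
  outweighs the quadratic error. A moment strictly below 1 makes the renewal series converge on
  \<open>Re z = r\<close>.\<close>

lemma nn_integral_exp_p:
  assumes "0 < r" "r \<le> r0"
  shows "(\<integral>\<^sup>+x. ennreal (exp (- (r * x))) \<partial>p) \<le> ennreal (1 - r * (c / 2))" "0 \<le> 1 - r * (c / 2)" "1 - r * (c / 2) < 1"
proof -
  have i: "integrable p (\<lambda>x. exp (- (r * x)))"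
  proof -
    have "integrable p (\<lambda>x. Re (exp (- of_real r * complex_of_real x)))"
      using mp.integrable_exp_strip[of "of_real r"] assms r0(5) by (intro integrable_Re) auto
    moreover have "Re (exp (- of_real r * complex_of_real x)) = exp (- (r * x))" for x
      by (simp add: Re_exp)
    ultimately show ?thesis by simp
  qed
  define E where "E = (LINT x|p. exp (- (r * x)))"
  have "lap p (of_real r) = of_real E"
  proof -
    have "lap p (of_real r) = (CLINT x|p. of_real (exp (- (r * x))))"
      unfolding lap_def by (simp add: exp_of_real[symmetric])
    then show ?thesis unfolding E_def using i by simp
  qed
  then have "norm (of_real (E - 1 + mean p * r) :: complex) \<le> r\<^sup>2 * (8 * C / \<tau>\<^sup>2)"
    using mp.lap_second_order[of "of_real r"] assms r0 rho p.prob_space by simp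
  then have "E \<le> 1 - mean p * r + r\<^sup>2 * (8 * C / \<tau>\<^sup>2)" unfolding norm_of_real by linarith
  moreover have "c * r \<le> mean p * r" using mean_ge assms by simp
  moreover have "r\<^sup>2 * (8 * C / \<tau>\<^sup>2) \<le> r * (c / 2)"
  proof -
    have "r * (8 * C / \<tau>\<^sup>2) \<le> \<rho> * (8 * C / \<tau>\<^sup>2)" using assms r0 rho C_ge by (intro mult_right_mono) auto
    then have "r * (8 * C / \<tau>\<^sup>2) \<le> c / 2" using rho(3) by linarith
    then have "r * (r * (8 * C / \<tau>\<^sup>2)) \<le> r * (c / 2)" using assms by (intro mult_left_mono) auto
    then show ?thesis by (simp add: power2_eq_square mult.assoc)
  qed
  moreover have "c * r = r * (c / 2) + r * (c / 2)" by simp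
  ultimately have E: "E \<le> 1 - r * (c / 2)" by linarith
  have "(\<integral>\<^sup>+x. ennreal (exp (- (r * x))) \<partial>p) = ennreal E"
    unfolding E_def using i by (intro nn_integral_eq_integral) auto
  also have "\<dots> \<le> ennreal (1 - r * (c / 2))" using E by (rule ennreal_leI)
  finally show "(\<integral>\<^sup>+x. ennreal (exp (- (r * x))) \<partial>p) \<le> ennreal (1 - r * (c / 2))" .
  have "0 \<le> E" unfolding E_def by simp
  then show "0 \<le> 1 - r * (c / 2)" using E by linarith
  show "1 - r * (c / 2) < 1" using assms c_pos by simp
qed

section \<open>The density and the decomposition of the renewal measure\<close>

text \<open>\<open>enn2real\<close> would send an infinite value to 0; \<open>laplace_repr_q\<close>
  shows that the double sum is finite at every \<open>x\<close>.\<close>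

definition "q x = enn2real (renewal_sum p (\<lambda>y. renewal_sum g (\<lambda>z. ennreal ((1 - lam) * \<phi> (x - y - z)))))"

lemma B_nonneg: "0 \<le> B"
proof -
  have "0 \<le> integral {-T..T} (\<lambda>x. \<bar>\<phi>2 x\<bar>)" by (rule Henstock_Kurzweil_Integration.integral_nonneg) (auto intro!: integrable_continuous_real continuous_intros continuous_on_subset[OF C02_continuous2[OF C02]])
  then show ?thesis using B by linarith
qed

lemma lap_Phi_eq: "lap \<Phi> z = (CLINT u|lborel. \<phi> u *\<^sub>R exp (- z * of_real u))"
  unfolding lap_def Phi_eq by (subst integral_density) (use phi_nonneg in auto)

lemma norm_lap_Phi_le:
  assumes "\<bar>Re z\<bar> \<le> r" "z \<noteq> 0"
  shows "norm (lap \<Phi> z) \<le> exp (r * T) * B / (norm z)\<^sup>2"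
proof -
  have "(norm z)\<^sup>2 * norm (lap \<Phi> z) \<le> exp (\<bar>Re z\<bar> * T) * B" by (rule lap_Phi_bound)
  also have "\<dots> \<le> exp (r * T) * B" using assms T_pos B_nonneg by (intro mult_right_mono) auto
  finally show ?thesis using assms(2) by (simp add: field_simps)
qed

lemma measurable_lap_lines [measurable]:
  "(\<lambda>t. lap \<Phi> (Complex s t)) \<in> borel_measurable borel"
  "(\<lambda>t. lap g (Complex s t)) \<in> borel_measurable borel"
  "(\<lambda>t. lap p (Complex s t)) \<in> borel_measurable borel"
  using measurable_lap_line[OF Phi.sigma_finite_measure_axioms] measurable_lap_line[OF g.sigma_finite_measure_axioms]
    measurable_lap_line[OF p.sigma_finite_measure_axioms] by auto

lemma phi_bounded: "\<exists>K. \<forall>x. \<phi> x \<le> K"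
proof -
  have "compact (\<phi> ` {-T..T})"
    by (intro compact_continuous_image continuous_on_subset[OF C02_continuous[OF C02]]) auto
  then have "bounded (\<phi> ` {-T..T})" by (rule compact_imp_bounded)
  then obtain K where K: "\<And>x. x \<in> {-T..T} \<Longrightarrow> \<bar>\<phi> x\<bar> \<le> K" unfolding bounded_iff by fastforce
  have "\<phi> x \<le> max K 0" for x
    using K[of x] C02_vanish[OF C02, of x] by (cases "x \<in> {-T..T}") (auto simp: max_def)
  then show ?thesis by blast
qed

text \<open>Fourier inversion for the tilted function \<open>exp (- (r * x)) * \<phi> x\<close>,
  whose Fourier transform at \<open>t\<close> is \<open>lap \<Phi> (Complex r t)\<close>. Smoothness
  of \<open>\<phi>\<close> enters through the inverse-square decay, which makes this transform
  integrable.\<close>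

lemma laplace_repr_phi:
  assumes "0 < r" "r \<le> \<tau>"
  shows "laplace_repr r \<phi> (\<lambda>t. lap \<Phi> (Complex r t) / (2 * pi))"
proof -
  define f where "f x = complex_of_real (exp (- (r * x)) * \<phi> x)" for x
  have tr: "(CLINT u|lborel. exp (- (\<i> * of_real t * of_real u)) * f u) = lap \<Phi> (Complex r t)" for t
  proof -
    have "exp (- (\<i> * of_real t * of_real u)) * f u = \<phi> u *\<^sub>R exp (- Complex r t * of_real u)" for u
    proof -
      have "- Complex r t * of_real u = - (\<i> * of_real t * of_real u) + of_real (- (r * u))"
        by (simp add: complex_eq_iff)
      then have "exp (- Complex r t * of_real u) = exp (- (\<i> * of_real t * of_real u)) * of_real (exp (- (r * u)))"
        by (simp only: exp_add exp_of_real)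
      then show ?thesis by (simp add: f_def scaleR_conv_of_real mult_ac)
    qed
    then show ?thesis unfolding lap_Phi_eq by simp
  qed
  have intL: "integrable lborel (\<lambda>t. lap \<Phi> (Complex r t))"
  proof (rule Bochner_Integration.integrable_bound)
    show "integrable lborel (\<lambda>t. exp (r * T) * B * (1 / (r\<^sup>2 + t\<^sup>2)))"
      using integrable_inverse_square_line[of r] assms by (intro integrable_mult_right) auto
    show "AE t in lborel. norm (lap \<Phi> (Complex r t)) \<le> norm (exp (r * T) * B * (1 / (r\<^sup>2 + t\<^sup>2)))"
    proof (rule AE_I2)
      fix t
      have "norm (lap \<Phi> (Complex r t)) \<le> exp (r * T) * B / (norm (Complex r t))\<^sup>2"
        by (rule norm_lap_Phi_le) (use assms in \<open>auto simp: complex_eq_iff\<close>)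
      then show "norm (lap \<Phi> (Complex r t)) \<le> norm (exp (r * T) * B * (1 / (r\<^sup>2 + t\<^sup>2)))"
        using B_nonneg by (simp add: cmod_power2)
    qed
  qed measurable
  obtain K where K: "\<And>x. \<phi> x \<le> K" using phi_bounded by blast
  have fint: "integrable lborel f"
  proof -
    have "integrable \<Phi> (\<lambda>x. exp (- of_real r * complex_of_real x))"
      using mPhi.integrable_exp_strip[of "of_real r"] assms by simp
    then have "integrable lborel (\<lambda>x. \<phi> x *\<^sub>R exp (- of_real r * complex_of_real x))"
      unfolding Phi_eq by (subst (asm) integrable_density) (use phi_nonneg in auto)
    moreover have "\<phi> x *\<^sub>R exp (- of_real r * complex_of_real x) = f x" for x
      by (simp add: f_def scaleR_conv_of_real exp_of_real[symmetric])
    ultimately show ?thesis by simp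
  qed
  have inv: "(CLINT t|lborel. exp (\<i> * of_real t * of_real x) * lap \<Phi> (Complex r t)) = 2 * pi * f x" for x
    unfolding tr[symmetric]
  proof (rule fourier_inversion[OF _ fint])
    show "continuous_on UNIV f" unfolding f_def
      by (intro continuous_intros C02_continuous[OF C02])
    show "norm (f x) \<le> exp (r * T) * K" for x
    proof (cases "\<bar>x\<bar> \<le> T")
      case True
      have "exp (- (r * x)) \<le> exp (r * T)"
        using True assms mult_left_mono[of "- x" T r] by (simp add: abs_le_iff)
      then have "exp (- (r * x)) * \<phi> x \<le> exp (r * T) * K"
        using K[of x] phi_nonneg[of x] by (intro mult_mono) auto
      then show ?thesis unfolding f_def norm_of_real using phi_nonneg[of x] by simp
    next
      case False
      then show ?thesis using C02_vanish[OF C02, of x] phi_nonneg[of x] K[of x] by (simp add: f_def)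
    qed
    show "integrable lborel (\<lambda>t::real. CLINT u|lborel. exp (- (\<i> * t * u)) * f u)"
      using intL unfolding tr .
  qed
  show ?thesis
    unfolding laplace_repr_def
  proof (intro conjI allI phi_nonneg phi_meas)
    show "integrable lborel (\<lambda>t. lap \<Phi> (Complex r t) / (2 * pi))" using intL by simp
    fix x
    have "exp (Complex r t * of_real x) * (lap \<Phi> (Complex r t) / (2 * pi)) =
       of_real (exp (r * x) / (2 * pi)) * (exp (\<i> * of_real t * of_real x) * lap \<Phi> (Complex r t))" for t
    proof -
      have "Complex r t * of_real x = of_real (r * x) + \<i> * of_real t * of_real x"
        by (simp add: complex_eq_iff)
      then have "exp (Complex r t * of_real x) = of_real (exp (r * x)) * exp (\<i> * of_real t * of_real x)"
        by (simp only: exp_add exp_of_real)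
      then show ?thesis by simp
    qed
    then have "(CLINT t|lborel. exp (Complex r t * of_real x) * (lap \<Phi> (Complex r t) / (2 * pi)))
       = of_real (exp (r * x) / (2 * pi)) * (2 * pi * f x)"
      by (simp only: integral_mult_right_zero inv)
    also have "\<dots> = of_real (exp (r * x) * exp (- (r * x)) * \<phi> x)" by (simp add: f_def)
    also have "\<dots> = of_real (\<phi> x)" by (simp flip: exp_add)
    finally show "complex_of_real (\<phi> x) = (CLINT t|lborel. exp (Complex r t * of_real x) * (lap \<Phi> (Complex r t) / (2 * pi)))" ..
  qed
qed

lemma laplace_repr_q:
  assumes "0 < r" "r \<le> r0"
  shows "renewal_sum p (\<lambda>y. renewal_sum g (\<lambda>z. ennreal ((1 - lam) * \<phi> (x - y - z)))) = ennreal (q x)"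
    and "laplace_repr r q (\<lambda>t. of_real (1 - lam) * (lap \<Phi> (Complex r t) / (2 * pi)) / (1 - lap g (Complex r t)) / (1 - lap p (Complex r t)))"
proof -
  have r: "laplace_repr r \<phi> (\<lambda>t. lap \<Phi> (Complex r t) / (2 * pi))"
    by (rule laplace_repr_phi) (use assms r0 in auto)
  have 1: "laplace_repr r (\<lambda>x. (1 - lam) * \<phi> x) (\<lambda>t. of_real (1 - lam) * (lap \<Phi> (Complex r t) / (2 * pi)))"
    unfolding laplace_repr_def
  proof (intro conjI allI)
    show "integrable lborel (\<lambda>t. of_real (1 - lam) * (lap \<Phi> (Complex r t) / (2 * pi)))"
      using r unfolding laplace_repr_def by (intro integrable_mult_right) auto
    fix x
    have "(CLINT t|lborel. exp (Complex r t * of_real x) * (of_real (1 - lam) * (lap \<Phi> (Complex r t) / (2 * pi))))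
       = of_real (1 - lam) * (CLINT t|lborel. exp (Complex r t * of_real x) * (lap \<Phi> (Complex r t) / (2 * pi)))"
      unfolding integral_mult_right_zero[symmetric] by (simp only: mult.left_commute)
    also have "\<dots> = of_real (1 - lam) * of_real (\<phi> x)" using r unfolding laplace_repr_def by simp
    finally show "complex_of_real ((1 - lam) * \<phi> x) = (CLINT t|lborel. exp (Complex r t * of_real x) * (of_real (1 - lam) * (lap \<Phi> (Complex r t) / (2 * pi))))"
      by simp
  qed (use phi_nonneg lam_less_1 in auto)
  \<comment> \<open>Convolving with the renewal measure of \<open>g\<close>, then with that of
    \<open>p\<close>, divides the kernel each time by 1 minus the transform.\<close>
  obtain h where h: "\<And>x. renewal_sum g (\<lambda>z. ennreal ((1 - lam) * \<phi> (x - z))) = ennreal (h x)"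
    "laplace_repr r h (\<lambda>t. of_real (1 - lam) * (lap \<Phi> (Complex r t) / (2 * pi)) / (1 - lap g (Complex r t)))"
    using laplace_repr_renewal_sum[OF 1 finite_borel_measure_g nn_integral_exp_g] assms gamma by auto
  obtain k where k: "\<And>x. renewal_sum p (\<lambda>y. ennreal (h (x - y))) = ennreal (k x)"
    "laplace_repr r k (\<lambda>t. of_real (1 - lam) * (lap \<Phi> (Complex r t) / (2 * pi)) / (1 - lap g (Complex r t)) / (1 - lap p (Complex r t)))"
    using laplace_repr_renewal_sum[OF h(2) p.finite_borel_measure_M nn_integral_exp_p] assms by auto
  have eq: "renewal_sum p (\<lambda>y. renewal_sum g (\<lambda>z. ennreal ((1 - lam) * \<phi> (x - y - z)))) = ennreal (k x)" for x
    unfolding h(1) by (rule k(1))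
  have "q = k"
  proof
    fix x show "q x = k x" unfolding q_def eq using k(2) by (simp add: laplace_repr_def)
  qed
  then show "renewal_sum p (\<lambda>y. renewal_sum g (\<lambda>z. ennreal ((1 - lam) * \<phi> (x - y - z)))) = ennreal (q x)"
    "laplace_repr r q (\<lambda>t. of_real (1 - lam) * (lap \<Phi> (Complex r t) / (2 * pi)) / (1 - lap g (Complex r t)) / (1 - lap p (Complex r t)))"
    using eq k(2) by auto
qed

lemma q_nonneg: "0 \<le> q x"
  by (simp add: q_def)

lemma q_measurable [measurable]: "q \<in> borel_measurable borel"
  using laplace_repr_q(2)[of r0] r0 by (simp add: laplace_repr_def)

text \<open>The cancellation needs a finite double renewal sum. On a set bounded above by
  \<open>K\<close> the indicator is at most \<open>exp (r0 * (K - x))\<close>, and this weight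
  factorises into finite renewal sums for \<open>p\<close> and for \<open>g\<close>.\<close>

lemma renewal_measure_decomposition_bounded:
  assumes A: "A \<in> sets borel" "A \<subseteq> {..K}"
  shows "emeasure (renewal_measure p) A = emeasure (density lborel q) A + emeasure (renewal_measure g) A"
proof -
  have r: "0 < r0" "r0 \<le> r0" using r0 by auto
  have [measurable]: "A \<in> sets borel" by fact
  have ep: "renewal_sum p (\<lambda>x. ennreal (exp (- r0 * x))) < \<infinity>"
    using renewal_sum_geometric_le[of p "\<lambda>x. ennreal (exp (- r0 * x))" "1 - r0 * (c / 2)"]
      nn_integral_exp_conv_pow[OF p.finite_borel_measure_M, where a="- r0"] nn_integral_exp_p[OF r]
    by (auto intro: order.strict_trans1)
  have eg: "renewal_sum g (\<lambda>x. ennreal (exp (- r0 * x))) < \<infinity>"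
    using renewal_sum_geometric_le[of g "\<lambda>x. ennreal (exp (- r0 * x))" "(1 + \<gamma>) / 2"]
      nn_integral_exp_conv_pow[OF finite_borel_measure_g, where a="- r0"] nn_integral_exp_g[of r0] r gamma
    by (auto intro: order.strict_trans1)
  have "renewal_sum p (\<lambda>y. renewal_sum g (\<lambda>z. indicator A (y + z)))
     \<le> renewal_sum p (\<lambda>y. renewal_sum g (\<lambda>z. ennreal (exp (r0 * K)) * ennreal (exp (- r0 * y)) * ennreal (exp (- r0 * z))))"
  proof (intro renewal_sum_mono)
    fix y z
    have "1 \<le> exp (r0 * K) * exp (- r0 * y) * exp (- r0 * z)" if "y + z \<le> K"
      using mult_left_mono[OF that, of r0] r by (simp add: algebra_simps flip: exp_add)
    then have "indicator A (y + z) \<le> ennreal (exp (r0 * K) * exp (- r0 * y) * exp (- r0 * z))"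
      using A(2) by (auto simp: indicator_def ennreal_ge_1)
    then show "indicator A (y + z) \<le> ennreal (exp (r0 * K)) * ennreal (exp (- r0 * y)) * ennreal (exp (- r0 * z))"
      by (simp add: ennreal_mult')
  qed
  also have "\<dots> = ennreal (exp (r0 * K)) * (renewal_sum p (\<lambda>y. ennreal (exp (- r0 * y))) * renewal_sum g (\<lambda>z. ennreal (exp (- r0 * z))))"
  proof -
    have "renewal_sum g (\<lambda>z. ennreal (exp (r0 * K)) * ennreal (exp (- r0 * y)) * ennreal (exp (- r0 * z)))
      = (ennreal (exp (r0 * K)) * renewal_sum g (\<lambda>z. ennreal (exp (- r0 * z)))) * ennreal (exp (- r0 * y))" for y
      by (subst renewal_sum_cmult) (auto simp: mult_ac)
    then show ?thesis by (simp only:) (subst renewal_sum_cmult, auto simp: mult_ac)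
  qed
  also have "\<dots> < \<infinity>" using ep eg by (simp add: ennreal_mult_less_top)
  finally have fin: "renewal_sum p (\<lambda>y. renewal_sum g (\<lambda>z. indicator A (y + z))) < \<infinity>" .
  have "renewal_sum p (indicator A) = renewal_sum g (indicator A) + (\<integral>\<^sup>+x. indicator A x * ennreal (q x) \<partial>lborel)"
    using renewal_sum_split[OF p.finite_borel_measure_M finite_borel_measure_g _ emeasure_p_split _ fin]
    unfolding laplace_repr_q(1)[OF r] by auto
  then show ?thesis
    by (simp add: emeasure_renewal_measure_eq_renewal_sum emeasure_density A mult.commute add.commute)
qed

text \<open>Continuity from below along \<open>{..real n}\<close> removes the upper bound on the
  set.\<close>

lemma renewal_measure_decomposition:
  assumes A: "A \<in> sets borel"
  shows "emeasure (renewal_measure p) A = emeasure (density lborel q) A + emeasure (renewal_measure g) A"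
proof -
  define X where "X n = A \<inter> {..real n}" for n
  have X: "range X \<subseteq> sets borel" "incseq X" "\<And>n. X n \<subseteq> {..real n}"
    using A by (auto simp: X_def incseq_def)
  have UX: "(\<Union>n. X n) = A" unfolding X_def by (rule set_eqI) (simp add: real_arch_simple)
  have lim: "(\<lambda>n. emeasure M (X n)) \<longlonglongrightarrow> emeasure M A" if "sets M = sets borel" for M
    using Lim_emeasure_incseq[of X M] X that unfolding UX by simp
  have "(\<lambda>n. emeasure (density lborel q) (X n) + emeasure (renewal_measure g) (X n))
     \<longlonglongrightarrow> emeasure (density lborel q) A + emeasure (renewal_measure g) A"
    by (intro tendsto_add lim) simp_all
  moreover have "emeasure (density lborel q) (X n) + emeasure (renewal_measure g) (X n) = emeasure (renewal_measure p) (X n)" for n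
    by (rule renewal_measure_decomposition_bounded[symmetric, OF _ X(3)]) (use X(1) in auto)
  ultimately have "(\<lambda>n. emeasure (renewal_measure p) (X n)) \<longlonglongrightarrow> emeasure (density lborel q) A + emeasure (renewal_measure g) A"
    by simp
  moreover have "(\<lambda>n. emeasure (renewal_measure p) (X n)) \<longlonglongrightarrow> emeasure (renewal_measure p) A"
    by (rule lim) simp
  ultimately show ?thesis using LIMSEQ_unique by blast
qed

lemma renewal_sum_exp_abs_g:
  assumes "0 \<le> r" "r \<le> r0"
  shows "renewal_sum g (\<lambda>x. ennreal (exp (r * \<bar>x\<bar>))) \<le> ennreal (2 / (1 - \<gamma>))"
proof -
  have "renewal_sum g (\<lambda>x. ennreal (exp (r * \<bar>x\<bar>))) \<le> ennreal (1 / (1 - (1 + \<gamma>) / 2))"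
    using gamma assms
    by (intro renewal_sum_geometric_le nn_integral_exp_abs_conv_pow_le finite_borel_measure_g nn_integral_exp_abs_g) auto
  also have "1 / (1 - (1 + \<gamma>) / 2) = 2 / (1 - \<gamma>)" using gamma by (simp add: field_simps)
  finally show ?thesis .
qed

lemma emeasure_renewal_measure_g: "emeasure (renewal_measure g) UNIV \<le> ennreal (2 / (1 - \<gamma>))"
proof -
  have "emeasure (renewal_measure g) UNIV = renewal_sum g (indicator UNIV)"
    by (simp add: emeasure_renewal_measure_eq_renewal_sum)
  also have "\<dots> \<le> renewal_sum g (\<lambda>x. ennreal (exp (0 * \<bar>x\<bar>)))" by (intro renewal_sum_mono) simp
  also have "\<dots> \<le> ennreal (2 / (1 - \<gamma>))" by (rule renewal_sum_exp_abs_g) (use r0 in auto)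
  finally show ?thesis .
qed

text \<open>Markov's inequality with the weight \<open>exp (r * \<bar>y\<bar>)\<close>, whose total
  under the renewal measure of \<open>g\<close> has a bound independent of \<open>r\<close>.\<close>

lemma renewal_measure_g_tail:
  assumes "0 \<le> r" "r \<le> r0" "0 < x"
  shows "exp (r * x) * measure (renewal_measure g) ({..-x} \<union> {x..}) \<le> 2 / (1 - \<gamma>)"
proof -
  let ?A = "{..-x} \<union> {x..}"
  have "emeasure (renewal_measure g) ?A = renewal_sum g (indicator ?A)"
    by (simp add: emeasure_renewal_measure_eq_renewal_sum)
  also have "\<dots> \<le> renewal_sum g (\<lambda>y. ennreal (exp (- (r * x))) * ennreal (exp (r * \<bar>y\<bar>)))"
  proof (rule renewal_sum_mono)
    fix y
    have "1 \<le> exp (- (r * x)) * exp (r * \<bar>y\<bar>)" if "y \<in> ?A"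
    proof -
      have "x \<le> \<bar>y\<bar>" using that assms by auto
      then have "r * x \<le> r * \<bar>y\<bar>" using assms by (intro mult_left_mono) auto
      then show ?thesis by (simp flip: exp_add)
    qed
    then show "indicator ?A y \<le> ennreal (exp (- (r * x))) * ennreal (exp (r * \<bar>y\<bar>))"
      by (auto simp: indicator_def ennreal_mult'[symmetric] ennreal_ge_1)
  qed
  also have "\<dots> = ennreal (exp (- (r * x))) * renewal_sum g (\<lambda>y. ennreal (exp (r * \<bar>y\<bar>)))"
    by (rule renewal_sum_cmult) measurable
  also have "\<dots> \<le> ennreal (exp (- (r * x))) * ennreal (2 / (1 - \<gamma>))"
    by (intro mult_left_mono renewal_sum_exp_abs_g assms) auto
  also have "\<dots> = ennreal (exp (- (r * x)) * (2 / (1 - \<gamma>)))" by (rule ennreal_mult'[symmetric]) simp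
  finally have "measure (renewal_measure g) ?A \<le> exp (- (r * x)) * (2 / (1 - \<gamma>))"
    unfolding measure_def using gamma by (intro enn2real_leI) auto
  then have "exp (r * x) * measure (renewal_measure g) ?A \<le> exp (r * x) * (exp (- (r * x)) * (2 / (1 - \<gamma>)))"
    by (intro mult_left_mono) auto
  also have "\<dots> = 2 / (1 - \<gamma>)" by (simp add: exp_minus)
  finally show ?thesis .
qed

text \<open>Up to the factor \<open>exp (z x)\<close>, \<open>v\<close> is the integrand of the inversion formula for \<open>q - H / mean p\<close>,
  where \<open>H\<close> is the distribution function of \<open>\<phi>\<close>: subtracting a smoothed step instead of the step
  itself keeps the decay \<open>O(1/\<bar>z\<bar>\<^sup>2)\<close>.\<close>

definition "v z = lap \<Phi> z / (2 * pi) * (of_real (1 - lam) / ((1 - lap g z) * (1 - lap p z)) - 1 / (of_real (mean p) * z))"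

definition "H x = (LINT y|half_lebesgue. \<phi> (x - y))"

lemma laplace_repr_H:
  assumes "0 < r" "r \<le> r0"
  shows "laplace_repr r H (\<lambda>t. lap \<Phi> (Complex r t) / (2 * pi) * (1 / Complex r t))"
proof -
  have "laplace_repr r H (\<lambda>t. lap \<Phi> (Complex r t) / (2 * pi) * lap half_lebesgue (Complex r t))"
    unfolding H_def
    by (rule laplace_repr_convolution[OF laplace_repr_phi sigma_finite_half_lebesgue])
       (use assms r0 nn_integral_exp_half_lebesgue in auto)
  moreover have "lap half_lebesgue (Complex r t) = 1 / Complex r t" for t
    by (rule lap_half_lebesgue) (use assms in simp)
  ultimately show ?thesis by simp
qed

lemma H_bounds: "0 \<le> H x" "H x \<le> 1" "T \<le> x \<Longrightarrow> H x = 1"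
proof -
  show "0 \<le> H x" unfolding H_def using phi_nonneg by simp
  have H: "ennreal (H x) = (\<integral>\<^sup>+y. indicator {0<..} y * ennreal (\<phi> (x - y)) \<partial>lborel)"
  proof -
    have "ennreal (H x) = (\<integral>\<^sup>+y. ennreal (\<phi> (x - y)) \<partial>half_lebesgue)"
      unfolding H_def
      by (rule laplace_repr_convolution(1)[OF laplace_repr_phi[of r0] sigma_finite_half_lebesgue, symmetric])
         (use r0 nn_integral_exp_half_lebesgue in auto)
    then show ?thesis unfolding half_lebesgue_def by (subst (asm) nn_integral_density) auto
  qed
  have tot: "(\<integral>\<^sup>+y. ennreal (\<phi> (x - y)) \<partial>lborel) = ennreal 1"
  proof -
    have "(\<integral>\<^sup>+y. ennreal (\<phi> y) \<partial>lborel) = emeasure \<Phi> UNIV" unfolding Phi_eq by (simp add: emeasure_density)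
    also have "\<dots> = 1" using Phi.emeasure_space_1 by simp
    finally show ?thesis
      by (subst (asm) nn_integral_real_affine[where c="-1" and t=x]) auto
  qed
  have "ennreal (H x) \<le> ennreal 1"
    unfolding H tot[symmetric] by (intro nn_integral_mono) (auto simp: indicator_def)
  then show "H x \<le> 1" by (subst (asm) ennreal_le_iff) auto
  assume "T \<le> x"
  \<comment> \<open>For \<open>y \<le> 0\<close> the argument \<open>x - y\<close> is at least
    \<open>T\<close>, where \<open>\<phi>\<close> vanishes, so restricting to positive
    \<open>y\<close> loses no mass.\<close>
  then have "indicator {0<..} y * ennreal (\<phi> (x - y)) = ennreal (\<phi> (x - y))" for y
    using C02_vanish[OF C02, of "x - y"] by (auto simp: indicator_def)
  then have "ennreal (H x) = ennreal 1" unfolding H tot[symmetric] by simp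
  then show "H x = 1" using \<open>0 \<le> H x\<close> by (subst (asm) ennreal_inj) auto
qed

text \<open>Beyond \<open>T\<close> the difference vanishes; before \<open>T\<close> it is at most
  1, while \<open>exp (r * (T - x))\<close> is at least 1. This is the cost of replacing the
  smoothed step by the constant 1.\<close>

lemma H_minus_1_bound:
  assumes "0 < r"
  shows "\<bar>H x - 1\<bar> \<le> exp (r * T) * exp (- (r * x))"
proof (cases "T \<le> x")
  case False
  have "\<bar>H x - 1\<bar> \<le> 1" using H_bounds(1,2)[of x] by auto
  also have "1 \<le> exp (r * T) * exp (- (r * x))"
    using False assms mult_left_mono[of x T r] by (simp flip: exp_add)
  finally show ?thesis .
qed (simp add: H_bounds(3))

text \<open>\<open>d\<close> is the distance kept from the pole at 0: it is \<open>r\<close> on the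
  lines \<open>Re z = r\<close> and \<open>Re z = - r\<close>, and 1 far up and down the
  strip.\<close>

lemma norm_kernel_le:
  assumes "\<bar>Re z\<bar> \<le> r" "r \<le> r0" "0 < d" "d \<le> norm z"
  shows "norm (lap \<Phi> z / (2 * pi)) \<le> exp (r * T) * B / (2 * pi) / (norm z)\<^sup>2"
    and "norm (of_real (1 - lam) / ((1 - lap g z) * (1 - lap p z))) \<le> 2 / ((1 - \<gamma>) * min (d * (c / 2)) \<delta>)"
    and "norm (1 / (of_real (mean p) * z)) \<le> 1 / (c * d)"
proof -
  have z0: "z \<noteq> 0" using assms by auto
  have "norm (lap \<Phi> z) \<le> exp (r * T) * B / (norm z)\<^sup>2" by (rule norm_lap_Phi_le) (use assms z0 in auto)
  then have "norm (lap \<Phi> z) / (2 * pi) \<le> exp (r * T) * B / (norm z)\<^sup>2 / (2 * pi)" by (rule divide_right_mono) simp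
  then show "norm (lap \<Phi> z / (2 * pi)) \<le> exp (r * T) * B / (2 * pi) / (norm z)\<^sup>2"
    by (simp add: norm_divide norm_mult mult_ac)
  have m: "0 < min (d * (c / 2)) \<delta>" using assms c_pos delta_pos by simp
  have "min (d * (c / 2)) \<delta> \<le> min (norm z * (c / 2)) \<delta>"
    using assms c_pos by (intro min.mono mult_right_mono) auto
  also have "\<dots> \<le> norm (1 - lap p z)" by (rule norm_one_minus_lap_p_ge) (use assms in auto)
  finally have "min (d * (c / 2)) \<delta> \<le> norm (1 - lap p z)" .
  moreover have "(1 - \<gamma>) / 2 \<le> norm (1 - lap g z)"
    by (rule norm_one_minus_lap_g_ge) (use assms in auto)
  ultimately have le: "(1 - \<gamma>) / 2 * min (d * (c / 2)) \<delta> \<le> norm (1 - lap g z) * norm (1 - lap p z)"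
    using m gamma by (intro mult_mono) auto
  have pos: "0 < (1 - \<gamma>) / 2 * min (d * (c / 2)) \<delta>" using m gamma by (intro mult_pos_pos) auto
  have "norm (of_real (1 - lam) / ((1 - lap g z) * (1 - lap p z))) = (1 - lam) / (norm (1 - lap g z) * norm (1 - lap p z))"
    using lam_less_1 unfolding norm_divide norm_mult norm_of_real by simp
  also have "\<dots> \<le> 1 / ((1 - \<gamma>) / 2 * min (d * (c / 2)) \<delta>)"
    using lam le pos by (intro frac_le) auto
  also have "\<dots> = 2 / ((1 - \<gamma>) * min (d * (c / 2)) \<delta>)" by simp
  finally show "norm (of_real (1 - lam) / ((1 - lap g z) * (1 - lap p z))) \<le> 2 / ((1 - \<gamma>) * min (d * (c / 2)) \<delta>)" .
  have "c * d \<le> mean p * norm z" using mean_ge mean_pos assms by (intro mult_mono) auto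
  then show "norm (1 / (of_real (mean p) * z)) \<le> 1 / (c * d)"
    using mean_pos c_pos assms unfolding norm_divide norm_mult norm_of_real by (intro frac_le) auto
qed

lemma norm_v_le:
  assumes "\<bar>Re z\<bar> \<le> r" "r \<le> r0" "0 < d" "d \<le> norm z"
  shows "norm (v z) \<le> decay_const r d / (norm z)\<^sup>2"
proof -
  note k = norm_kernel_le[OF assms]
  have "norm (v z) \<le> exp (r * T) * B / (2 * pi) / (norm z)\<^sup>2 * (2 / ((1 - \<gamma>) * min (d * (c / 2)) \<delta>) + 1 / (c * d))"
    unfolding v_def norm_mult[of "lap \<Phi> z / (2 * pi)"]
    using B_nonneg by (intro mult_mono k(1) order_trans[OF norm_triangle_ineq4 add_mono[OF k(2,3)]]) auto
  then show ?thesis by (simp add: decay_const_def)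
qed

lemma norm_q_kernel_le:
  assumes "0 < r" "r \<le> r0"
  shows "norm (of_real (1 - lam) * (lap \<Phi> (Complex r t) / (2 * pi)) / (1 - lap g (Complex r t)) / (1 - lap p (Complex r t)))
    \<le> decay_const r r * (1 / (r\<^sup>2 + t\<^sup>2))"
proof -
  define z where "z = Complex r t"
  have "r \<le> norm z" using abs_Re_le_cmod[of z] assms by (simp add: z_def)
  note k = norm_kernel_le[of z r r, OF _ assms(2,1) this]
  have "norm (of_real (1 - lam) * (lap \<Phi> z / (2 * pi)) / (1 - lap g z) / (1 - lap p z))
     = norm (lap \<Phi> z / (2 * pi)) * norm (of_real (1 - lam) / ((1 - lap g z) * (1 - lap p z)))"
    unfolding norm_mult[symmetric] by (simp add: mult_ac)
  also have "\<dots> \<le> exp (r * T) * B / (2 * pi) / (norm z)\<^sup>2 * (2 / ((1 - \<gamma>) * min (r * (c / 2)) \<delta>))"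
    using assms B_nonneg by (intro mult_mono k) (auto simp: z_def)
  \<comment> \<open>The summand \<open>1 / (c * r)\<close> is added so that the same
    \<open>decay_const\<close> serves for this kernel and for \<open>v\<close>.\<close>
  also have "\<dots> \<le> exp (r * T) * B / (2 * pi) / (norm z)\<^sup>2 * (2 / ((1 - \<gamma>) * min (r * (c / 2)) \<delta>) + 1 / (c * r))"
    using assms B_nonneg c_pos by (intro mult_left_mono) auto
  also have "\<dots> = decay_const r r * (1 / (r\<^sup>2 + t\<^sup>2))"
    by (simp add: decay_const_def z_def cmod_power2)
  finally show ?thesis unfolding z_def .
qed

lemma v_line:
  assumes "0 < r" "r \<le> r0" "\<bar>s\<bar> = r"
  shows "integrable lborel (\<lambda>t. v (Complex s t))"
    and "(LINT t|lborel. norm (v (Complex s t))) \<le> decay_const r r * (LINT t|lborel. 1 / (r\<^sup>2 + t\<^sup>2))"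
proof -
  have b: "norm (v (Complex s t)) \<le> decay_const r r * (1 / (r\<^sup>2 + t\<^sup>2))" for t
  proof -
    have "r \<le> norm (Complex s t)" using abs_Re_le_cmod[of "Complex s t"] assms by simp
    then have "norm (v (Complex s t)) \<le> decay_const r r / (norm (Complex s t))\<^sup>2"
      by (intro norm_v_le) (use assms in auto)
    also have "(norm (Complex s t))\<^sup>2 = r\<^sup>2 + t\<^sup>2" using assms(3) by (simp add: cmod_power2 flip: assms(3))
    finally show ?thesis by simp
  qed
  have i: "integrable lborel (\<lambda>t. decay_const r r * (1 / (r\<^sup>2 + t\<^sup>2)))"
    using integrable_inverse_square_line[of r] assms by (intro integrable_mult_right) auto
  show iv: "integrable lborel (\<lambda>t. v (Complex s t))"
  proof (rule Bochner_Integration.integrable_bound[OF i])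
    show "(\<lambda>t. v (Complex s t)) \<in> borel_measurable lborel" unfolding v_def by measurable
    show "AE t in lborel. norm (v (Complex s t)) \<le> norm (decay_const r r * (1 / (r\<^sup>2 + t\<^sup>2)))"
      unfolding real_norm_def by (intro AE_I2 order_trans[OF b abs_ge_self])
  qed
  have "(LINT t|lborel. norm (v (Complex s t))) \<le> (LINT t|lborel. decay_const r r * (1 / (r\<^sup>2 + t\<^sup>2)))"
    by (rule integral_mono[OF integrable_norm[OF iv] i b])
  then show "(LINT t|lborel. norm (v (Complex s t))) \<le> decay_const r r * (LINT t|lborel. 1 / (r\<^sup>2 + t\<^sup>2))"
    by (simp only: integral_mult_right_zero)
qed

text \<open>The residues cancel: at 0, \<open>lap \<Phi>\<close> is 1 and \<open>1 - lap g\<close>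
  is \<open>1 - lam\<close>, while \<open>1 - lap p z\<close> behaves like
  \<open>mean p * z\<close>. Hence \<open>z * v z\<close> tends to 0 and the singularity is
  removable.\<close>

lemma v_extension:
  "\<exists>w. w holomorphic_on {z. \<bar>Re z\<bar> < r0} \<and> (\<forall>z\<in>{z. \<bar>Re z\<bar> < r0} - {0}. w z = v z)"
proof -
  define S where "S = {z::complex. \<bar>Re z\<bar> < r0}"
  have S: "S = {z. Re z < r0} \<inter> {z. Re z > - r0}" by (auto simp: S_def)
  have oS: "open S" unfolding S by (intro open_Int open_halfspace_Re_lt open_halfspace_Re_gt)
  have 0: "0 \<in> interior S" using interior_open[OF oS] r0 by (simp add: S_def)
  have sub: "S - {0} \<subseteq> {z. \<bar>Re z\<bar> < \<tau>}" using r0(5) by (auto simp: S_def)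
  have g1: "1 - lap g z \<noteq> 0" if "z \<in> S" for z
    using norm_one_minus_lap_g_ge[of z] that gamma by (auto simp: S_def)
  have p1: "1 - lap p z \<noteq> 0" if "z \<in> S - {0}" for z
    using lap_p_neq_1[of z] that by (auto simp: S_def)
  have hol: "v holomorphic_on (S - {0})"
    unfolding v_def
    using g1 p1 mean_pos
    by (intro holomorphic_intros holomorphic_on_subset[OF mPhi.lap_holomorphic sub]
        holomorphic_on_subset[OF mg.lap_holomorphic sub] holomorphic_on_subset[OF mp.lap_holomorphic sub]) auto
  have cont: "(lap M \<longlongrightarrow> lap M 0) (at 0)" if "exp_moment M \<tau> C'" for M C'
    using DERIV_isCont[OF exp_moment.lap_has_field_derivative_0[OF that]] by (simp add: isCont_def)
  have cPhi: "(lap \<Phi> \<longlongrightarrow> 1) (at 0)"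
    using cont[OF mPhi.exp_moment_axioms] Phi.prob_space by (simp add: mPhi.lap_0)
  have cg: "((\<lambda>z. 1 - lap g z) \<longlongrightarrow> of_real (1 - lam)) (at 0)"
    using cont[OF mg.exp_moment_axioms] by (auto simp: mg.lap_0 measure_g intro!: tendsto_eq_intros)
  have "((\<lambda>z. (lap p z - lap p 0) / (z - 0)) \<longlongrightarrow> - of_real (mean p)) (at 0)"
    using mp.lap_has_field_derivative_0 by (simp add: has_field_derivative_iff)
  then have "((\<lambda>z. (lap p z - 1) / z) \<longlongrightarrow> - of_real (mean p)) (at 0)"
    using p.prob_space by (simp add: mp.lap_0)
  then have *: "((\<lambda>z. - inverse ((lap p z - 1) / z)) \<longlongrightarrow> - inverse (- of_real (mean p))) (at 0)"
    using mean_pos by (intro tendsto_intros) auto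
  have cp: "((\<lambda>z. z / (1 - lap p z)) \<longlongrightarrow> 1 / of_real (mean p)) (at 0)"
  proof -
    have "- inverse ((lap p z - 1) / z) = z / (1 - lap p z)" for z
      by (metis inverse_divide minus_diff_eq minus_divide_right)
    moreover have "- inverse (- complex_of_real (mean p)) = 1 / of_real (mean p)"
      by (simp add: inverse_eq_divide)
    ultimately show ?thesis using * by simp
  qed
  have "((\<lambda>z. lap \<Phi> z / (2 * pi) * (of_real (1 - lam) / (1 - lap g z) * (z / (1 - lap p z)) - 1 / of_real (mean p)))
     \<longlongrightarrow> 1 / complex_of_real (2 * pi) * (of_real (1 - lam) / of_real (1 - lam) * (1 / of_real (mean p)) - 1 / of_real (mean p))) (at 0)"
    using lam_less_1 by (intro tendsto_intros cPhi cg cp) auto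
  then have "((\<lambda>z. lap \<Phi> z / (2 * pi) * (of_real (1 - lam) / (1 - lap g z) * (z / (1 - lap p z)) - 1 / of_real (mean p)))
     \<longlongrightarrow> 0) (at 0)" using lam_less_1 by simp
  moreover have "eventually (\<lambda>z. lap \<Phi> z / (2 * pi) * (of_real (1 - lam) / (1 - lap g z) * (z / (1 - lap p z)) - 1 / of_real (mean p)) = (z - 0) * v z) (at 0)"
    unfolding eventually_at_filter by (rule always_eventually) (auto simp: v_def field_simps)
  ultimately have "((\<lambda>z. (z - 0) * v z) \<longlongrightarrow> 0) (at 0)"
    by (rule Lim_transform_eventually)
  then show ?thesis
    using holomorphic_on_extend_lim[OF hol 0] unfolding S_def by blast
qed

lemma q_left_tail:
  assumes "0 < r" "r \<le> r0"
  shows "exp (r * x) * q (-x) \<le> decay_const r r * (LINT t|lborel. 1 / (r\<^sup>2 + t\<^sup>2))"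
proof -
  let ?K = "\<lambda>t. of_real (1 - lam) * (lap \<Phi> (Complex r t) / (2 * pi)) / (1 - lap g (Complex r t)) / (1 - lap p (Complex r t))"
  have rep: "laplace_repr r q ?K" by (rule laplace_repr_q(2)[OF assms])
  have "(LINT t|lborel. norm (?K t)) \<le> (LINT t|lborel. decay_const r r * (1 / (r\<^sup>2 + t\<^sup>2)))"
  proof (rule integral_mono)
    show "integrable lborel (\<lambda>t. norm (?K t))" using rep unfolding laplace_repr_def by (intro integrable_norm) blast
    show "integrable lborel (\<lambda>t. decay_const r r * (1 / (r\<^sup>2 + t\<^sup>2)))"
      using integrable_inverse_square_line[of r] assms by (intro integrable_mult_right) auto
  qed (rule norm_q_kernel_le[OF assms])
  also have "\<dots> = decay_const r r * (LINT t|lborel. 1 / (r\<^sup>2 + t\<^sup>2))"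
    by (simp only: integral_mult_right_zero)
  finally have I: "(LINT t|lborel. norm (?K t)) \<le> decay_const r r * (LINT t|lborel. 1 / (r\<^sup>2 + t\<^sup>2))" .
  have "q (-x) \<le> exp (r * - x) * (LINT t|lborel. norm (?K t))" by (rule laplace_repr_bound[OF rep])
  then have "exp (r * x) * q (-x) \<le> exp (r * x) * (exp (r * - x) * (LINT t|lborel. norm (?K t)))"
    by (intro mult_left_mono) auto
  also have "\<dots> = (LINT t|lborel. norm (?K t))" by (simp add: exp_minus)
  finally show ?thesis using I by linarith
qed

text \<open>On \<open>Re z = r\<close> the kernels of \<open>q\<close> and of
  \<open>H / mean p\<close> differ by \<open>v\<close>; after the shift to \<open>Re z = - r\<close>
  the factor \<open>exp (z * x)\<close> has modulus \<open>exp (- (r * x))\<close>. The summand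
  \<open>exp (r * T) / c\<close> pays for replacing \<open>H\<close> by 1. Strictness of
  \<open>r < r0\<close> keeps both lines inside the open strip where \<open>v\<close>
  extends.\<close>

lemma q_right_tail:
  assumes "0 < r" "r < r0"
  shows "exp (r * x) * \<bar>q x - 1 / mean p\<bar> \<le> decay_const r r * (LINT t|lborel. 1 / (r\<^sup>2 + t\<^sup>2)) + exp (r * T) / c"
proof -
  have r: "0 < r" "r \<le> r0" using assms by auto
  obtain w where w: "w holomorphic_on {z. \<bar>Re z\<bar> < r0}" "\<And>z. \<bar>Re z\<bar> < r0 \<Longrightarrow> z \<noteq> 0 \<Longrightarrow> w z = v z"
    using v_extension by auto
  have wl: "w (Complex s t) = v (Complex s t)" if "\<bar>s\<bar> = r" for s t
    by (rule w(2)) (use that assms in \<open>auto simp: complex_eq_iff\<close>)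
  let ?K = "\<lambda>t. of_real (1 - lam) * (lap \<Phi> (Complex r t) / (2 * pi)) / (1 - lap g (Complex r t)) / (1 - lap p (Complex r t))"
  let ?L = "\<lambda>t. lap \<Phi> (Complex r t) / (2 * pi) * (1 / Complex r t)"
  let ?e = "\<lambda>s t. exp (Complex s t * of_real x)"
  have repq: "laplace_repr r q ?K" by (rule laplace_repr_q(2)[OF r])
  have repH: "laplace_repr r H ?L" by (rule laplace_repr_H[OF r])
  have iK: "integrable lborel (\<lambda>t. ?e r t * ?K t)"
    using repq unfolding laplace_repr_def by (intro integrable_exp_line_mult) blast
  have iL: "integrable lborel (\<lambda>t. ?e r t * ?L t)"
    using repH unfolding laplace_repr_def by (intro integrable_exp_line_mult) blast
  have "complex_of_real (q x - H x / mean p) = (CLINT t|lborel. ?e r t * ?K t) - (CLINT t|lborel. ?e r t * ?L t) / of_real (mean p)"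
    using repq repH unfolding laplace_repr_def by simp
  also have "\<dots> = (CLINT t|lborel. ?e r t * ?K t - ?e r t * ?L t / of_real (mean p))"
    by (subst Bochner_Integration.integral_diff[OF iK integrable_divide[OF iL]]) (simp only: integral_divide_zero)
  also have "\<dots> = (CLINT t|lborel. ?e r t * w (Complex r t))"
  proof (intro Bochner_Integration.integral_cong refl)
    fix t
    have "w (Complex r t) = v (Complex r t)" by (rule wl) (use assms in simp)
    then show "?e r t * ?K t - ?e r t * ?L t / of_real (mean p) = ?e r t * w (Complex r t)"
      by (simp add: v_def right_diff_distrib mult_ac)
  qed
  also have "\<dots> = (CLINT t|lborel. ?e (-r) t * w (Complex (-r) t))"
  proof (rule line_integral_shift[where F="\<lambda>z. exp (z * of_real x) * w z"])
    show "(\<lambda>z. exp (z * of_real x) * w z) holomorphic_on {z. \<bar>Re z\<bar> < r0}"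
      using w(1) by (intro holomorphic_intros)
    show "integrable lborel (\<lambda>t. ?e r t * w (Complex r t))"
      using v_line(1)[OF r, of r] assms by (simp add: wl integrable_exp_line_mult)
    show "integrable lborel (\<lambda>t. ?e (-r) t * w (Complex (-r) t))"
      using v_line(1)[OF r, of "-r"] assms by (simp add: wl integrable_exp_line_mult)
    \<comment> \<open>The threshold 1 is an arbitrary choice; it gives
      \<open>norm z \<ge> 1\<close>, hence the decay bound with \<open>d = 1\<close>.\<close>
    fix z :: complex assume z: "\<bar>Re z\<bar> \<le> r" "1 \<le> \<bar>Im z\<bar>"
    have nz: "1 \<le> norm z" using z abs_Im_le_cmod[of z] by linarith
    have dc: "0 \<le> decay_const r 1"
      using B_nonneg gamma c_pos delta_pos unfolding decay_const_def by auto
    have "z \<noteq> 0" using nz by auto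
    have "norm (w z) = norm (v z)" using \<open>z \<noteq> 0\<close> w(2)[of z] z assms by simp
    also have "\<dots> \<le> decay_const r 1 / (norm z)\<^sup>2" by (rule norm_v_le) (use z nz assms in auto)
    also have "\<dots> \<le> decay_const r 1 / (Im z)\<^sup>2"
    proof (intro divide_left_mono dc mult_pos_pos)
      show "(Im z)\<^sup>2 \<le> (norm z)\<^sup>2"
        using abs_Im_le_cmod[of z] power_mono[of "\<bar>Im z\<bar>" "norm z" 2] by simp
      show "0 < (norm z)\<^sup>2" using \<open>z \<noteq> 0\<close> by simp
      have "Im z \<noteq> 0" using z by auto
      then show "0 < (Im z)\<^sup>2" by simp
    qed
    finally have "norm (w z) \<le> decay_const r 1 / (Im z)\<^sup>2" .
    moreover have "norm (exp (z * of_real x)) \<le> exp (r * \<bar>x\<bar>)"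
    proof -
      have "Re z * x \<le> \<bar>Re z\<bar> * \<bar>x\<bar>" by (metis abs_ge_self abs_mult)
      also have "\<dots> \<le> r * \<bar>x\<bar>" using z by (intro mult_right_mono) auto
      finally show ?thesis by simp
    qed
    ultimately have "norm (exp (z * of_real x)) * norm (w z) \<le> exp (r * \<bar>x\<bar>) * (decay_const r 1 / (Im z)\<^sup>2)"
      by (intro mult_mono) auto
    then show "norm (exp (z * of_real x) * w z) \<le> exp (r * \<bar>x\<bar>) * decay_const r 1 / (Im z)\<^sup>2"
      by (simp add: norm_mult)
  qed (use assms in auto)
  also have "\<dots> = (CLINT t|lborel. ?e (-r) t * v (Complex (-r) t))" using assms by (simp add: wl)
  finally have "\<bar>q x - H x / mean p\<bar> = norm (CLINT t|lborel. ?e (-r) t * v (Complex (-r) t))"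
    by (metis norm_of_real)
  also have "\<dots> \<le> exp (- r * x) * (LINT t|lborel. norm (v (Complex (-r) t)))"
    by (rule norm_exp_line_integral_le) (use v_line(1)[OF r, of "-r"] assms in auto)
  also have "\<dots> \<le> exp (- r * x) * (decay_const r r * (LINT t|lborel. 1 / (r\<^sup>2 + t\<^sup>2)))"
    by (intro mult_left_mono v_line(2)[OF r]) (use assms in auto)
  finally have 1: "\<bar>q x - H x / mean p\<bar> \<le> exp (- (r * x)) * (decay_const r r * (LINT t|lborel. 1 / (r\<^sup>2 + t\<^sup>2)))"
    by simp
  have 2: "\<bar>H x / mean p - 1 / mean p\<bar> \<le> exp (- (r * x)) * (exp (r * T) / c)"
  proof -
    have "\<bar>H x / mean p - 1 / mean p\<bar> = \<bar>H x - 1\<bar> / mean p"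
      using mean_pos by (simp flip: diff_divide_distrib)
    also have "\<dots> \<le> exp (r * T) * exp (- (r * x)) / c"
      using H_minus_1_bound[OF assms(1), of x] mean_ge c_pos by (intro frac_le) auto
    finally show ?thesis by (simp add: mult_ac)
  qed
  have "\<bar>q x - 1 / mean p\<bar> \<le> \<bar>q x - H x / mean p\<bar> + \<bar>H x / mean p - 1 / mean p\<bar>" by linarith
  also have "\<dots> \<le> exp (- (r * x)) * (decay_const r r * (LINT t|lborel. 1 / (r\<^sup>2 + t\<^sup>2)) + exp (r * T) / c)"
    using 1 2 by (simp add: distrib_left)
  finally have "exp (r * x) * \<bar>q x - 1 / mean p\<bar> \<le> exp (r * x) * (exp (- (r * x)) * (decay_const r r * (LINT t|lborel. 1 / (r\<^sup>2 + t\<^sup>2)) + exp (r * T) / c))"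
    by (intro mult_left_mono) auto
  also have "\<dots> = decay_const r r * (LINT t|lborel. 1 / (r\<^sup>2 + t\<^sup>2)) + exp (r * T) / c"
    by (simp add: exp_minus)
  finally show ?thesis .
qed

end

section \<open>Uniformity over the family\<close>

text \<open>The bounds are built from the shared constants and \<open>r\<close> alone. Stating
  existence of \<open>q\<close> and \<open>N\<close> hides the components of \<open>p\<close>, so
  that one pair can be chosen for each measure.\<close>

lemma (in renewal_constants) renewal_measure_decomposition_uniform:
  fixes p :: "real measure"
  assumes "real_distribution p" "c \<le> mean p" "(\<integral>\<^sup>+x. ennreal (exp (\<tau> * \<bar>x\<bar>)) \<partial>p) \<le> ennreal C"
    and "0 \<le> lam \<and> lam \<le> \<gamma> \<and> real_prob \<Phi> \<and> real_prob \<Psi> \<and>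
          (\<forall>x. 0 \<le> \<phi> x) \<and> \<phi> \<in> borel_measurable borel \<and> \<Phi> = density lborel \<phi> \<and>
          (\<forall>A\<in>sets borel. measure p A = (1 - lam) * measure \<Phi> A + lam * measure \<Psi> A) \<and>
          C02_with T \<phi> \<phi>2 \<and> integral {-T..T} (\<lambda>x. \<bar>\<phi>2 x\<bar>) \<le> B"
  shows "\<exists>q N. (\<forall>x. 0 \<le> q x) \<and> q \<in> borel_measurable borel \<and> sets N = sets borel \<and>
     (\<forall>A\<in>sets borel. emeasure (renewal_measure p) A = emeasure (density lborel q) A + emeasure N A) \<and>
     emeasure N UNIV \<le> ennreal (2 / (1 - \<gamma>)) \<and>
     (\<forall>r x. 0 < r \<and> r < r0 \<and> 0 < x \<longrightarrow>
        exp (r * x) * \<bar>q x - 1 / mean p\<bar> \<le> decay_const r r * (LINT t|lborel. 1 / (r\<^sup>2 + t\<^sup>2)) + exp (r * T) / c \<and>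
        exp (r * x) * q (-x) \<le> decay_const r r * (LINT t|lborel. 1 / (r\<^sup>2 + t\<^sup>2)) + exp (r * T) / c \<and>
        exp (r * x) * measure N ({..-x} \<union> {x..}) \<le> 2 / (1 - \<gamma>))"
proof -
  have rd: "real_distribution M" if "real_prob M" for M
    using that unfolding real_prob_def by (intro real_distribution.intro real_distribution_axioms.intro) auto
  interpret smooth_component c \<tau> C \<gamma> T B p \<Phi> \<Psi> \<phi> \<phi>2 lam
    by (intro smooth_component.intro smooth_component_axioms.intro renewal_constants_axioms)
       (use assms rd in blast)+
  \<comment> \<open>The left-tail bound is enlarged by \<open>exp (r * T) / c\<close> to share the
    constant of the right tail.\<close>
  have "exp (r * x) * q (-x) \<le> decay_const r r * (LINT t|lborel. 1 / (r\<^sup>2 + t\<^sup>2)) + exp (r * T) / c"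
    if "0 < r" "r < r0" for r x
    using c_pos that by (intro order_trans[OF q_left_tail]) auto
  then show ?thesis
    by (intro exI[of _ q] exI[of _ "renewal_measure g"] conjI allI ballI impI q_nonneg q_measurable
        sets_renewal_measure renewal_measure_decomposition emeasure_renewal_measure_g
        q_right_tail renewal_measure_g_tail) auto
qed

theorem theorem1p1:
  fixes \<M> :: "real measure set"
  assumes fam: "\<forall>p\<in>\<M>. real_prob p"
    and mean_pos: "\<exists>c>0. \<forall>p\<in>\<M>. c \<le> mean p"
    and expmom: "\<exists>\<tau>>0. \<exists>C::real. \<forall>p\<in>\<M>.
                   (\<integral>\<^sup>+x. ennreal (exp (\<tau> * \<bar>x\<bar>)) \<partial>p) \<le> ennreal C"
    and decomp: "\<exists>\<gamma><1. \<exists>T>0. \<exists>B::real. \<forall>p\<in>\<M>.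
        \<exists>lam \<Phi> \<Psi> \<phi> \<phi>2. 0 \<le> lam \<and> lam \<le> \<gamma> \<and>
          real_prob \<Phi> \<and> real_prob \<Psi> \<and>
          (\<forall>x. 0 \<le> \<phi> x) \<and> \<phi> \<in> borel_measurable borel \<and> \<Phi> = density lborel \<phi> \<and>
          (\<forall>A\<in>sets borel. measure p A = (1 - lam) * measure \<Phi> A + lam * measure \<Psi> A) \<and>
          C02_with T \<phi> \<phi>2 \<and>
          integral {-T..T} (\<lambda>x. \<bar>\<phi>2 x\<bar>) \<le> B"
  shows "\<exists>(q :: real measure \<Rightarrow> real \<Rightarrow> real) (Nb :: real measure \<Rightarrow> real measure).
     (\<forall>p\<in>\<M>. (\<forall>x. 0 \<le> q p x) \<and> q p \<in> borel_measurable borel \<and> sets (Nb p) = sets borel \<and>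
        (\<forall>A\<in>sets borel. emeasure (renewal_measure p) A
             = emeasure (density lborel (q p)) A + emeasure (Nb p) A)) \<and>
     (\<exists>C::real. \<forall>p\<in>\<M>. emeasure (Nb p) UNIV \<le> ennreal C) \<and>
     (\<exists>r0>0. \<forall>r. 0 < r \<and> r < r0 \<longrightarrow>
        (\<exists>A1::real. \<forall>p\<in>\<M>. \<forall>x>0.
            exp (r * x) * \<bar>q p x - 1 / mean p\<bar> \<le> A1 \<and> exp (r * x) * q p (-x) \<le> A1) \<and>
        (\<exists>A2::real. \<forall>p\<in>\<M>. \<forall>x>0.
            exp (r * x) * measure (Nb p) ({..-x} \<union> {x..}) \<le> A2))"
proof -
  obtain c where c: "0 < c" "\<And>p. p \<in> \<M> \<Longrightarrow> c \<le> mean p" using mean_pos by auto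
  obtain \<tau> C where \<tau>: "0 < \<tau>" and C: "\<And>p. p \<in> \<M> \<Longrightarrow> (\<integral>\<^sup>+x. ennreal (exp (\<tau> * \<bar>x\<bar>)) \<partial>p) \<le> ennreal C"
    using expmom by auto
  obtain \<gamma> T B where \<gamma>: "\<gamma> < 1" and T: "0 < T" and dec: "\<forall>p\<in>\<M>.
        \<exists>lam \<Phi> \<Psi> \<phi> \<phi>2. 0 \<le> lam \<and> lam \<le> \<gamma> \<and>
          real_prob \<Phi> \<and> real_prob \<Psi> \<and>
          (\<forall>x. 0 \<le> \<phi> x) \<and> \<phi> \<in> borel_measurable borel \<and> \<Phi> = density lborel \<phi> \<and>
          (\<forall>A\<in>sets borel. measure p A = (1 - lam) * measure \<Phi> A + lam * measure \<Psi> A) \<and>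
          C02_with T \<phi> \<phi>2 \<and>
          integral {-T..T} (\<lambda>x. \<bar>\<phi>2 x\<bar>) \<le> B"
    using decomp by blast
  \<comment> \<open>Enlarging to \<open>max C 1\<close> and \<open>max \<gamma> 0\<close> meets the
    normalisations of the locale and keeps the mass bound below 1.\<close>
  interpret renewal_constants c \<tau> "max C 1" "max \<gamma> 0" T B
    by unfold_locales (use c \<tau> \<gamma> T in auto)
  define K where "K r = decay_const r r * (LINT t|lborel. 1 / (r\<^sup>2 + t\<^sup>2)) + exp (r * T) / c" for r
  \<comment> \<open>Bundles everything required of one pair for one measure, with bounds free of
    \<open>p\<close>, so that a single choice over the family yields the functions \<open>q\<close>
    and \<open>N\<close>.\<close>
  define good where "good p q N \<longleftrightarrow> (\<forall>x. 0 \<le> q x) \<and> q \<in> borel_measurable borel \<and> sets N = sets borel \<and>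
     (\<forall>A\<in>sets borel. emeasure (renewal_measure p) A = emeasure (density lborel q) A + emeasure N A) \<and>
     emeasure N UNIV \<le> ennreal (2 / (1 - max \<gamma> 0)) \<and>
     (\<forall>r x. 0 < r \<and> r < r0 \<and> 0 < x \<longrightarrow>
        exp (r * x) * \<bar>q x - 1 / mean p\<bar> \<le> K r \<and> exp (r * x) * q (-x) \<le> K r \<and>
        exp (r * x) * measure N ({..-x} \<union> {x..}) \<le> 2 / (1 - max \<gamma> 0))" for p q N
  have "\<forall>p\<in>\<M>. \<exists>q N. good p q N"
  proof
    fix p assume p: "p \<in> \<M>"
    then obtain lam \<Phi> \<Psi> \<phi> \<phi>2 where d: "0 \<le> lam \<and> lam \<le> \<gamma> \<and>
          real_prob \<Phi> \<and> real_prob \<Psi> \<and>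
          (\<forall>x. 0 \<le> \<phi> x) \<and> \<phi> \<in> borel_measurable borel \<and> \<Phi> = density lborel \<phi> \<and>
          (\<forall>A\<in>sets borel. measure p A = (1 - lam) * measure \<Phi> A + lam * measure \<Psi> A) \<and>
          C02_with T \<phi> \<phi>2 \<and>
          integral {-T..T} (\<lambda>x. \<bar>\<phi>2 x\<bar>) \<le> B"
      using dec by blast
    have "(\<integral>\<^sup>+x. ennreal (exp (\<tau> * \<bar>x\<bar>)) \<partial>p) \<le> ennreal (max C 1)"
      using C[OF p] by (rule order_trans) (simp add: ennreal_leI)
    moreover have "real_distribution p"
      using fam p by (auto simp: real_prob_def intro!: real_distribution.intro real_distribution_axioms.intro)
    moreover have "0 \<le> lam \<and> lam \<le> max \<gamma> 0 \<and> real_prob \<Phi> \<and> real_prob \<Psi> \<and>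
          (\<forall>x. 0 \<le> \<phi> x) \<and> \<phi> \<in> borel_measurable borel \<and> \<Phi> = density lborel \<phi> \<and>
          (\<forall>A\<in>sets borel. measure p A = (1 - lam) * measure \<Phi> A + lam * measure \<Psi> A) \<and>
          C02_with T \<phi> \<phi>2 \<and> integral {-T..T} (\<lambda>x. \<bar>\<phi>2 x\<bar>) \<le> B"
      using d by auto
    ultimately show "\<exists>q N. good p q N"
      unfolding good_def K_def using c(2)[OF p] by (intro renewal_measure_decomposition_uniform)
  qed
  then obtain q N where good: "\<And>p. p \<in> \<M> \<Longrightarrow> good p (q p) (N p)" by metis
  show ?thesis
  proof (intro exI[of _ q] exI[of _ N] conjI ballI)
    show "\<exists>r0>0. \<forall>r. 0 < r \<and> r < r0 \<longrightarrow>
        (\<exists>A1::real. \<forall>p\<in>\<M>. \<forall>x>0.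
            exp (r * x) * \<bar>q p x - 1 / mean p\<bar> \<le> A1 \<and> exp (r * x) * q p (-x) \<le> A1) \<and>
        (\<exists>A2::real. \<forall>p\<in>\<M>. \<forall>x>0. exp (r * x) * measure (N p) ({..-x} \<union> {x..}) \<le> A2)"
    proof (rule exI[of _ r0], intro conjI allI impI r0(1))
      fix r assume r: "0 < r \<and> r < r0"
      show "\<exists>A1::real. \<forall>p\<in>\<M>. \<forall>x>0.
            exp (r * x) * \<bar>q p x - 1 / mean p\<bar> \<le> A1 \<and> exp (r * x) * q p (-x) \<le> A1"
        using good r unfolding good_def by (intro exI[of _ "K r"]) blast
      show "\<exists>A2::real. \<forall>p\<in>\<M>. \<forall>x>0. exp (r * x) * measure (N p) ({..-x} \<union> {x..}) \<le> A2"
        using good r unfolding good_def by (intro exI[of _ "2 / (1 - max \<gamma> 0)"]) blast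
    qed
    show "\<exists>C::real. \<forall>p\<in>\<M>. emeasure (N p) UNIV \<le> ennreal C"
      using good unfolding good_def by blast
  qed (use good in \<open>auto simp: good_def\<close>)
qed

end
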